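(* For every integer $m\geq 1$ and every real skew-symmetric matrix $\Theta=(\theta_{p,q})_{1\leq p,q\leq [m/2]}$, one has $K_0(C_{\mathrm{alg}}(\mathbb{R}_{\Theta}^{m}))\cong\mathbb{Z}$ and $K_0(C^\infty_{\mathrm{alg}}(\mathbb{R}_{\Theta}^{m}))\cong\mathbb{Z}$.
   Context: Here $[m/2]$ is the integer part of $m/2$, $\mathbb{N}=\{0,1,2,\ldots\}$, and $\lambda_{p,q}:=e^{i\theta_{p,q}}$ with $\theta_{p,q}=-\theta_{q,p}\in\mathbb{R}$. **The algebra $C_{\mathrm{alg}}(\mathbb{R}_{\Theta}^{m})$.** For $m=2n$ even, $C_{\mathrm{alg}}(\mathbb{R}_{\Theta}^{2n})$ is the complex unital associative $*$-algebra generated by $2n$ elements $z_p,\bar z_q$ ($p,q=1,\ldots,n$) with relations $$z_pz_q=\lambda_{p,q}z_qz_p,\quad \bar z_p\bar z_q=\lambda_{p,q}\bar z_q\bar z_p,\quad \bar z_pz_q=\lambda_{q,p}z_q\bar z_p,\quad z_p^*=\bar z_p\qquad (p,q=1,\ldots,n).$$ Every element is a finite sum $\sum a_{p_1,\ldots,p_n,q_1,\ldots,q_n}z_1^{p_1}\cdots z_n^{p_n}\bar z_1^{q_1}\cdots\bar z_n^{q_n}$ with complex coefficients and exponents in $\mathbb{N}$. For $m=2n+1$ odd, $C_{\mathrm{alg}}(\mathbb{R}_{\Theta}^{2n+1})$ is the unital complex $*$-algebra obtained by adding to $C_{\mathrm{alg}}(\mathbb{R}_{\Theta}^{2n})$ a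 hermitian generator $x$ ($x^*=x$) with relations $xz_p=z_px$ ($p=1,\ldots,n$); hence $x$ is central. **The smooth version $C^\infty_{\mathrm{alg}}(\mathbb{R}_{\Theta}^{m})$.** For $m=2n$, it is the $*$-algebra of formal series $$\sum_{p_1,\ldots,p_n,q_1,\ldots,q_n=0}^\infty a_{p_1,\ldots,p_n,q_1,\ldots,q_n}z_1^{p_1}\cdots z_n^{p_n}\bar z_1^{q_1}\cdots\bar z_n^{q_n}$$ whose coefficient function $\mathbb{N}^{2n}\to\mathbb{C}$ belongs to the Schwartz space $\mathcal{S}(\mathbb{N}^{2n})$, i.e. for every $r\geq 1$ there is a constant $C_r$ with $$\sup_{(p_1,\ldots,p_n,q_1,\ldots,q_n)\in\mathbb{N}^{2n}}\Big(1+\sum_{k=1}^n(p_k^2+q_k^2)\Big)^r|a_{p_1,\ldots,p_n,q_1,\ldots,q_n}|<C_r,$$ with multiplication and involution given by extending those of $C_{\mathrm{alg}}(\mathbb{R}_{\Theta}^{2n})$ term by term (using the relations $z_pz_q=\lambda_{p,q}z_qz_p$, $\bar z_p\bar z_q=\lambda_{p,q}\bar z_q\bar z_p$, $\bar z_pz_q=\lambda_{q,p}z_q\bar z_p$ and $z_p^*=\bar z_p$ for $p,q=1,\ldots,n$ to reorder monomials). For $m=2n+1$, $C^\infty_{\mathrm{alg}}(\mathbb{R}_{\Theta}^{2n+1})$ is defined in the same way, with formal series in the monomials $x^{p_0}z_1^{p_1}\cdots z_n^{p_n}\bar z_1^{q_1}\cdots\bar z_n^{q_n}$ and coefficient functions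 in $\mathcal{S}(\mathbb{N}^{2n+1})$. **The group $K_0$.** For a unital $*$-algebra $A$, a projector of $A$ is a square matrix $p$ (of any size) with entries in $A$ such that $p^2=p=p^*$, where $(p^* )_{k,l}=(p_{l,k})^*$. $P(A)$ is the set of projectors of $A$. For $p,q\in P(A)$ put $p+q:=\begin{pmatrix}p&0\\0&q\end{pmatrix}$, and write $p\sim q$ if there is a unitary $u\in M_N(A)$ for some suitable $N$ such that $\begin{pmatrix}p&0\\0&0\end{pmatrix}=u\begin{pmatrix}q&0\\0&0\end{pmatrix}u^*$, where $p$ and $q$ are padded with zeros to size $N\times N$. Then $P(A)/\sim$ is a semigroup under $+$, and $K_0(A)$ is its Grothendieck group. *)

theory Defs
  imports
    Complex_Main
    "HOL-Library.Poly_Mapping"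
    "HOL-Algebra.QuotRing"
    "HOL-Algebra.Elementary_Groups"
    "Jordan_Normal_Form.Matrix"
begin

section \<open>Complex $*$-algebras with explicit carrier\<close>

record 'a star_algebra = "(complex, 'a) module" +
  star :: "'a \<Rightarrow> 'a"


section \<open>The group $K_0$\<close>

text \<open>
  The type \<^typ>\<open>'a mat\<close> is only used as a container: the matrix operations of the library
  are those of a type class, whereas the entries here live in an algebra with a carrier.
\<close>

definition mats :: "('a, 'm) star_algebra_scheme \<Rightarrow> nat \<Rightarrow> nat \<Rightarrow> 'a mat set" where
  "mats A r c = {p \<in> carrier_mat r c. \<forall>i<r. \<forall>j<c. p $$ (i, j) \<in> carrier A}"

definition mmult :: "('a, 'm) star_algebra_scheme \<Rightarrow> 'a mat \<Rightarrow> 'a mat \<Rightarrow> 'a mat" where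
  "mmult A p q = mat (dim_row p) (dim_col q)
     (\<lambda>(i, j). \<Oplus>\<^bsub>A\<^esub>k\<in>{..<dim_col p}. p $$ (i, k) \<otimes>\<^bsub>A\<^esub> q $$ (k, j))"

definition madjoint :: "('a, 'm) star_algebra_scheme \<Rightarrow> 'a mat \<Rightarrow> 'a mat" where
  "madjoint A p = mat (dim_col p) (dim_row p) (\<lambda>(k, l). star A (p $$ (l, k)))"

definition mone :: "('a, 'm) star_algebra_scheme \<Rightarrow> nat \<Rightarrow> 'a mat" where
  "mone A N = mat N N (\<lambda>(i, j). if i = j then \<one>\<^bsub>A\<^esub> else \<zero>\<^bsub>A\<^esub>)"

definition mzero :: "('a, 'm) star_algebra_scheme \<Rightarrow> nat \<Rightarrow> nat \<Rightarrow> 'a mat" where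
  "mzero A r c = mat r c (\<lambda>_. \<zero>\<^bsub>A\<^esub>)"

definition dsum :: "('a, 'm) star_algebra_scheme \<Rightarrow> 'a mat \<Rightarrow> 'a mat \<Rightarrow> 'a mat" where
  "dsum A p q =
     four_block_mat p (mzero A (dim_row p) (dim_col q)) (mzero A (dim_row q) (dim_col p)) q"

definition pad :: "('a, 'm) star_algebra_scheme \<Rightarrow> nat \<Rightarrow> 'a mat \<Rightarrow> 'a mat" where
  "pad A N p = dsum A p (mzero A (N - dim_row p) (N - dim_col p))"

definition projectors :: "('a, 'm) star_algebra_scheme \<Rightarrow> 'a mat set" where
  "projectors A = {p. \<exists>N. p \<in> mats A N N \<and> mmult A p p = p \<and> madjoint A p = p}"

definition unitaries :: "('a, 'm) star_algebra_scheme \<Rightarrow> nat \<Rightarrow> 'a mat set" where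
  "unitaries A N = {u \<in> mats A N N.
     mmult A u (madjoint A u) = mone A N \<and> mmult A (madjoint A u) u = mone A N}"

definition proj_equiv :: "('a, 'm) star_algebra_scheme \<Rightarrow> ('a mat \<times> 'a mat) set" where
  "proj_equiv A = {(p, q). p \<in> projectors A \<and> q \<in> projectors A \<and>
     (\<exists>N u. dim_row p \<le> N \<and> dim_row q \<le> N \<and> u \<in> unitaries A N \<and>
        pad A N p = mmult A (mmult A u (pad A N q)) (madjoint A u))}"

text \<open>
  The semigroup $P(A)/{\sim}$ with $[p] + [q] = [p + q]$, written multiplicatively as is usual
  for monoid records; its unit is the class of the zero projector.
\<close>

definition proj_classes :: "('a, 'm) star_algebra_scheme \<Rightarrow> 'a mat set monoid" where
  "proj_classes A =
     \<lparr>carrier = projectors A // proj_equiv A,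
      monoid.mult = (\<lambda>X Y. \<Union>p\<in>X. \<Union>q\<in>Y. proj_equiv A `` {dsum A p q}),
      one = proj_equiv A `` {mzero A 1 1}\<rparr>"

text \<open>
  The Grothendieck group of a commutative monoid: a pair $(a, b)$ stands for the formal
  difference of $a$ and $b$.
\<close>

definition groth_rel :: "('b, 'm) monoid_scheme \<Rightarrow> (('b \<times> 'b) \<times> ('b \<times> 'b)) set" where
  "groth_rel S = {((a, b), (c, d)).
     a \<in> carrier S \<and> b \<in> carrier S \<and> c \<in> carrier S \<and> d \<in> carrier S \<and>
     (\<exists>e\<in>carrier S. a \<otimes>\<^bsub>S\<^esub> d \<otimes>\<^bsub>S\<^esub> e = c \<otimes>\<^bsub>S\<^esub> b \<otimes>\<^bsub>S\<^esub> e)}"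

definition grothendieck_group :: "('b, 'm) monoid_scheme \<Rightarrow> ('b \<times> 'b) set monoid" where
  "grothendieck_group S =
     \<lparr>carrier = (carrier S \<times> carrier S) // groth_rel S,
      monoid.mult = (\<lambda>X Y. \<Union>(a, b)\<in>X. \<Union>(c, d)\<in>Y. groth_rel S `` {(a \<otimes>\<^bsub>S\<^esub> c, b \<otimes>\<^bsub>S\<^esub> d)}),
      one = groth_rel S `` {(\<one>\<^bsub>S\<^esub>, \<one>\<^bsub>S\<^esub>)}\<rparr>"

definition K0 :: "('a, 'm) star_algebra_scheme \<Rightarrow> ('a mat set \<times> 'a mat set) set monoid" where
  "K0 A = grothendieck_group (proj_classes A)"


section \<open>The free $*$-algebra on the generators\<close>

text \<open>\<open>Z p\<close>, \<open>Zb p\<close> and \<open>X\<close> stand for $z_p$, $\bar z_p$ and $x$.\<close>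

datatype letter = X | Z nat | Zb nat

text \<open>The list order is the order of the factors in a standard monomial.\<close>

definition gens :: "nat \<Rightarrow> letter list" where
  "gens m = (if odd m then [X] else []) @ map Z [1..<m div 2 + 1] @ map Zb [1..<m div 2 + 1]"

fun bar :: "letter \<Rightarrow> letter" where
  "bar X = X"
| "bar (Z p) = Zb p"
| "bar (Zb p) = Z p"

text \<open>
  Words form a monoid under concatenation, which turns \<^typ>\<open>letter list \<Rightarrow>\<^sub>0 complex\<close> into
  the free algebra on all letters.
\<close>

instantiation list :: (type) monoid_add
begin

definition zero_list :: "'a list" where "zero_list = []"

definition plus_list :: "'a list \<Rightarrow> 'a list \<Rightarrow> 'a list" where "plus_list = (@)"

instance by standard (simp_all add: zero_list_def plus_list_def)

end

type_synonym free = "letter list \<Rightarrow>\<^sub>0 complex"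

abbreviation word :: "letter list \<Rightarrow> free" where
  "word w \<equiv> Poly_Mapping.single w 1"

definition free_scale :: "complex \<Rightarrow> free \<Rightarrow> free" where
  "free_scale c f = Poly_Mapping.map (\<lambda>a. c * a) f"

definition star_word :: "letter list \<Rightarrow> letter list" where
  "star_word w = rev (map bar w)"

text \<open>
  The antilinear antimultiplicative map that exchanges \<open>Z p\<close> and \<open>Zb p\<close> and fixes \<open>X\<close>; this
  encodes the relations $z_p^* = \bar z_p$ and $x^* = x$. (\<^term>\<open>star_word\<close> is an involution, so
  \<^term>\<open>Poly_Mapping.map_key star_word\<close> moves the coefficient of a word to the starred word.)
\<close>

definition free_star :: "free \<Rightarrow> free" where
  "free_star f = Poly_Mapping.map cnj (Poly_Mapping.map_key star_word f)"

definition free_alg :: "nat \<Rightarrow> free star_algebra" where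
  "free_alg m =
     \<lparr>carrier = {f. \<forall>w\<in>Poly_Mapping.keys f. set w \<subseteq> set (gens m)},
      monoid.mult = (*), one = 1, zero = 0, add = (+), smult = free_scale, star = free_star\<rparr>"


section \<open>The algebra $C_{\mathrm{alg}}(\mathbb{R}^m_\Theta)$\<close>

definition lam :: "(nat \<Rightarrow> nat \<Rightarrow> real) \<Rightarrow> nat \<Rightarrow> nat \<Rightarrow> complex" where
  "lam \<Theta> p q = exp (\<i> * complex_of_real (\<Theta> p q))"

definition relators :: "nat \<Rightarrow> (nat \<Rightarrow> nat \<Rightarrow> real) \<Rightarrow> free set" where
  "relators m \<Theta> =
     (\<Union>p\<in>{1..m div 2}. \<Union>q\<in>{1..m div 2}.
        {word [Z p, Z q] - free_scale (lam \<Theta> p q) (word [Z q, Z p]),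
         word [Zb p, Zb q] - free_scale (lam \<Theta> p q) (word [Zb q, Zb p]),
         word [Zb p, Z q] - free_scale (lam \<Theta> q p) (word [Z q, Zb p])})
     \<union> (if odd m then {word [X, Z p] - word [Z p, X] | p. p \<in> {1..m div 2}} else {})"

text \<open>
  The adjoints of the relators are added because the relations are those of a $*$-algebra: for
  instance $x \bar z_p = \bar z_p x$ follows from $x z_p = z_p x$ only by taking adjoints.
\<close>

definition rel_ideal :: "nat \<Rightarrow> (nat \<Rightarrow> nat \<Rightarrow> real) \<Rightarrow> free set" where
  "rel_ideal m \<Theta> = Idl\<^bsub>free_alg m\<^esub> (relators m \<Theta> \<union> free_star ` relators m \<Theta>)"

text \<open>
  In \<open>smult\<close> the summand \<open>rel_ideal m \<Theta>\<close> is only needed for the scalar 0, where the image of a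
  coset is not itself a coset.
\<close>

definition C_alg :: "nat \<Rightarrow> (nat \<Rightarrow> nat \<Rightarrow> real) \<Rightarrow> free set star_algebra" where
  "C_alg m \<Theta> =
     \<lparr>carrier = carrier (free_alg m Quot rel_ideal m \<Theta>),
      monoid.mult = monoid.mult (free_alg m Quot rel_ideal m \<Theta>),
      one = \<one>\<^bsub>free_alg m Quot rel_ideal m \<Theta>\<^esub>,
      zero = \<zero>\<^bsub>free_alg m Quot rel_ideal m \<Theta>\<^esub>,
      add = ring.add (free_alg m Quot rel_ideal m \<Theta>),
      smult = (\<lambda>c C. rel_ideal m \<Theta> <+>\<^bsub>free_alg m\<^esub> (free_scale c ` C)),
      star = (\<lambda>C. free_star ` C)\<rparr>"


section \<open>The algebra $C^\infty_{\mathrm{alg}}(\mathbb{R}^m_\Theta)$\<close>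

text \<open>
  Multi-indices in $\mathbb{N}^m$ are functions on letters that vanish outside the generators.
\<close>

type_synonym multiindex = "letter \<Rightarrow> nat"

definition multiindices :: "nat \<Rightarrow> multiindex set" where
  "multiindices m = {k. \<forall>g. g \<notin> set (gens m) \<longrightarrow> k g = 0}"

definition schwartz :: "nat \<Rightarrow> (multiindex \<Rightarrow> complex) set" where
  "schwartz m = {a. (\<forall>k. k \<notin> multiindices m \<longrightarrow> a k = 0) \<and>
     (\<forall>r\<ge>1. \<exists>C. \<forall>k\<in>multiindices m.
        (1 + (\<Sum>g\<in>set (gens m). (real (k g))\<^sup>2)) ^ r * cmod (a k) < C)}"

text \<open>
  The standard monomial
  $x^{k(x)} z_1^{k(z_1)} \cdots z_n^{k(z_n)} \bar z_1^{k(\bar z_1)} \cdots \bar z_n^{k(\bar z_n)}$.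
\<close>

definition monomial :: "nat \<Rightarrow> multiindex \<Rightarrow> letter list" where
  "monomial m k = concat (map (\<lambda>g. replicate (k g) g) (gens m))"

fun precedes :: "letter \<Rightarrow> letter \<Rightarrow> bool" where
  "precedes X h \<longleftrightarrow> h \<noteq> X"
| "precedes (Z p) (Z q) \<longleftrightarrow> p < q"
| "precedes (Z p) (Zb q) \<longleftrightarrow> True"
| "precedes (Zb p) (Zb q) \<longleftrightarrow> p < q"
| "precedes _ _ \<longleftrightarrow> False"

text \<open>
  \<open>swap \<Theta> g h\<close> is the scalar with $g h = \mathrm{swap}\,\Theta\,g\,h \cdot h g$ in the algebra; the
  case $(z_p, \bar z_q)$ is the relation $\bar z_q z_p = \lambda_{p,q} z_p \bar z_q$ read backwards.
\<close>

fun swap :: "(nat \<Rightarrow> nat \<Rightarrow> real) \<Rightarrow> letter \<Rightarrow> letter \<Rightarrow> complex" where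
  "swap \<Theta> (Z p) (Z q) = lam \<Theta> p q"
| "swap \<Theta> (Zb p) (Zb q) = lam \<Theta> p q"
| "swap \<Theta> (Zb p) (Z q) = lam \<Theta> q p"
| "swap \<Theta> (Z p) (Zb q) = lam \<Theta> q p"
| "swap \<Theta> _ _ = 1"

text \<open>
  Reordering a word into a standard monomial multiplies it by this scalar: each letter is moved
  to the right past all later letters that have to stand before it.
\<close>

fun reorder :: "(nat \<Rightarrow> nat \<Rightarrow> real) \<Rightarrow> letter list \<Rightarrow> complex" where
  "reorder \<Theta> [] = 1"
| "reorder \<Theta> (g # w) = prod_list (map (swap \<Theta> g) (filter (\<lambda>h. precedes h g) w)) * reorder \<Theta> w"

text \<open>
  A formal series is represented by its coefficient function. The product of the monomials with exponents
  \<open>i\<close> and \<open>j\<close> is a multiple of the monomial with exponent \<open>i + j\<close>, and the adjoint of the monomial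
  with exponent \<open>k \<circ> bar\<close> is a multiple of the one with exponent \<open>k\<close>.
\<close>

definition C_smooth :: "nat \<Rightarrow> (nat \<Rightarrow> nat \<Rightarrow> real) \<Rightarrow> (multiindex \<Rightarrow> complex) star_algebra" where
  "C_smooth m \<Theta> =
     \<lparr>carrier = schwartz m,
      monoid.mult = (\<lambda>a b k. \<Sum>(i, j) \<in> {(i, j). i \<in> multiindices m \<and> j \<in> multiindices m \<and>
                                      (\<forall>g. i g + j g = k g)}.
                a i * b j * reorder \<Theta> (monomial m i @ monomial m j)),
      one = (\<lambda>k. if k = (\<lambda>_. 0) then 1 else 0),
      zero = (\<lambda>_. 0),
      add = (\<lambda>a b k. a k + b k),
      smult = (\<lambda>c a k. c * a k),
      star = (\<lambda>a k. cnj (a (k \<circ> bar)) * reorder \<Theta> (star_word (monomial m (k \<circ> bar))))\<rparr>"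

end

theory Submission
  imports
    Defs
    "HOL-Library.Function_Algebras"
    "HOL-Computational_Algebra.Formal_Power_Series"
    "Jordan_Normal_Form.Determinant"
begin

text \<open>
  Both algebras embed, by an injective unital $*$-homomorphism, into the algebra of all formal
  series in the standard monomials with the twisted convolution product: for the smooth algebra
  this is its definition, and for the polynomial algebra it says that the standard monomials are
  linearly independent modulo the relations (\<open>I_eq_kernel\<close>). The images contain the
  constants. Taking the constant term is a $*$-homomorphism to the complex numbers, so
  the trace of the constant term of a projector is invariant under unitary equivalence; it is the
  rank of a complex projection, hence a natural number, it is additive under block sums, and it
  takes every value on identity matrices. Therefore $K_0$ is the group of integers as soon as
  this trace is a complete invariant, and for that it suffices to conjugate every projector, by a
  unitary over the algebra itself, into a diagonal matrix of ones and zeros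
  (\<open>series_representation.K0_iso_integers\<close>). A projector with constant entries is conjugated by
  a complex unitary, so the point is to reach constant entries.

  For the polynomial algebra there is nothing to conjugate: a projector is already constant
  (\<open>finite_support_projection_constant\<close>). A diagonal entry of $p = p p^*$ is a sum of terms
  $a a^*$, whose leading coefficients cannot cancel. The appropriate notion of leading term is
  given by the multidegree of a monomial that does not distinguish $z_i$ from $\bar z_i$; the
  twist only contributes a phase which depends on the multidegree alone
  (\<open>positivity_factor_cong\<close>).

  The smooth algebra is different: it has non-constant projectors, and no useful spectral theory,
  since an element $1 + a^* a$ need not be invertible in it. A projector $p$ is joined to its
  constant term by the projectors $p_t$ obtained by multiplying the coefficients in degree $d$ by
  $t^d$, where $0 \le t \le 1$, and this path is Lipschitz for the $\ell^1$ norm of the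
  coefficients. Neighbouring projections $p$, $q$ on the path are conjugate by the direct rotation
  $(p q + (1 - p)(1 - q)) (1 - (p - q)^2)^{-1/2}$. The constant term of $p - q$ vanishes, so the
  inverse square root makes sense as a formal series without any convergence, and all algebraic
  identities are checked degree by degree (\<open>direct_rotation_exists\<close>). If the $\ell^1$ norm
  of $p - q$ is less than 1, the coefficients of the inverse square root are rapidly decreasing: with
  $x = (p - q)^2$, the moments of the powers $x^n$ grow no faster than $\rho^n$ for any $\rho$ greater than the $\ell^1$ norm of $x$, by the
  Leibniz rule for the degree (\<open>mat_norm_mpow_bound\<close>, \<open>tempered_isqrt\<close>).
\<close>

section \<open>Products over pairs of letters of a word\<close>

text \<open>
  The scalar that reorders a word is a product over the pairs of its positions. Writing such
  scalars as \<open>pairprod\<close> reduces their invariance properties to symmetries of the function of two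
  letters.
\<close>

fun pairprod :: "('a \<Rightarrow> 'a \<Rightarrow> 'b::comm_monoid_mult) \<Rightarrow> 'a list \<Rightarrow> 'b" where
  "pairprod f [] = 1"
| "pairprod f (g # w) = prod_list (map (f g) w) * pairprod f w"

lemma prod_list_map_mset: "prod_list (map f w) = prod_mset (image_mset f (mset w))"
  by (simp add: prod_mset_prod_list[symmetric])

lemma pairprod_insert:
  assumes "\<forall>h\<in>set v. f g h = f h g"
  shows "pairprod f (v @ g # w) = pairprod f (g # v @ w)"
  using assms by (induction v) (auto simp: ac_simps)

text \<open>
  A letter can be moved to the front of the word without changing any of the factors, up to the
  order of the two arguments.
\<close>

lemma pairprod_mset_cong:
  assumes "\<And>g h. g \<in> set w \<Longrightarrow> h \<in> set w \<Longrightarrow> f g h = f h g" and "mset w = mset v"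
  shows "pairprod f w = pairprod f v"
  using assms
proof (induction w arbitrary: v)
  case Nil
  then show ?case by simp
next
  case (Cons a w)
  have "a \<in> set v" using Cons.prems(2) by (metis list.set_intros(1) set_mset_mset)
  then obtain v1 v2 where v: "v = v1 @ a # v2" by (meson split_list)
  have m: "mset w = mset (v1 @ v2)" using Cons.prems(2) v by simp
  have s: "set v = set (a # w)" using Cons.prems(2) by (metis set_mset_mset)
  have "pairprod f v = pairprod f (a # v1 @ v2)"
    unfolding v by (rule pairprod_insert) (use Cons.prems(1) s v in auto)
  also have "\<dots> = prod_list (map (f a) (v1 @ v2)) * pairprod f w"
    using Cons.IH[OF _ m] Cons.prems(1) by simp
  also have "prod_list (map (f a) (v1 @ v2)) = prod_list (map (f a) w)"
    unfolding prod_list_map_mset m ..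
  finally show ?case by simp
qed

lemma pairprod_cong:
  "(\<And>g h. g \<in> set w \<Longrightarrow> h \<in> set w \<Longrightarrow> f g h = f' g h) \<Longrightarrow> pairprod f w = pairprod f' w"
  by (induction w) (auto intro!: arg_cong2[where f="(*)"] arg_cong[where f=prod_list])

lemma pairprod_mult: "pairprod (\<lambda>g h. f g h * f' g h) w = pairprod f w * pairprod f' w"
proof (induction w)
  case (Cons g w)
  have "prod_list (map (\<lambda>h. f g h * f' g h) w) = prod_list (map (f g) w) * prod_list (map (f' g) w)"
    by (induction w) (auto simp: ac_simps)
  then show ?case using Cons by (simp add: ac_simps)
qed simp

lemma pairprod_map: "pairprod f (map t w) = pairprod (\<lambda>g h. f (t g) (t h)) w"
  by (induction w) (auto simp: o_def)

definition cross :: "('a \<Rightarrow> 'b \<Rightarrow> 'c::comm_monoid_mult) \<Rightarrow> 'a list \<Rightarrow> 'b list \<Rightarrow> 'c" where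
  "cross f w v = prod_list (map (\<lambda>g. prod_list (map (f g) v)) w)"

lemma cross_simps [simp]:
  "cross f [] v = 1"
  "cross f (g # w) v = prod_list (map (f g) v) * cross f w v"
  "cross f (w @ w') v = cross f w v * cross f w' v"
  by (simp_all add: cross_def)

lemma cross_append_right: "cross f w (v @ v') = cross f w v * cross f w v'"
  by (induction w) (simp_all add: ac_simps)

lemma cross_Nil_right [simp]: "cross f w [] = 1"
  by (induction w) auto

lemma cross_Cons_right: "cross f w (h # v) = prod_list (map (\<lambda>g. f g h) w) * cross f w v"
  by (induction w) (auto simp: ac_simps)

lemma cross_mset_cong:
  assumes "mset w = mset w'" "mset v = mset v'"
  shows "cross f w v = cross f w' v'"
  using assms unfolding cross_def prod_list_map_mset by simp

lemma pairprod_append: "pairprod f (w @ v) = pairprod f w * pairprod f v * cross f w v"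
  by (induction w) (auto simp: ac_simps)

lemma pairprod_rev: "pairprod f (rev w) = pairprod (\<lambda>g h. f h g) w"
  by (induction w) (auto simp: pairprod_append cross_Cons_right simp flip: rev_map
      simp: prod_list_map_mset ac_simps)

text \<open>
  Starring reverses the word, so each pair is read backwards and with bars.
\<close>

lemma pairprod_star_word: "pairprod f (star_word w) = pairprod (\<lambda>g h. f (bar h) (bar g)) w"
  by (simp add: star_word_def pairprod_rev pairprod_map)

section \<open>Reordering words\<close>

text \<open>
  The factor that a pair of letters, in this order in a word, contributes to \<open>reorder\<close>: it is
  trivial unless the pair is an inversion.
\<close>

definition transp :: "(nat \<Rightarrow> nat \<Rightarrow> real) \<Rightarrow> letter \<Rightarrow> letter \<Rightarrow> complex" where
  "transp \<Theta> g h = (if precedes h g then swap \<Theta> g h else 1)"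

lemma reorder_eq_pairprod: "reorder \<Theta> w = pairprod (transp \<Theta>) w"
proof (induction w)
  case (Cons g w)
  have "prod_list (map (swap \<Theta> g) (filter (\<lambda>h. precedes h g) w)) = prod_list (map (transp \<Theta> g) w)"
    by (induction w) (auto simp: transp_def)
  then show ?case using Cons by simp
qed simp

lemma cmod_lam [simp]: "cmod (lam \<Theta> p q) = 1"
  by (simp add: lam_def)

lemma cmod_swap: "cmod (swap \<Theta> g h) = 1"
  by (cases "(\<Theta>, g, h)" rule: swap.cases) auto

lemma cmod_transp: "cmod (transp \<Theta> g h) = 1"
  by (simp add: transp_def cmod_swap)

lemma cmod_prod_list_1: "(\<And>g. cmod (f g) = 1) \<Longrightarrow> cmod (prod_list (map f w)) = 1"
  by (induction w) (auto simp: norm_mult)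

lemma cmod_reorder [simp]: "cmod (reorder \<Theta> w) = 1"
  unfolding reorder_eq_pairprod
  by (induction w) (auto simp: norm_mult cmod_prod_list_1 cmod_transp)

lemma cnj_mult_unit: "cmod z = 1 \<Longrightarrow> cnj z * z = 1" "cmod z = 1 \<Longrightarrow> z * cnj z = 1"
  using complex_norm_square[of z] by (simp_all add: mult.commute)

lemma bar_bar [simp]: "bar (bar g) = g" by (cases g) auto

lemma bar_eq_iff: "bar g = h \<longleftrightarrow> g = bar h" by (metis bar_bar)

lemma bar_comp_bar [simp]: "bar \<circ> bar = id" by auto

lemma star_word_append: "star_word (w @ v) = star_word v @ star_word w"
  by (simp add: star_word_def)

lemma star_word_star_word [simp]: "star_word (star_word w) = w"
  by (simp add: star_word_def rev_map)

lemma count_star_word: "count (mset (star_word w)) = count (mset w) \<circ> bar"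
proof
  fix g
  have "count (mset (map bar w)) g = count (mset w) (bar g)"
    by (induction w) (auto simp: bar_eq_iff)
  then show "count (mset (star_word w)) g = (count (mset w) \<circ> bar) g"
    by (simp add: star_word_def)
qed

lemma set_gens: "g \<in> set (gens m) \<longleftrightarrow>
    (case g of X \<Rightarrow> odd m | Z p \<Rightarrow> p \<in> {1..m div 2} | Zb p \<Rightarrow> p \<in> {1..m div 2})"
  by (cases g) (auto simp: gens_def)

lemma bar_in_gens [simp]: "bar g \<in> set (gens m) \<longleftrightarrow> g \<in> set (gens m)"
  by (cases g) (auto simp: set_gens)

lemma sorted_upt_map:
  assumes "\<And>i j. i < j \<Longrightarrow> P (f i) (f j)"
  shows "sorted_wrt P (map f [a..<b])"
  using assms by (auto simp: sorted_wrt_iff_nth_less)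

lemma sorted_gens: "sorted_wrt precedes (gens m)"
  unfolding gens_def sorted_wrt_append
  by (auto intro!: sorted_upt_map simp del: upt_Suc upt_Suc_append)

lemma precedes_asym: "precedes g h \<Longrightarrow> \<not> precedes h g"
  by (cases g; cases h) auto

lemma precedes_irrefl [simp]: "\<not> precedes g g"
  by (cases g) auto

lemma distinct_gens [simp]: "distinct (gens m)"
  by (metis distinct_conv_nth precedes_irrefl sorted_gens sorted_wrt_iff_nth_less linorder_neqE_nat)

text \<open>
  Equal letters may be adjacent in a monomial, hence the negated form of the order.
\<close>

lemma monomial_sorted: "sorted_wrt (\<lambda>g h. \<not> precedes h g) (monomial m k)"
proof -
  have "sorted_wrt (\<lambda>g h. \<not> precedes h g) (concat (map (\<lambda>g. replicate (k g) g) gs))"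
    if "sorted_wrt precedes gs" for gs
    using that
  proof (induction gs)
    case (Cons a gs)
    have "sorted_wrt (\<lambda>g h. \<not> precedes h g) (replicate n a)" for n
      by (induction n) auto
    with Cons show ?case by (auto simp: sorted_wrt_append precedes_asym)
  qed simp
  from this[OF sorted_gens] show ?thesis by (simp add: monomial_def)
qed

lemma reorder_monomial [simp]: "reorder \<Theta> (monomial m k) = 1"
proof -
  have "reorder \<Theta> w = 1" if "sorted_wrt (\<lambda>g h. \<not> precedes h g) w" for w
    using that by (induction w) (auto simp: filter_empty_conv)
  with monomial_sorted show ?thesis by blast
qed

text \<open>
  Together with the next lemmas this allows any word to be replaced, inside an expression that
  only depends on the multiset of letters, by the standard monomial with the same exponents.
\<close>

lemma count_monomial:
  assumes "k \<in> multiindices m"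
  shows "count (mset (monomial m k)) = k"
proof
  fix g
  have "count (mset (concat (map (\<lambda>g. replicate (k g) g) gs))) g = (if g \<in> set gs then k g else 0)"
    if "distinct gs" for gs
    using that by (induction gs) auto
  from this[OF distinct_gens] show "count (mset (monomial m k)) g = k g"
    using assms by (auto simp: monomial_def multiindices_def)
qed

lemma set_monomial: "set (monomial m k) \<subseteq> set (gens m)"
  by (auto simp: monomial_def)

lemma mset_eq_monomialI:
  assumes "k \<in> multiindices m" "count (mset w) = k"
  shows "mset (monomial m k) = mset w"
  using count_monomial[OF assms(1)] assms(2) by (simp add: multiset_eq_iff)

lemma count_word_in_multiindices:
  "set w \<subseteq> set (gens m) \<Longrightarrow> count (mset w) \<in> multiindices m"
  by (auto simp: multiindices_def count_eq_zero_iff)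

section \<open>Commutation scalars for a skew-symmetric parameter\<close>

locale skew_parameter =
  fixes m :: nat and \<Theta> :: "nat \<Rightarrow> nat \<Rightarrow> real"
  assumes skew: "\<And>p q. p \<in> {1..m div 2} \<Longrightarrow> q \<in> {1..m div 2} \<Longrightarrow> \<Theta> p q = - \<Theta> q p"
begin

abbreviation "L \<equiv> set (gens m)"
abbreviation "MI \<equiv> multiindices m"
abbreviation "stdm \<equiv> monomial m"
abbreviation "R \<equiv> reorder \<Theta>"
abbreviation "\<beta> \<equiv> transp \<Theta>"

lemma lam_inverse: "p \<in> {1..m div 2} \<Longrightarrow> q \<in> {1..m div 2} \<Longrightarrow> lam \<Theta> p q * lam \<Theta> q p = 1"
  using skew[of p q] by (simp add: lam_def exp_add[symmetric] algebra_simps)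

lemma lam_diag: "p \<in> {1..m div 2} \<Longrightarrow> lam \<Theta> p p = 1"
  using skew[of p p] by (simp add: lam_def)

lemma swap_inverse: "g \<in> L \<Longrightarrow> h \<in> L \<Longrightarrow> swap \<Theta> g h * swap \<Theta> h g = 1"
  by (cases g; cases h) (auto simp: set_gens lam_inverse)

text \<open>
  The relation for a pair of letters is compatible with the star: swapping \<open>bar h\<close> and \<open>bar g\<close>
  costs the inverse of the scalar for swapping \<open>h\<close> and \<open>g\<close>. So an unordered pair contributes the
  same total scalar to a word and to its star, whichever letter comes first.
\<close>

lemma transp_star_symmetric:
  assumes "g \<in> L" "h \<in> L"
  shows "\<beta> g h * \<beta> (bar h) (bar g) = \<beta> h g * \<beta> (bar g) (bar h)"
  by (cases g; cases h; use assms in \<open>auto simp: transp_def set_gens lam_inverse\<close>)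

text \<open>
  The scalars of a word and of its star are related up to conjugation by this factor, which
  depends only on the letters and not on their order.
\<close>

definition star_factor :: "letter list \<Rightarrow> complex" where
  "star_factor w = R (star_word w) * R w"

lemma star_factor_eq_pairprod:
  "star_factor w = pairprod (\<lambda>g h. \<beta> g h * \<beta> (bar h) (bar g)) w"
  by (simp add: star_factor_def reorder_eq_pairprod pairprod_star_word pairprod_mult mult.commute)

lemma star_factor_mset_cong:
  assumes "set w \<subseteq> L" "mset w = mset v"
  shows "star_factor w = star_factor v"
  unfolding star_factor_eq_pairprod
  by (rule pairprod_mset_cong) (use assms transp_star_symmetric in auto)

lemma star_factor_append:
  "star_factor (w @ v) =
     star_factor w * star_factor v * cross \<beta> w v * cross \<beta> (star_word v) (star_word w)"
  by (simp add: star_factor_def star_word_append reorder_eq_pairprod pairprod_append)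

lemma star_factor_star: "star_factor (star_word w) = star_factor w"
  by (simp add: star_factor_def mult.commute)

lemma star_factor_monomial: "star_factor (stdm k) = R (star_word (stdm k))"
  by (simp add: star_factor_def)

lemma set_star_word: "set (star_word w) \<subseteq> L \<longleftrightarrow> set w \<subseteq> L"
  by (auto simp: star_word_def)

text \<open>
  This says that the involution on formal series, which is defined on standard monomials, is the
  correct one on every word.
\<close>

lemma reorder_star_word:
  assumes "set w \<subseteq> L"
  shows "R (star_word w) = cnj (R w) * R (star_word (stdm (count (mset w))))"
proof -
  let ?k = "count (mset w)"
  have k: "?k \<in> MI" using assms by (rule count_word_in_multiindices)
  have "star_factor w = star_factor (stdm ?k)"
    by (rule star_factor_mset_cong[OF assms]) (use mset_eq_monomialI[OF k] in simp)
  then have eq: "R (star_word w) * R w = R (star_word (stdm ?k))"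
    by (simp add: star_factor_def)
  have "cnj (R w) * R (star_word (stdm ?k)) = R (star_word w) * (R w * cnj (R w))"
    unfolding eq[symmetric] by (simp only: ac_simps)
  then show ?thesis by (simp only: cnj_mult_unit cmod_reorder mult_1_right)
qed

text \<open>
  Since standard monomials are sorted, only pairs with one letter in each factor contribute, and
  the cocycle is a bicharacter of the exponents. This is why the twisted product is associative.
\<close>

definition cocycle :: "multiindex \<Rightarrow> multiindex \<Rightarrow> complex" where
  "cocycle i j = R (stdm i @ stdm j)"

lemma cocycle_eq_cross: "cocycle i j = cross \<beta> (stdm i) (stdm j)"
  using reorder_monomial[of \<Theta> m i] reorder_monomial[of \<Theta> m j]
  by (simp add: cocycle_def reorder_eq_pairprod pairprod_append)

lemma cocycle_count:
  assumes "set w \<subseteq> L" "set v \<subseteq> L"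
  shows "cocycle (count (mset w)) (count (mset v)) = cross \<beta> w v"
  unfolding cocycle_eq_cross
  by (rule cross_mset_cong) (use assms in \<open>auto intro!: mset_eq_monomialI count_word_in_multiindices\<close>)

lemma MI_add: "i \<in> MI \<Longrightarrow> j \<in> MI \<Longrightarrow> i + j \<in> MI"
  by (auto simp: multiindices_def)

lemma MI_add_iff: "i + j \<in> MI \<longleftrightarrow> i \<in> MI \<and> j \<in> MI"
  by (auto simp: multiindices_def)

lemma MI_zero [simp]: "0 \<in> MI" by (auto simp: multiindices_def)

lemma MI_bar [simp]: "k \<circ> bar \<in> MI \<longleftrightarrow> k \<in> MI"
  unfolding multiindices_def by (auto, metis bar_bar bar_in_gens)

lemma mset_mon_add: "i \<in> MI \<Longrightarrow> j \<in> MI \<Longrightarrow> mset (stdm (i + j)) = mset (stdm i @ stdm j)"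
  by (rule mset_eq_monomialI) (auto simp: MI_add_iff count_monomial fun_eq_iff)

lemma mset_mon_bar: "i \<in> MI \<Longrightarrow> mset (stdm (i \<circ> bar)) = mset (star_word (stdm i))"
  by (rule mset_eq_monomialI) (auto simp: count_star_word count_monomial)

lemma cocycle_add_left:
  "i \<in> MI \<Longrightarrow> i' \<in> MI \<Longrightarrow> cocycle (i + i') j = cocycle i j * cocycle i' j"
  unfolding cocycle_eq_cross by (subst cross_mset_cong[OF mset_mon_add refl]) auto

lemma cocycle_add_right:
  "j \<in> MI \<Longrightarrow> j' \<in> MI \<Longrightarrow> cocycle i (j + j') = cocycle i j * cocycle i j'"
  unfolding cocycle_eq_cross
  by (subst cross_mset_cong[OF refl mset_mon_add]) (auto simp: cross_append_right)

lemma monomial_zero [simp]: "stdm 0 = []"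
  by (simp add: monomial_def)

lemma cocycle_zero [simp]: "cocycle 0 j = 1" "cocycle i 0 = 1"
  by (simp_all add: cocycle_eq_cross)

lemma cmod_cocycle [simp]: "cmod (cocycle i j) = 1"
  by (simp add: cocycle_def)

definition star_coeff :: "multiindex \<Rightarrow> complex" where
  "star_coeff k = R (star_word (stdm k))"

lemma cmod_star_coeff [simp]: "cmod (star_coeff k) = 1"
  by (simp add: star_coeff_def)

lemma star_coeff_zero [simp]: "star_coeff 0 = 1"
  by (simp add: star_coeff_def star_word_def)

lemma star_coeff_bar: "k \<in> MI \<Longrightarrow> star_coeff (k \<circ> bar) = star_coeff k"
  unfolding star_coeff_def star_factor_monomial[symmetric]
  using star_factor_mset_cong[OF _ mset_mon_bar[symmetric], of k]
  by (simp add: set_star_word set_monomial star_factor_star)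

text \<open>
  The cocycle identity behind the rule $(ab)^* = b^* a^*$.
\<close>

lemma star_coeff_add:
  assumes "i \<in> MI" "j \<in> MI"
  shows "cnj (cocycle i j) * star_coeff (i + j) =
    star_coeff i * star_coeff j * cocycle (j \<circ> bar) (i \<circ> bar)"
proof -
  have m: "mset (stdm (i + j)) = mset (stdm i @ stdm j)" using assms by (rule mset_mon_add)
  have "star_coeff (i + j) = star_factor (stdm (i + j))"
    by (simp add: star_coeff_def star_factor_monomial)
  also have "\<dots> = star_factor (stdm i @ stdm j)"
    by (rule star_factor_mset_cong[OF set_monomial m])
  also have "\<dots> = star_coeff i * star_coeff j * cocycle i j *
      cross \<beta> (star_word (stdm j)) (star_word (stdm i))"
    by (simp add: star_factor_append star_factor_monomial star_coeff_def cocycle_eq_cross)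
  also have "cross \<beta> (star_word (stdm j)) (star_word (stdm i)) = cocycle (j \<circ> bar) (i \<circ> bar)"
    unfolding cocycle_eq_cross
    by (rule cross_mset_cong) (simp_all only: mset_mon_bar assms)
  finally have eq: "star_coeff (i + j) =
     star_coeff i * star_coeff j * cocycle i j * cocycle (j \<circ> bar) (i \<circ> bar)" .
  have "cnj (cocycle i j) * star_coeff (i + j) = (cnj (cocycle i j) * cocycle i j) *
      (star_coeff i * star_coeff j * cocycle (j \<circ> bar) (i \<circ> bar))"
    unfolding eq by (simp only: mult.assoc mult.left_commute mult.commute)
  then show ?thesis unfolding cnj_mult_unit(1)[OF cmod_cocycle] mult_1_left .
qed

text \<open>
  The reduction of a letter that forgets the difference between \<open>Z p\<close> and \<open>Zb p\<close>.
\<close>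

definition unbar :: "letter \<Rightarrow> letter" where
  "unbar g = (case g of Zb p \<Rightarrow> Z p | _ \<Rightarrow> g)"

text \<open>
  The scalar contributed to the word $w w^*$ by a pair of letters of \<open>w\<close> together with the two
  letters of $w^*$ that they give rise to.
\<close>

definition \<kappa> :: "letter \<Rightarrow> letter \<Rightarrow> complex" where
  "\<kappa> g h = \<beta> g h * \<beta> g (bar h) * \<beta> h (bar g) * \<beta> (bar h) (bar g)"

lemma kappa_sym: "g \<in> L \<Longrightarrow> h \<in> L \<Longrightarrow> \<kappa> g h = \<kappa> h g"
  by (cases g; cases h) (auto simp: \<kappa>_def transp_def set_gens lam_inverse)

lemma kappa_unbar: "g \<in> L \<Longrightarrow> h \<in> L \<Longrightarrow> \<kappa> (unbar g) (unbar h) = \<kappa> g h"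
  by (cases g; cases h) (auto simp: \<kappa>_def transp_def set_gens unbar_def lam_inverse)

lemma transp_bar_self: "g \<in> L \<Longrightarrow> \<beta> g (bar g) = 1"
  by (cases g) (auto simp: transp_def set_gens lam_diag)

lemma unbar_in_L [simp]: "g \<in> L \<Longrightarrow> unbar g \<in> L"
  by (cases g) (auto simp: set_gens unbar_def)

text \<open>
  Adding a letter \<open>g\<close> in front of \<open>w\<close> adds \<open>g\<close> at the front and \<open>bar g\<close> at the end of the word;
  these two contribute trivially together, because $z_p$ commutes with $\bar z_p$.
\<close>

lemma reorder_word_star_word:
  assumes "set w \<subseteq> L"
  shows "R (w @ star_word w) = pairprod \<kappa> w"
  using assms
proof (induction w)
  case (Cons g w)
  have st: "star_word (g # w) = star_word w @ [bar g]" by (simp add: star_word_def)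
  have p: "prod_list (map f (star_word w)) = prod_list (map (\<lambda>h. f (bar h)) w)" for f :: "letter \<Rightarrow> complex"
    by (simp add: star_word_def prod_list_map_mset image_mset.compositionality o_def flip: rev_map)
  have "R (g # w @ star_word w @ [bar g]) =
     prod_list (map (\<beta> g) w) * prod_list (map (\<lambda>h. \<beta> g (bar h)) w) * \<beta> g (bar g) * R (w @ star_word w) *
     prod_list (map (\<lambda>h. \<beta> h (bar g)) w) * prod_list (map (\<lambda>h. \<beta> (bar h) (bar g)) w)"
    by (simp add: reorder_eq_pairprod pairprod_append[of _ "w @ star_word w" "[bar g]", simplified]
        cross_append_right cross_Cons_right p)
  also have "\<dots> = prod_list (map (\<kappa> g) w) * R (w @ star_word w)"
  proof -
    have "prod_list (map (\<kappa> g) w) = prod_list (map (\<beta> g) w) * prod_list (map (\<lambda>h. \<beta> g (bar h)) w) *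
        prod_list (map (\<lambda>h. \<beta> h (bar g)) w) * prod_list (map (\<lambda>h. \<beta> (bar h) (bar g)) w)"
      unfolding \<kappa>_def by (induction w) (auto simp: ac_simps)
    then show ?thesis using Cons.prems transp_bar_self[of g] by simp
  qed
  finally show ?case using Cons st by simp
qed (simp add: star_word_def)

lemma count_map_unbar: "count (mset (map unbar w)) g =
    (case g of X \<Rightarrow> count (mset w) X | Z p \<Rightarrow> count (mset w) (Z p) + count (mset w) (Zb p) | Zb p \<Rightarrow> 0)"
  by (induction w) (auto simp: unbar_def split: letter.splits)

text \<open>
  The phase of $z^i (z^i)^*$ relative to the standard monomial depends only on the multidegree
  $i + \bar i$. Reason: in terms of operators, $z_p \bar z_p$ is central, so the product of a word
  and its star depends on the number of occurrences of $z_p$ and $\bar z_p$ in total.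
\<close>

lemma positivity_factor_cong:
  assumes "i \<in> MI" "j \<in> MI" "i + (i \<circ> bar) = j + (j \<circ> bar)"
  shows "star_coeff i * cocycle i (i \<circ> bar) = star_coeff j * cocycle j (j \<circ> bar)"
proof -
  have eq: "star_coeff i * cocycle i (i \<circ> bar) = pairprod \<kappa> (map unbar (stdm i))" if "i \<in> MI" for i
  proof -
    have "cocycle i (i \<circ> bar) = cross \<beta> (stdm i) (star_word (stdm i))"
      unfolding cocycle_eq_cross by (rule cross_mset_cong[OF refl mset_mon_bar[OF that]])
    then have "star_coeff i * cocycle i (i \<circ> bar) = R (stdm i @ star_word (stdm i))"
      using reorder_monomial[of \<Theta> m i] by (simp add: star_coeff_def reorder_eq_pairprod pairprod_append)
    also have "\<dots> = pairprod \<kappa> (stdm i)"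
      by (rule reorder_word_star_word[OF set_monomial])
    also have "\<dots> = pairprod \<kappa> (map unbar (stdm i))"
      unfolding pairprod_map
      by (rule pairprod_cong, rule kappa_unbar[symmetric]; erule subsetD[OF set_monomial])
    finally show ?thesis .
  qed
  have "i (X) = j X \<and> i (Z p) + i (Zb p) = j (Z p) + j (Zb p)" for p
    using fun_cong[OF assms(3), of X] fun_cong[OF assms(3), of "Z p"] by auto
  then have m: "mset (map unbar (stdm i)) = mset (map unbar (stdm j))"
    unfolding multiset_eq_iff count_map_unbar count_monomial[OF assms(1)] count_monomial[OF assms(2)]
    by (simp split: letter.split)
  show ?thesis
    unfolding eq[OF assms(1)] eq[OF assms(2)]
    by (rule pairprod_mset_cong[OF kappa_sym m]) (use set_monomial[of m i] in auto)
qed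

end

section \<open>Twisted convolution of formal series\<close>

lemma sum_fun_apply: "(\<Sum>x\<in>A. f x) k = (\<Sum>x\<in>A. f x k)"
  by (induction A rule: infinite_finite_induct) auto

context skew_parameter
begin

definition splits :: "multiindex \<Rightarrow> (multiindex \<times> multiindex) set" where
  "splits k = {(i, j). i \<in> MI \<and> j \<in> MI \<and> i + j = k}"

definition deg :: "multiindex \<Rightarrow> nat" where
  "deg k = (\<Sum>g\<in>L. k g)"

definition ball :: "nat \<Rightarrow> multiindex set" where
  "ball d = {k \<in> MI. deg k \<le> d}"

lemma deg_add: "deg (i + j) = deg i + deg j"
  by (simp add: deg_def sum.distrib)

lemma deg_zero [simp]: "deg 0 = 0"
  by (simp add: deg_def)

lemma deg_eq_0_iff: "k \<in> MI \<Longrightarrow> deg k = 0 \<longleftrightarrow> k = 0"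
  by (auto simp: deg_def multiindices_def fun_eq_iff)

lemma deg_bar [simp]: "deg (k \<circ> bar) = deg k"
  unfolding deg_def
  by (rule sum.reindex_bij_witness[of _ bar bar]) auto

lemma finite_ball [simp]: "finite (ball d)"
proof (rule finite_subset)
  show "ball d \<subseteq> {k. \<forall>g. (g \<in> L \<longrightarrow> k g \<in> {..d}) \<and> (g \<notin> L \<longrightarrow> k g = 0)}"
  proof (intro subsetI CollectI allI conjI impI)
    fix k g assume "k \<in> ball d" "g \<in> L"
    moreover from this have "k g \<le> deg k" unfolding deg_def by (intro member_le_sum) auto
    ultimately show "k g \<in> {..d}" by (simp add: ball_def)
  qed (auto simp: ball_def multiindices_def)
qed (rule finite_set_of_finite_funs, auto)

lemma splits_deg: "(i, j) \<in> splits k \<Longrightarrow> deg i + deg j = deg k"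
  by (auto simp: splits_def deg_add)

lemma finite_splits [simp]: "finite (splits k)"
proof (rule finite_subset)
  show "splits k \<subseteq> ball (deg k) \<times> ball (deg k)" by (auto simp: ball_def splits_def deg_add)
qed simp

lemma splits_0: "splits 0 = {(0, 0)}"
  by (auto simp: splits_def fun_eq_iff)

lemma splits_empty: "k \<notin> MI \<Longrightarrow> splits k = {}"
  by (auto simp: splits_def MI_add)

definition conv :: "(multiindex \<Rightarrow> complex) \<Rightarrow> (multiindex \<Rightarrow> complex) \<Rightarrow> multiindex \<Rightarrow> complex" where
  "conv a b k = (\<Sum>(i, j)\<in>splits k. a i * b j * cocycle i j)"

text \<open>
  Both sides are sums over triples of exponents with given sum, with the product of the three
  values of the cocycle on pairs.
\<close>

lemma conv_assoc: "conv (conv a b) c = conv a (conv b c)"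
proof
  fix k
  let ?T = "{(i, j, h). i \<in> MI \<and> j \<in> MI \<and> h \<in> MI \<and> i + j + h = k}"
  let ?f = "\<lambda>(i, j, h). a i * b j * c h * (cocycle i j * cocycle i h * cocycle j h)"
  have "conv (conv a b) c k =
      (\<Sum>x\<in>splits k. \<Sum>y\<in>splits (fst x). ?f (fst y, snd y, snd x))"
    unfolding conv_def case_prod_beta sum_distrib_right
    by (intro sum.cong refl) (auto simp: splits_def cocycle_add_left)
  also have "\<dots> = (\<Sum>(x, y)\<in>(SIGMA x:splits k. splits (fst x)). ?f (fst y, snd y, snd x))"
    by (rule sum.Sigma) auto
  also have "\<dots> = sum ?f ?T"
    by (rule sum.reindex_bij_witness[of _ "\<lambda>(i, j, h). ((i + j, h), (i, j))"
          "\<lambda>(x, y). (fst y, snd y, snd x)"]) (auto simp: splits_def MI_add)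
  also have "\<dots> = (\<Sum>(x, y)\<in>(SIGMA x:splits k. splits (snd x)). ?f (fst x, fst y, snd y))"
    by (rule sum.reindex_bij_witness[of _ "\<lambda>(x, y). (fst x, fst y, snd y)"
          "\<lambda>(i, j, h). ((i, j + h), (j, h))"]) (auto simp: splits_def MI_add add.assoc)
  also have "\<dots> = (\<Sum>x\<in>splits k. \<Sum>y\<in>splits (snd x). ?f (fst x, fst y, snd y))"
    by (rule sum.Sigma[symmetric]) auto
  also have "\<dots> = conv a (conv b c) k"
    unfolding conv_def case_prod_beta sum_distrib_right sum_distrib_left
    by (intro sum.cong refl) (auto simp: splits_def cocycle_add_right)
  finally show "conv (conv a b) c k = conv a (conv b c) k" .
qed

lemma conv_add_left: "conv (a + b) c = conv a c + conv b c"
  by (auto simp: conv_def fun_eq_iff case_prod_beta ring_distribs sum.distrib)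

lemma conv_add_right: "conv c (a + b) = conv c a + conv c b"
  by (auto simp: conv_def fun_eq_iff case_prod_beta ring_distribs sum.distrib)

lemma conv_zero [simp]: "conv 0 c = 0" "conv c 0 = 0"
  by (auto simp: conv_def fun_eq_iff case_prod_beta)

lemma conv_sum_left: "conv (\<Sum>x\<in>A. f x) c = (\<Sum>x\<in>A. conv (f x) c)"
  by (induction A rule: infinite_finite_induct)
    (simp_all only: sum.infinite sum.empty sum.insert conv_zero conv_add_left not_False_eq_True)

lemma conv_sum_right: "conv c (\<Sum>x\<in>A. f x) = (\<Sum>x\<in>A. conv c (f x))"
  by (induction A rule: infinite_finite_induct)
    (simp_all only: sum.infinite sum.empty sum.insert conv_zero conv_add_right not_False_eq_True)

definition const :: "complex \<Rightarrow> multiindex \<Rightarrow> complex" where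
  "const c k = (if k = 0 then c else 0)"

lemma conv_const_left: "conv (const c) a k = (if k \<in> MI then c * a k else 0)"
proof (cases "k \<in> MI")
  case True
  then have "conv (const c) a k = (\<Sum>(i, j)\<in>{(0, k)}. const c i * a j * cocycle i j)"
    unfolding conv_def
    by (intro sum.mono_neutral_right finite_splits) (auto simp: splits_def const_def split: if_splits)
  with True show ?thesis by (simp add: const_def)
qed (simp add: conv_def splits_empty)

lemma conv_const_right: "conv a (const c) k = (if k \<in> MI then a k * c else 0)"
proof (cases "k \<in> MI")
  case True
  then have "conv a (const c) k = (\<Sum>(i, j)\<in>{(k, 0)}. a i * const c j * cocycle i j)"
    unfolding conv_def
    by (intro sum.mono_neutral_right finite_splits) (auto simp: splits_def const_def split: if_splits)
  with True show ?thesis by (simp add: const_def)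
qed (simp add: conv_def splits_empty)

lemma conv_at_0: "conv a b 0 = a 0 * b 0"
  by (simp add: conv_def splits_0)

definition series_star :: "(multiindex \<Rightarrow> complex) \<Rightarrow> multiindex \<Rightarrow> complex" where
  "series_star a k = cnj (a (k \<circ> bar)) * star_coeff (k \<circ> bar)"

lemma comp_bar_bar [simp]: "(k \<circ> bar) \<circ> bar = k"
  by (simp add: fun_eq_iff)

lemma comp_bar_add: "(i + j) \<circ> bar = (i \<circ> bar) + (j \<circ> bar)"
  by (simp add: fun_eq_iff)

lemma zero_comp_bar [simp]: "0 \<circ> bar = (0 :: multiindex)"
  by (simp add: fun_eq_iff)

lemma comp_bar_eq_0 [simp]: "k \<circ> bar = 0 \<longleftrightarrow> k = (0 :: multiindex)"
  by (metis comp_bar_bar zero_comp_bar)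

lemma star_coeff_splits: "(i, j) \<in> splits k \<Longrightarrow>
    cnj (cocycle i j) * star_coeff k = star_coeff i * star_coeff j * cocycle (j \<circ> bar) (i \<circ> bar)"
  using star_coeff_add by (auto simp: splits_def)

lemma series_star_conv: "series_star (conv a b) = conv (series_star b) (series_star a)"
proof
  fix k
  have "series_star (conv a b) k =
      (\<Sum>(i, j)\<in>splits (k \<circ> bar). cnj (a i) * cnj (b j) * (cnj (cocycle i j) * star_coeff (k \<circ> bar)))"
    unfolding series_star_def conv_def cnj_sum sum_distrib_right
    by (rule sum.cong) auto
  also have "\<dots> = (\<Sum>(i, j)\<in>splits (k \<circ> bar). cnj (a i) * cnj (b j) *
      (star_coeff i * star_coeff j * cocycle (j \<circ> bar) (i \<circ> bar)))"
    by (rule sum.cong) (auto simp: star_coeff_splits)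
  also have "\<dots> = conv (series_star b) (series_star a) k"
    unfolding conv_def
    by (rule sum.reindex_bij_witness[of _ "\<lambda>(j, i). (i \<circ> bar, j \<circ> bar)" "\<lambda>(i, j). (j \<circ> bar, i \<circ> bar)"])
      (auto simp: splits_def series_star_def comp_bar_add[symmetric] add.commute)
  finally show "series_star (conv a b) k = conv (series_star b) (series_star a) k" .
qed

lemma series_star_add: "series_star (a + b) = series_star a + series_star b"
  by (auto simp: series_star_def fun_eq_iff ring_distribs)

lemma series_star_zero [simp]: "series_star 0 = 0"
  by (auto simp: series_star_def fun_eq_iff)

lemma series_star_sum: "series_star (\<Sum>x\<in>A. f x) = (\<Sum>x\<in>A. series_star (f x))"
  by (induction A rule: infinite_finite_induct)
    (simp_all only: sum.infinite sum.empty sum.insert series_star_zero series_star_add not_False_eq_True)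

lemma series_star_series_star: "k \<in> MI \<Longrightarrow> series_star (series_star a) k = a k"
  by (simp add: series_star_def star_coeff_bar mult.assoc cnj_mult_unit)

lemma series_star_const [simp]: "series_star (const c) = const (cnj c)"
  by (rule ext) (auto simp: series_star_def const_def)

lemma cmod_series_star: "cmod (series_star a k) = cmod (a (k \<circ> bar))"
  by (simp add: series_star_def norm_mult)

end

section \<open>Matrices of formal series\<close>

text \<open>
  Matrices of size \<open>N\<close> are functions on all pairs of indices, and multiplication is defined for all
  of them by summing over indices below \<open>N\<close>. In this way associativity and distributivity hold
  without side conditions; only the unit laws need the entries outside the square, and the
  coefficients outside the multi-indices, to vanish (\<open>supported\<close>).
\<close>

locale series_matrices = skew_parameter +
  fixes N :: nat
begin

type_synonym smat = "nat \<Rightarrow> nat \<Rightarrow> multiindex \<Rightarrow> complex"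

definition mul :: "smat \<Rightarrow> smat \<Rightarrow> smat" (infixl "\<star>" 70) where
  "(F \<star> G) a b = (\<Sum>c<N. conv (F a c) (G c b))"

definition adj :: "smat \<Rightarrow> smat" where
  "adj F a b = series_star (F b a)"

definition cmat :: "(nat \<Rightarrow> nat \<Rightarrow> complex) \<Rightarrow> smat" where
  "cmat C a b = (if a < N \<and> b < N then const (C a b) else 0)"

definition E :: smat where
  "E = cmat (\<lambda>a b. if a = b then 1 else 0)"

definition supported :: "smat \<Rightarrow> bool" where
  "supported F \<longleftrightarrow> (\<forall>a b k. F a b k \<noteq> 0 \<longrightarrow> a < N \<and> b < N \<and> k \<in> MI)"

lemma mul_assoc: "F \<star> G \<star> H = F \<star> (G \<star> H)"
proof (intro ext)
  fix a b k
  have "(F \<star> G \<star> H) a b = (\<Sum>d<N. \<Sum>c<N. conv (conv (F a c) (G c d)) (H d b))"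
    by (simp add: mul_def conv_sum_left)
  also have "\<dots> = (\<Sum>c<N. \<Sum>d<N. conv (F a c) (conv (G c d) (H d b)))"
    unfolding conv_assoc by (rule sum.swap)
  also have "\<dots> = (F \<star> (G \<star> H)) a b"
    by (simp add: mul_def conv_sum_right)
  finally show "(F \<star> G \<star> H) a b k = (F \<star> (G \<star> H)) a b k" by simp
qed

lemma mul_add: "F \<star> (G + H) = F \<star> G + F \<star> H"
  by (intro ext) (simp add: mul_def conv_add_right sum.distrib)

lemma add_mul: "(G + H) \<star> F = G \<star> F + H \<star> F"
  by (intro ext) (simp add: mul_def conv_add_left sum.distrib)

lemma zero_mul [simp]: "0 \<star> F = 0"
  by (intro ext) (simp add: mul_def)

lemma mul_zero [simp]: "F \<star> 0 = 0"
  by (intro ext) (simp add: mul_def)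

lemma minus_mul: "(- G) \<star> F = - (G \<star> F)"
  using add_mul[of G "- G" F] by (simp add: eq_neg_iff_add_eq_0 add.commute)

lemma mul_minus: "F \<star> (- G) = - (F \<star> G)"
  using mul_add[of F G "- G"] by (simp add: eq_neg_iff_add_eq_0 add.commute)

lemma diff_mul: "(G - H) \<star> F = G \<star> F - H \<star> F"
  using add_mul[of G "- H" F] by (simp add: minus_mul)

lemma mul_diff: "F \<star> (G - H) = F \<star> G - F \<star> H"
  using mul_add[of F G "- H"] by (simp add: mul_minus)

lemmas mul_distribs = mul_add add_mul mul_diff diff_mul

lemma sum_mul: "(\<Sum>x\<in>A. f x) \<star> F = (\<Sum>x\<in>A. f x \<star> F)"
  by (induction A rule: infinite_finite_induct)
    (simp_all only: sum.infinite sum.empty sum.insert zero_mul add_mul not_False_eq_True)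

lemma mul_sum: "F \<star> (\<Sum>x\<in>A. f x) = (\<Sum>x\<in>A. F \<star> f x)"
  by (induction A rule: infinite_finite_induct)
    (simp_all only: sum.infinite sum.empty sum.insert mul_zero mul_add not_False_eq_True)

lemma adj_mul: "adj (F \<star> G) = adj G \<star> adj F"
  by (intro ext) (simp add: adj_def mul_def series_star_sum series_star_conv)

lemma adj_add: "adj (F + G) = adj F + adj G"
  by (intro ext) (simp add: adj_def series_star_add)

lemma adj_zero [simp]: "adj 0 = 0"
  by (intro ext) (simp add: adj_def)

lemma adj_minus: "adj (- F) = - adj F"
  using adj_add[of F "- F"] by (simp add: eq_neg_iff_add_eq_0 add.commute)

lemma adj_diff: "adj (F - G) = adj F - adj G"
  using adj_add[of F "- G"] by (simp add: adj_minus)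

lemma supportedD: "supported F \<Longrightarrow> \<not> (a < N \<and> b < N \<and> k \<in> MI) \<Longrightarrow> F a b k = 0"
  by (auto simp: supported_def)

lemma supported_zero: "supported F \<Longrightarrow> \<not> (a < N \<and> b < N) \<Longrightarrow> F a b = 0"
  by (auto simp: supported_def fun_eq_iff)

lemma adj_adj: "supported F \<Longrightarrow> adj (adj F) = F"
proof (intro ext)
  fix a b k assume F: "supported F"
  show "adj (adj F) a b k = F a b k"
  proof (cases "k \<in> MI")
    case True then show ?thesis by (simp add: adj_def series_star_series_star)
  next
    case False
    with F have "F a b k = 0" by (auto simp: supportedD)
    then show ?thesis by (simp add: adj_def series_star_def)
  qed
qed

lemma conv_not_MI: "k \<notin> MI \<Longrightarrow> conv a b k = 0"
  by (simp add: conv_def splits_empty)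

lemma supported_mul:
  assumes "supported F" "supported G"
  shows "supported (F \<star> G)"
  unfolding supported_def
proof (intro allI impI)
  fix a b k assume nz: "(F \<star> G) a b k \<noteq> 0"
  then obtain c where c: "c < N" "conv (F a c) (G c b) k \<noteq> 0"
    unfolding mul_def sum_fun_apply by (metis (no_types, lifting) lessThan_iff sum.neutral)
  from c(2) have *: "F a c \<noteq> 0" "G c b \<noteq> 0" "k \<in> MI"
    using conv_not_MI[of k "F a c" "G c b"] by auto
  with assms show "a < N \<and> b < N \<and> k \<in> MI" by (metis supported_zero)
qed

lemma supported_add: "supported F \<Longrightarrow> supported G \<Longrightarrow> supported (F + G)"
  unfolding supported_def by (metis add_0 plus_fun_apply)

lemma supported_minus: "supported F \<Longrightarrow> supported (- F)"
  by (auto simp: supported_def)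

lemma supported_diff: "supported F \<Longrightarrow> supported G \<Longrightarrow> supported (F - G)"
  using supported_add[OF _ supported_minus, of F G] by simp

lemma supported_adj: "supported F \<Longrightarrow> supported (adj F)"
  unfolding supported_def adj_def series_star_def by (metis MI_bar complex_cnj_zero mult_zero_left)

lemma supported_cmat: "supported (cmat C)"
  by (auto simp: supported_def cmat_def const_def)

lemma supported_E: "supported E"
  by (simp add: E_def supported_cmat)

lemma supported_0: "supported 0"
  by (simp add: supported_def)

lemmas supported_intros = supported_mul supported_add supported_minus supported_diff supported_adj
  supported_cmat supported_E supported_0

lemma E_mul:
  assumes "supported F" shows "E \<star> F = F"
proof (intro ext)
  fix a b k
  have "(E \<star> F) a b k = (\<Sum>c<N. if c = a then conv (const 1) (F a b) k else 0)"
    unfolding mul_def sum_fun_apply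
    by (rule sum.cong) (auto simp: E_def cmat_def const_def[abs_def] zero_fun_def[symmetric])
  also have "\<dots> = F a b k"
    using assms supportedD[OF assms, of a b k] by (auto simp: conv_const_left)
  finally show "(E \<star> F) a b k = F a b k" .
qed

lemma mul_E:
  assumes "supported F" shows "F \<star> E = F"
proof (intro ext)
  fix a b k
  have "(F \<star> E) a b k = (\<Sum>c<N. if c = b then conv (F a b) (const 1) k else 0)"
    unfolding mul_def sum_fun_apply
    by (rule sum.cong) (auto simp: E_def cmat_def const_def[abs_def] zero_fun_def[symmetric])
  also have "\<dots> = F a b k"
    using assms supportedD[OF assms, of a b k] by (auto simp: conv_const_right)
  finally show "(F \<star> E) a b k = F a b k" .
qed

lemma adj_cmat: "adj (cmat C) = cmat (\<lambda>a b. cnj (C b a))"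
  by (intro ext) (auto simp: adj_def cmat_def)

lemma adj_E [simp]: "adj E = E"
  unfolding E_def adj_cmat by (rule arg_cong[of _ _ cmat]) (auto simp: fun_eq_iff)

lemma conv_const_const: "conv (const c) (const d) = const (c * d)"
  by (rule ext) (auto simp: conv_const_left const_def)

lemma sum_const: "(\<Sum>x\<in>A. const (f x)) = const (\<Sum>x\<in>A. f x)"
  by (rule ext) (auto simp: sum_fun_apply const_def)

lemma cmat_mul: "cmat C \<star> cmat D = cmat (\<lambda>a b. \<Sum>c<N. C a c * D c b)"
  by (intro ext) (auto simp: mul_def cmat_def conv_const_const sum_const)

lemma mul_at_0: "(F \<star> G) a b 0 = (\<Sum>c<N. F a c 0 * G c b 0)"
  by (simp add: mul_def sum_fun_apply conv_at_0)

definition tr :: "smat \<Rightarrow> complex" where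
  "tr F = (\<Sum>a<N. F a a 0)"

lemma tr_mul_commute: "tr (F \<star> G) = tr (G \<star> F)"
  unfolding tr_def mul_at_0 by (subst sum.swap) (simp add: mult.commute)

definition scale :: "complex \<Rightarrow> smat \<Rightarrow> smat" where
  "scale c F = (\<lambda>a b k. c * F a b k)"

lemma conv_scale: "conv (\<lambda>k. c * a k) b = (\<lambda>k. c * conv a b k)" "conv a (\<lambda>k. c * b k) = (\<lambda>k. c * conv a b k)"
  by (auto simp: conv_def fun_eq_iff sum_distrib_left mult_ac case_prod_beta)

lemma scale_mul: "scale c F \<star> G = scale c (F \<star> G)"
  by (intro ext) (simp add: scale_def mul_def conv_scale sum_fun_apply sum_distrib_left)

lemma mul_scale: "F \<star> scale c G = scale c (F \<star> G)"
  by (intro ext) (simp add: scale_def mul_def conv_scale sum_fun_apply sum_distrib_left)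

lemma adj_scale: "adj (scale c F) = scale (cnj c) (adj F)"
  by (intro ext) (simp add: adj_def scale_def series_star_def)

text \<open>
  On power series this is the substitution of $t z$ for $z$. It is a $*$-homomorphism because the
  degree is additive and invariant under the star.
\<close>

definition dilate :: "real \<Rightarrow> smat \<Rightarrow> smat" where
  "dilate t F = (\<lambda>a b k. of_real (t ^ deg k) * F a b k)"

lemma dilate_mul: "dilate t (F \<star> G) = dilate t F \<star> dilate t G"
proof (intro ext)
  fix a b k
  have "conv (\<lambda>k. of_real (t ^ deg k) * f k) (\<lambda>k. of_real (t ^ deg k) * g k) k = of_real (t ^ deg k) * conv f g k"
    for f g
    unfolding conv_def sum_distrib_left
    by (rule sum.cong) (auto simp: power_add dest!: splits_deg[symmetric])
  then show "dilate t (F \<star> G) a b k = (dilate t F \<star> dilate t G) a b k"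
    by (simp add: dilate_def mul_def sum_fun_apply sum_distrib_left)
qed

lemma dilate_adj: "dilate t (adj F) = adj (dilate t F)"
  by (intro ext) (simp add: dilate_def adj_def series_star_def)

lemma supported_dilate: "supported F \<Longrightarrow> supported (dilate t F)"
  by (auto simp: supported_def dilate_def)

lemma dilate_1 [simp]: "dilate 1 F = F"
  by (simp add: dilate_def)

lemma dilate_at_0 [simp]: "dilate t F a b 0 = F a b 0"
  by (simp add: dilate_def)

lemma dilate_0:
  assumes "supported F"
  shows "dilate 0 F = cmat (\<lambda>a b. F a b 0)"
proof (intro ext)
  fix a b k
  show "dilate 0 F a b k = cmat (\<lambda>a b. F a b 0) a b k"
    using supportedD[OF assms, of a b k] deg_eq_0_iff[of k]
    by (auto simp: dilate_def cmat_def const_def power_0_left)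
qed

definition projection :: "smat \<Rightarrow> bool" where
  "projection p \<longleftrightarrow> supported p \<and> p \<star> p = p \<and> adj p = p"

definition unitary :: "smat \<Rightarrow> bool" where
  "unitary u \<longleftrightarrow> supported u \<and> u \<star> adj u = E \<and> adj u \<star> u = E"

lemma projection_dilate: "projection p \<Longrightarrow> projection (dilate t p)"
  by (simp add: projection_def supported_dilate dilate_mul[symmetric] dilate_adj[symmetric])

lemma unitary_mul:
  assumes "unitary u" "unitary v" shows "unitary (u \<star> v)"
proof -
  have "u \<star> v \<star> adj (u \<star> v) = u \<star> (v \<star> adj v) \<star> adj u"
    by (simp add: adj_mul mul_assoc)
  moreover have "adj (u \<star> v) \<star> (u \<star> v) = adj v \<star> (adj u \<star> u) \<star> v"
    by (simp add: adj_mul mul_assoc)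
  ultimately show ?thesis using assms
    by (simp add: unitary_def supported_intros mul_E E_mul)
qed

lemma unitary_adj: "unitary u \<Longrightarrow> unitary (adj u)"
  by (simp add: unitary_def supported_adj adj_adj)

lemma tr_unitary_conjugate:
  assumes "unitary u" "supported q"
  shows "tr (u \<star> q \<star> adj u) = tr q"
proof -
  have "tr (u \<star> q \<star> adj u) = tr (adj u \<star> (u \<star> q))" by (rule tr_mul_commute)
  also have "adj u \<star> (u \<star> q) = q"
    using assms by (simp add: mul_assoc[symmetric] unitary_def E_mul)
  finally show ?thesis .
qed

text \<open>
  With $g = p q + (1 - p)(1 - q)$ one has $g q = p q = p g$ and
  $g g^* = g^* g = 1 - (p - q)^2$. The element $(p - q)^2$ commutes with $p$ and $q$, and so does \<open>s\<close>,
  its inverse square root; so $g s$ is the unitary part of $g$.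
\<close>

lemma direct_rotation:
  assumes p: "projection p" and q: "projection q"
    and s: "supported s" "adj s = s" "s \<star> s \<star> (E - (p - q) \<star> (p - q)) = E"
    and sp: "s \<star> p = p \<star> s" and sq: "s \<star> q = q \<star> s"
  defines "u \<equiv> (p \<star> q + (E - p) \<star> (E - q)) \<star> s"
  shows "unitary u" "u \<star> q \<star> adj u = p"
proof -
  have supp: "supported p" "supported q" and idem: "p \<star> p = p" "q \<star> q = q"
    and sa: "adj p = p" "adj q = q"
    using p q by (auto simp: projection_def)
  have idem': "p \<star> (p \<star> F) = p \<star> F" "q \<star> (q \<star> F) = q \<star> F" for F
    by (simp_all add: mul_assoc[symmetric] idem)
  note sup = supported_intros supp s(1)
  define g where "g = p \<star> q + (E - p) \<star> (E - q)"
  define g' where "g' = q \<star> p + (E - q) \<star> (E - p)"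
  note simps = mul_distribs mul_assoc idem idem' E_mul mul_E sup
  have supg: "supported g" "supported g'" by (auto simp: g_def g'_def intro!: sup)
  have ag: "adj g = g'" by (simp add: g_def g'_def adj_add adj_mul adj_diff sa)
  have gg: "g \<star> g' = E - (p - q) \<star> (p - q)" "g' \<star> g = E - (p - q) \<star> (p - q)"
    unfolding g_def g'_def by (simp_all only: simps) (simp_all add: algebra_simps)
  have gq: "g \<star> q = p \<star> g" unfolding g_def by (simp only: simps) (simp add: algebra_simps)
  have sg: "s \<star> g = g \<star> s" "s \<star> g' = g' \<star> s"
  proof -
    have "s \<star> (p \<star> F) = p \<star> (s \<star> F)" "s \<star> (q \<star> F) = q \<star> (s \<star> F)" for F
      by (simp_all add: mul_assoc[symmetric] sp sq)
    then show "s \<star> g = g \<star> s" "s \<star> g' = g' \<star> s"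
      unfolding g_def g'_def by (simp_all only: simps sp sq)
  qed
  have sg': "g \<star> (s \<star> F) = s \<star> (g \<star> F)" "g' \<star> (s \<star> F) = s \<star> (g' \<star> F)" for F
    by (simp_all add: mul_assoc[symmetric] sg)
  have u: "u = g \<star> s" by (simp add: u_def g_def)
  have au: "adj u = g' \<star> s" by (simp add: u adj_mul ag s(2) sg)
  have "u \<star> adj u = s \<star> s \<star> (g \<star> g')"
    unfolding au unfolding u by (simp only: mul_assoc sg' sg[symmetric])
  moreover have "adj u \<star> u = s \<star> s \<star> (g' \<star> g)"
    unfolding au unfolding u by (simp only: mul_assoc sg' sg[symmetric])
  ultimately show un: "unitary u"
    unfolding unitary_def gg s(3) using supg s(1) by (auto simp: u intro!: sup)
  have "u \<star> q = p \<star> u" unfolding u by (metis gq mul_assoc sq)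
  then show "u \<star> q \<star> adj u = p"
    using un supp by (simp add: mul_assoc unitary_def mul_E)
qed

end

section \<open>The inverse square root as a formal series\<close>

text \<open>
  The coefficients of the binomial series of $(1 - x)^{-1/2}$.
\<close>

definition isqrt_coeff :: "nat \<Rightarrow> real" where
  "isqrt_coeff n = (- 1) ^ n * ((- 1 / 2) gchoose n)"

lemma isqrt_coeff_0 [simp]: "isqrt_coeff 0 = 1"
  by (simp add: isqrt_coeff_def)

text \<open>
  The square of the series is the geometric series.
\<close>

lemma isqrt_coeff_convolution: "(\<Sum>i\<le>n. isqrt_coeff i * isqrt_coeff (n - i)) = 1"
proof -
  have "(\<Sum>i\<le>n. isqrt_coeff i * isqrt_coeff (n - i)) =
      (- 1) ^ n * (\<Sum>i\<le>n. ((- 1 / 2) gchoose i) * ((- 1 / 2 :: real) gchoose (n - i)))"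
    unfolding sum_distrib_left isqrt_coeff_def
    by (rule sum.cong) (auto simp: power_add[symmetric] field_simps)
  also have "(\<Sum>i\<le>n. ((- 1 / 2) gchoose i) * ((- 1 / 2 :: real) gchoose (n - i))) = (- 1) gchoose n"
    using gbinomial_Vandermonde[of "- 1 / 2 :: real" "- 1 / 2" n] by (simp add: atMost_atLeast0)
  also have "(- 1 :: real) ^ n * ((- 1) gchoose n) = 1"
    by (simp add: gbinomial_pochhammer pochhammer_fact[symmetric] power_add[symmetric] flip: mult_2)
  finally show ?thesis .
qed

lemma isqrt_coeff_nonneg: "isqrt_coeff n \<ge> 0"
proof -
  have "isqrt_coeff n = pochhammer (1 / 2) n / fact n"
    by (simp add: isqrt_coeff_def gbinomial_pochhammer power_add[symmetric] flip: mult_2)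
  then show ?thesis by (simp add: pochhammer_nonneg)
qed

lemma isqrt_coeff_le_1: "isqrt_coeff n \<le> 1"
proof -
  have "isqrt_coeff 0 * isqrt_coeff (n - 0) \<le> (\<Sum>i\<le>n. isqrt_coeff i * isqrt_coeff (n - i))"
    by (rule member_le_sum) (auto simp: isqrt_coeff_nonneg)
  then show ?thesis by (simp add: isqrt_coeff_convolution)
qed

context series_matrices
begin

primrec mpow :: "smat \<Rightarrow> nat \<Rightarrow> smat" where
  "mpow x 0 = E"
| "mpow x (Suc n) = x \<star> mpow x n"

lemma supported_mpow: "supported x \<Longrightarrow> supported (mpow x n)"
  by (induction n) (auto intro: supported_intros)

lemma mpow_add: "supported x \<Longrightarrow> mpow x l \<star> mpow x n = mpow x (l + n)"
  by (induction l) (auto simp: E_mul supported_mpow mul_assoc)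

lemma mpow_commute: "supported x \<Longrightarrow> supported F \<Longrightarrow> F \<star> x = x \<star> F \<Longrightarrow> F \<star> mpow x n = mpow x n \<star> F"
proof (induction n)
  case (Suc n)
  have "F \<star> (x \<star> mpow x n) = x \<star> (F \<star> mpow x n)"
    by (simp add: mul_assoc[symmetric] Suc.prems)
  with Suc show ?case by (simp add: mul_assoc)
qed (simp add: E_mul mul_E)

lemma adj_mpow: "supported x \<Longrightarrow> adj x = x \<Longrightarrow> adj (mpow x n) = mpow x n"
  by (induction n) (auto simp: adj_mul mpow_commute[symmetric])

text \<open>
  The filtration by degree; equality of series is tested modulo each of its steps, see \<open>agree\<close>.
\<close>

definition vanishes_below :: "nat \<Rightarrow> smat \<Rightarrow> bool" where
  "vanishes_below n F \<longleftrightarrow> (\<forall>a b k. deg k < n \<longrightarrow> F a b k = 0)"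

lemma vanishes_below_mul:
  assumes "vanishes_below m' F" "vanishes_below n G"
  shows "vanishes_below (m' + n) (F \<star> G)"
  unfolding vanishes_below_def
proof (intro allI impI)
  fix a b k assume k: "deg k < m' + n"
  have "conv (F a c) (G c b) k = 0" for c
    unfolding conv_def
  proof (intro sum.neutral ballI)
    fix x assume "x \<in> splits k"
    then obtain i j where x: "x = (i, j)" "deg i + deg j = deg k" using splits_deg by (cases x) auto
    then have "deg i < m' \<or> deg j < n" using k by linarith
    then show "(case x of (i, j) \<Rightarrow> F a c i * G c b j * cocycle i j) = 0"
      using assms x(1) by (auto simp: vanishes_below_def)
  qed
  then show "(F \<star> G) a b k = 0" by (simp add: mul_def sum_fun_apply)
qed

lemma vanishes_below_0: "vanishes_below 0 F"
  by (simp add: vanishes_below_def)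

lemma vanishes_below_mpow: "vanishes_below 1 x \<Longrightarrow> vanishes_below n (mpow x n)"
proof (induction n)
  case (Suc n)
  then show ?case using vanishes_below_mul[of 1 x n "mpow x n"] by simp
qed (rule vanishes_below_0)

definition agree :: "nat \<Rightarrow> smat \<Rightarrow> smat \<Rightarrow> bool" where
  "agree K F G \<longleftrightarrow> (\<forall>a b k. deg k \<le> K \<longrightarrow> F a b k = G a b k)"

lemma agree_refl: "agree K F F"
  by (simp add: agree_def)

lemma agree_trans: "agree K F G \<Longrightarrow> agree K G H \<Longrightarrow> agree K F H"
  by (simp add: agree_def)

lemma agree_all: "(\<And>K. agree K F G) \<Longrightarrow> F = G"
  by (intro ext) (auto simp: agree_def)

lemma agree_mul:
  assumes "agree K F F'" "agree K G G'"
  shows "agree K (F \<star> G) (F' \<star> G')"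
  unfolding agree_def
proof (intro allI impI)
  fix a b k assume k: "deg k \<le> K"
  have "conv (F a c) (G c b) k = conv (F' a c) (G' c b) k" for c
    unfolding conv_def
  proof (rule sum.cong)
    fix x assume "x \<in> splits k"
    then obtain i j where "x = (i, j)" "deg i + deg j = deg k" using splits_deg by (cases x) auto
    then show "(case x of (i, j) \<Rightarrow> F a c i * G c b j * cocycle i j) =
        (case x of (i, j) \<Rightarrow> F' a c i * G' c b j * cocycle i j)"
      using assms k by (auto simp: agree_def)
  qed simp
  then show "(F \<star> G) a b k = (F' \<star> G') a b k" by (simp add: mul_def sum_fun_apply)
qed

lemma agree_adj: "agree K F G \<Longrightarrow> agree K (adj F) (adj G)"
  by (auto simp: agree_def adj_def series_star_def)

text \<open>
  If \<open>x\<close> has no constant term then $x^n$ starts in degree \<open>n\<close>, so the sum over \<open>n\<close> of the binomial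
  series may be cut off at the degree of the coefficient.
\<close>

definition isqrt :: "smat \<Rightarrow> smat" where
  "isqrt x = (\<lambda>a b k. \<Sum>n\<le>deg k. of_real (isqrt_coeff n) * mpow x n a b k)"

definition isqrt_trunc :: "smat \<Rightarrow> nat \<Rightarrow> smat" where
  "isqrt_trunc x K = (\<Sum>n\<le>K. scale (of_real (isqrt_coeff n)) (mpow x n))"

lemma isqrt_trunc_apply:
  "isqrt_trunc x K a b k = (\<Sum>n\<le>K. of_real (isqrt_coeff n) * mpow x n a b k)"
  by (simp add: isqrt_trunc_def sum_fun_apply scale_def)

lemma supported_isqrt: "supported x \<Longrightarrow> supported (isqrt x)"
proof -
  assume x: "supported x"
  have "isqrt x a b k = 0" if "\<not> (a < N \<and> b < N \<and> k \<in> MI)" for a b k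
    using supportedD[OF supported_mpow[OF x] that] by (simp add: isqrt_def)
  then show "supported (isqrt x)" unfolding supported_def by metis
qed

lemma agree_isqrt:
  assumes "vanishes_below 1 x"
  shows "agree K (isqrt x) (isqrt_trunc x K)"
  unfolding agree_def
proof (intro allI impI)
  fix a b k assume k: "deg k \<le> K"
  show "isqrt x a b k = isqrt_trunc x K a b k"
    unfolding isqrt_def isqrt_trunc_apply
    by (rule sum.mono_neutral_left)
      (use k vanishes_below_mpow[OF assms] in \<open>auto simp: vanishes_below_def\<close>)
qed

lemma isqrt_commute:
  assumes "vanishes_below 1 x" "supported x" "supported F" "F \<star> x = x \<star> F"
  shows "F \<star> isqrt x = isqrt x \<star> F"
proof (rule agree_all)
  fix K
  have "F \<star> isqrt_trunc x K = isqrt_trunc x K \<star> F"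
    by (simp add: isqrt_trunc_def sum_mul mul_sum scale_mul mul_scale mpow_commute assms)
  then show "agree K (F \<star> isqrt x) (isqrt x \<star> F)"
    using agree_mul[OF agree_refl agree_isqrt[OF assms(1)], of K F]
      agree_mul[OF agree_isqrt[OF assms(1)] agree_refl, of K F]
    by (simp add: agree_def)
qed

lemma adj_sum: "adj (\<Sum>x\<in>A. f x) = (\<Sum>x\<in>A. adj (f x))"
  by (induction A rule: infinite_finite_induct)
    (simp_all only: sum.infinite sum.empty sum.insert adj_zero adj_add not_False_eq_True)

lemma adj_isqrt:
  assumes "vanishes_below 1 x" "supported x" "adj x = x"
  shows "adj (isqrt x) = isqrt x"
proof (rule agree_all)
  fix K
  have "adj (isqrt_trunc x K) = isqrt_trunc x K"
    by (simp add: isqrt_trunc_def adj_sum adj_scale adj_mpow assms)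
  then show "agree K (adj (isqrt x)) (isqrt x)"
    using agree_adj[OF agree_isqrt[OF assms(1)], of K] agree_isqrt[OF assms(1), of K]
    by (simp add: agree_def)
qed

lemma geometric_sum_mul:
  assumes "supported x"
  shows "(\<Sum>n\<le>K. mpow x n) \<star> (E - x) = E - mpow x (Suc K)"
proof (induction K)
  case 0
  have "supported (E - x)" by (intro supported_intros assms)
  then show ?case by (simp only: atMost_0 sum.insert sum.empty finite.emptyI empty_iff not_False_eq_True
        mpow.simps add_0_right E_mul mul_E[OF assms])
next
  case (Suc K)
  have "mpow x (Suc K) \<star> (E - x) = mpow x (Suc K) - mpow x (Suc (Suc K))"
    using mpow_commute[OF assms assms refl, of "Suc K"] supported_mpow[OF assms, of "Suc K"]
    by (simp only: mul_diff mul_E) (simp only: mpow.simps)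
  then have "(\<Sum>n\<le>Suc K. mpow x n) \<star> (E - x) = E - mpow x (Suc K) + (mpow x (Suc K) - mpow x (Suc (Suc K)))"
    by (simp only: sum.atMost_Suc add_mul Suc)
  also have "\<dots> = E - mpow x (Suc (Suc K))" by (rule ext)+ (simp del: mpow.simps)
  finally show ?case .
qed

text \<open>
  Modulo degrees greater than \<open>K\<close> the series may be replaced by its truncation at \<open>K\<close>, whose square is
  the truncated geometric series.
\<close>

lemma isqrt_square:
  assumes x: "vanishes_below 1 x" "supported x"
  shows "isqrt x \<star> isqrt x \<star> (E - x) = E"
proof (rule agree_all)
  fix K
  let ?S = "isqrt_trunc x K" and ?c = "\<lambda>n. complex_of_real (isqrt_coeff n)"
  have "agree K (?S \<star> ?S) (\<Sum>n\<le>K. mpow x n)"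
    unfolding agree_def
  proof (intro allI impI)
    fix a b k assume k: "deg k \<le> K"
    have zero: "n \<le> K" if "mpow x n a b k \<noteq> 0" for n
    proof (rule ccontr)
      assume "\<not> n \<le> K"
      then have "deg k < n" using k by simp
      then have "mpow x n a b k = 0"
        using vanishes_below_mpow[OF x(1), of n] by (simp only: vanishes_below_def)
      with that show False ..
    qed
    have "(?S \<star> ?S) a b k = (\<Sum>i\<le>K. \<Sum>j\<le>K. ?c i * ?c j * mpow x (i + j) a b k)"
    proof -
      have eq: "?S \<star> ?S = (\<Sum>i\<le>K. \<Sum>j\<le>K. scale (?c i) (scale (?c j) (mpow x (i + j))))"
        by (simp only: isqrt_trunc_def sum_mul, simp only: mul_sum, simp only: scale_mul,
            simp only: mul_scale mpow_add[OF x(2)])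
      show ?thesis unfolding eq sum_fun_apply scale_def mult.assoc ..
    qed
    also have "\<dots> = (\<Sum>(i, j)\<in>{..K} \<times> {..K}. ?c i * ?c j * mpow x (i + j) a b k)"
      by (rule sum.cartesian_product)
    also have "\<dots> = (\<Sum>(i, j)\<in>{(i, j). i + j \<le> K}. ?c i * ?c j * mpow x (i + j) a b k)"
      by (rule sum.mono_neutral_right) (use zero in auto)
    also have "\<dots> = (\<Sum>n\<le>K. \<Sum>i\<le>n. ?c i * ?c (n - i) * mpow x (i + (n - i)) a b k)"
      by (rule sum.triangle_reindex_eq)
    also have "\<dots> = (\<Sum>n\<le>K. of_real (\<Sum>i\<le>n. isqrt_coeff i * isqrt_coeff (n - i)) * mpow x n a b k)"
      unfolding of_real_sum sum_distrib_right by (intro sum.cong refl) simp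
    also have "\<dots> = (\<Sum>n\<le>K. mpow x n) a b k"
      unfolding isqrt_coeff_convolution by (simp add: sum_fun_apply)
    finally show "(?S \<star> ?S) a b k = (\<Sum>n\<le>K. mpow x n) a b k" .
  qed
  then have A: "agree K (?S \<star> ?S \<star> (E - x)) (E - mpow x (Suc K))"
    unfolding geometric_sum_mul[OF x(2), symmetric] by (rule agree_mul[OF _ agree_refl])
  have B: "agree K (E - mpow x (Suc K)) E"
    unfolding agree_def
  proof (intro allI impI)
    fix a b k assume "deg k \<le> K"
    then have "mpow x (Suc K) a b k = 0"
      using vanishes_below_mpow[OF x(1), of "Suc K"] unfolding vanishes_below_def by (metis le_imp_less_Suc)
    then show "(E - mpow x (Suc K)) a b k = E a b k" by (simp del: mpow.simps)
  qed
  have C: "agree K (isqrt x \<star> isqrt x \<star> (E - x)) (?S \<star> ?S \<star> (E - x))"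
    by (intro agree_mul agree_isqrt x agree_refl)
  show "agree K (isqrt x \<star> isqrt x \<star> (E - x)) E"
    by (rule agree_trans[OF C agree_trans[OF A B]])
qed

lemma direct_rotation_exists:
  assumes p: "projection p" and q: "projection q" and c: "\<And>a b. p a b 0 = q a b 0"
  defines "u \<equiv> (p \<star> q + (E - p) \<star> (E - q)) \<star> isqrt ((p - q) \<star> (p - q))"
  shows "unitary u" "u \<star> q \<star> adj u = p"
proof -
  let ?x = "(p - q) \<star> (p - q)"
  have supp: "supported p" "supported q" and idem: "p \<star> p = p" "q \<star> q = q"
    and sa: "adj p = p" "adj q = q"
    using p q by (auto simp: projection_def)
  have idem': "p \<star> (p \<star> F) = p \<star> F" "q \<star> (q \<star> F) = q \<star> F" for F
    by (simp_all add: mul_assoc[symmetric] idem)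
  have sx: "supported ?x" by (intro supported_intros supp)
  have "vanishes_below 1 (p - q)"
    unfolding vanishes_below_def
  proof (intro allI impI)
    fix a b k assume "deg k < 1"
    then show "(p - q) a b k = 0"
      using deg_eq_0_iff[of k] c[of a b] supportedD[OF supp(1), of a b k] supportedD[OF supp(2), of a b k]
      by (cases "k \<in> MI") auto
  qed
  then have vx: "vanishes_below 1 ?x"
    using vanishes_below_mul[of 1 "p - q" 0 "p - q"] vanishes_below_0 by simp
  have ax: "adj ?x = ?x" by (simp add: adj_mul adj_diff sa)
  have px: "p \<star> ?x = ?x \<star> p" "q \<star> ?x = ?x \<star> q"
    by (simp_all only: mul_distribs mul_assoc idem idem') (simp_all add: algebra_simps)
  show "unitary u" "u \<star> q \<star> adj u = p"
    unfolding u_def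
    by (rule direct_rotation[OF p q supported_isqrt[OF sx] adj_isqrt[OF vx sx ax] isqrt_square[OF vx sx]
          isqrt_commute[OF vx sx supp(1) px(1), symmetric] isqrt_commute[OF vx sx supp(2) px(2), symmetric]])+
qed

section \<open>Moments of coefficients\<close>

text \<open>
  The moments of a series, over the coefficients of degree at most \<open>d\<close>. Cutting off at \<open>d\<close> makes all
  sums finite; the estimates below are uniform in \<open>d\<close>. For \<open>r = 0\<close> this is the $\ell^1$ norm (note
  that \<open>0 ^ 0 = 1\<close>).
\<close>

definition series_norm :: "nat \<Rightarrow> nat \<Rightarrow> (multiindex \<Rightarrow> complex) \<Rightarrow> real" where
  "series_norm r d a = (\<Sum>k\<in>ball d. real (deg k) ^ r * cmod (a k))"

definition mat_norm :: "nat \<Rightarrow> nat \<Rightarrow> smat \<Rightarrow> real" where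
  "mat_norm r d F = (\<Sum>a<N. \<Sum>b<N. series_norm r d (F a b))"

lemma series_norm_nonneg: "series_norm r d a \<ge> 0"
  by (simp add: series_norm_def sum_nonneg)

lemma mat_norm_nonneg: "mat_norm r d F \<ge> 0"
  by (simp add: mat_norm_def sum_nonneg series_norm_nonneg)

lemma series_norm_add: "series_norm r d (a + b) \<le> series_norm r d a + series_norm r d b"
  unfolding series_norm_def sum.distrib[symmetric]
  by (rule sum_mono) (auto simp: ring_distribs[symmetric] intro!: mult_left_mono norm_triangle_ineq)

lemma series_norm_zero [simp]: "series_norm r d 0 = 0"
  by (simp add: series_norm_def)

lemma series_norm_sum: "series_norm r d (\<Sum>x\<in>A. f x) \<le> (\<Sum>x\<in>A. series_norm r d (f x))"
proof (induction A rule: infinite_finite_induct)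
  case (insert x A)
  show ?case
    unfolding sum.insert[OF insert.hyps]
    by (rule order_trans[OF series_norm_add]) (rule add_left_mono[OF insert.IH])
qed (simp_all only: sum.infinite sum.empty series_norm_zero not_False_eq_True order.refl)

text \<open>
  The degree behaves like a derivation: the \<open>r\<close>-th power of the degree of a product of monomials
  expands by the binomial theorem. The cocycle has modulus 1 and disappears.
\<close>

lemma series_norm_conv:
  "series_norm r d (conv a b) \<le> (\<Sum>q\<le>r. real (r choose q) * (series_norm q d a * series_norm (r - q) d b))"
proof -
  let ?f = "\<lambda>(i, j). real (deg i + deg j) ^ r * (cmod (a i) * cmod (b j))"
  have "series_norm r d (conv a b) \<le> (\<Sum>k\<in>ball d. \<Sum>x\<in>splits k. ?f x)"
    unfolding series_norm_def
  proof (rule sum_mono)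
    fix k
    have "cmod (conv a b k) \<le> (\<Sum>(i, j)\<in>splits k. cmod (a i) * cmod (b j))"
      unfolding conv_def by (rule order_trans[OF norm_sum]) (auto simp: case_prod_beta norm_mult)
    then have "real (deg k) ^ r * cmod (conv a b k) \<le>
        real (deg k) ^ r * (\<Sum>(i, j)\<in>splits k. cmod (a i) * cmod (b j))"
      by (rule mult_left_mono) simp
    also have "\<dots> = (\<Sum>x\<in>splits k. ?f x)"
      unfolding sum_distrib_left by (rule sum.cong) (auto dest!: splits_deg[symmetric])
    finally show "real (deg k) ^ r * cmod (conv a b k) \<le> (\<Sum>x\<in>splits k. ?f x)" .
  qed
  also have "\<dots> = (\<Sum>(k, x)\<in>(SIGMA k:ball d. splits k). ?f x)"
    by (rule sum.Sigma) auto
  also have "\<dots> = (\<Sum>x\<in>{(i, j). i \<in> MI \<and> j \<in> MI \<and> i + j \<in> ball d}. ?f x)"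
    by (rule sum.reindex_bij_witness[of _ "\<lambda>(i, j). (i + j, (i, j))" snd]) (auto simp: splits_def ball_def)
  also have "\<dots> \<le> (\<Sum>x\<in>ball d \<times> ball d. ?f x)"
    by (rule sum_mono2[OF finite_cartesian_product[OF finite_ball finite_ball]])
      (auto simp: ball_def deg_add case_prod_beta)
  also have "\<dots> = (\<Sum>(i, j)\<in>ball d \<times> ball d. \<Sum>q\<le>r. real (r choose q) *
      ((real (deg i) ^ q * cmod (a i)) * (real (deg j) ^ (r - q) * cmod (b j))))"
    by (rule sum.cong) (auto simp: binomial_ring sum_distrib_left sum_distrib_right mult_ac)
  also have "\<dots> = (\<Sum>q\<le>r. \<Sum>(i, j)\<in>ball d \<times> ball d. real (r choose q) *
      ((real (deg i) ^ q * cmod (a i)) * (real (deg j) ^ (r - q) * cmod (b j))))"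
    unfolding case_prod_beta by (rule sum.swap)
  also have "\<dots> = (\<Sum>q\<le>r. real (r choose q) * (series_norm q d a * series_norm (r - q) d b))"
    by (rule sum.cong[OF refl])
      (simp only: series_norm_def sum_product sum.cartesian_product, simp add: sum_distrib_left case_prod_beta)
  finally show ?thesis .
qed

lemma mat_norm_mul:
  "mat_norm r d (F \<star> G) \<le> (\<Sum>q\<le>r. real (r choose q) * (mat_norm q d F * mat_norm (r - q) d G))"
proof -
  have "mat_norm r d (F \<star> G) \<le> (\<Sum>a<N. \<Sum>b<N. \<Sum>c<N. \<Sum>q\<le>r. real (r choose q) *
      (series_norm q d (F a c) * series_norm (r - q) d (G c b)))"
    unfolding mat_norm_def mul_def
    by (intro sum_mono order_trans[OF series_norm_sum] series_norm_conv)
  also have "\<dots> = (\<Sum>q\<le>r. \<Sum>a<N. \<Sum>b<N. \<Sum>c<N. real (r choose q) *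
      (series_norm q d (F a c) * series_norm (r - q) d (G c b)))"
    by (simp only: sum.swap[where B = "{..r}"])
  also have "\<dots> \<le> (\<Sum>q\<le>r. real (r choose q) * (mat_norm q d F * mat_norm (r - q) d G))"
  proof (rule sum_mono)
    fix q
    let ?u = "\<lambda>a c. series_norm q d (F a c)" and ?v = "\<lambda>c b. series_norm (r - q) d (G c b)"
    have "(\<Sum>a<N. \<Sum>b<N. \<Sum>c<N. ?u a c * ?v c b) = (\<Sum>a<N. \<Sum>c<N. ?u a c * (\<Sum>b<N. ?v c b))"
      by (rule sum.cong[OF refl], subst sum.swap, simp only: sum_distrib_left)
    also have "\<dots> \<le> (\<Sum>a<N. \<Sum>c<N. ?u a c * mat_norm (r - q) d G)"
      unfolding mat_norm_def
      by (intro sum_mono mult_left_mono series_norm_nonneg member_le_sum sum_nonneg) auto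
    also have "\<dots> = mat_norm q d F * mat_norm (r - q) d G"
      unfolding mat_norm_def[of q] sum_distrib_right ..
    finally show "(\<Sum>a<N. \<Sum>b<N. \<Sum>c<N. real (r choose q) * (?u a c * ?v c b)) \<le>
        real (r choose q) * (mat_norm q d F * mat_norm (r - q) d G)"
      by (simp add: sum_distrib_left[symmetric] mult_left_mono)
  qed
  finally show ?thesis .
qed

text \<open>
  Finiteness of all moments, which characterises rapidly decreasing coefficients.
\<close>

definition tempered :: "smat \<Rightarrow> bool" where
  "tempered F \<longleftrightarrow> (\<forall>r. \<exists>C. \<forall>d. mat_norm r d F \<le> C)"

lemma tempered_mul:
  assumes "tempered F" "tempered G"
  shows "tempered (F \<star> G)"
  unfolding tempered_def
proof
  fix r
  obtain A B where A: "\<And>q d. mat_norm q d F \<le> A q" and B: "\<And>q d. mat_norm q d G \<le> B q"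
    using assms unfolding tempered_def by metis
  have "mat_norm r d (F \<star> G) \<le> (\<Sum>q\<le>r. real (r choose q) * (A q * B (r - q)))" for d
    by (rule order_trans[OF mat_norm_mul]; intro sum_mono mult_left_mono mult_mono A B mat_norm_nonneg)
      (auto intro: order_trans[OF mat_norm_nonneg A])
  then show "\<exists>C. \<forall>d. mat_norm r d (F \<star> G) \<le> C" by blast
qed

lemma mat_norm_add: "mat_norm r d (F + G) \<le> mat_norm r d F + mat_norm r d G"
  unfolding mat_norm_def sum.distrib[symmetric] by (intro sum_mono) (simp add: series_norm_add)

lemma mat_norm_minus [simp]: "mat_norm r d (- F) = mat_norm r d F"
  by (simp add: mat_norm_def series_norm_def)

lemma tempered_add:
  assumes "tempered F" "tempered G" shows "tempered (F + G)"
  using assms unfolding tempered_def by (meson add_mono mat_norm_add order_trans)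

lemma tempered_minus: "tempered F \<Longrightarrow> tempered (- F)"
  by (simp add: tempered_def)

lemma tempered_diff: "tempered F \<Longrightarrow> tempered G \<Longrightarrow> tempered (F - G)"
  using tempered_add[OF _ tempered_minus, of F G] by simp

lemma linear_recursion_bound:
  fixes y :: "nat \<Rightarrow> real"
  assumes "\<And>n. y (Suc n) \<le> \<alpha> * y n + D * \<rho> ^ n" "y 0 \<le> C" "0 \<le> \<alpha>" "\<alpha> < \<rho>" "D \<le> C * (\<rho> - \<alpha>)"
  shows "y n \<le> C * \<rho> ^ n"
proof (induction n)
  case (Suc n)
  have "y (Suc n) \<le> \<alpha> * (C * \<rho> ^ n) + (C * (\<rho> - \<alpha>)) * \<rho> ^ n"
    using assms by (intro order_trans[OF assms(1)] add_mono mult_left_mono mult_right_mono Suc) auto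
  then show ?case by (simp add: algebra_simps)
qed (use assms in simp)

text \<open>
  The point is that the same rate \<open>\<rho>\<close> works for all moments, although only the zeroth one is known
  to be small. By the Leibniz rule the \<open>r\<close>-th moment of $x^{n+1}$ is at most \<open>\<alpha>\<close> times the \<open>r\<close>-th
  moment of $x^n$, plus lower moments of $x^n$ which grow like $\rho^n$ by induction.
\<close>

lemma mat_norm_mpow_bound:
  assumes x: "tempered x" "\<And>d. mat_norm 0 d x \<le> \<alpha>" and \<alpha>: "0 \<le> \<alpha>" "\<alpha> < \<rho>"
  shows "\<exists>C\<ge>0. \<forall>n d. mat_norm r d (mpow x n) \<le> C * \<rho> ^ n"
proof (induction r rule: less_induct)
  case (less r)
  obtain A where A: "\<And>q d. mat_norm q d x \<le> A q"
    using x(1) unfolding tempered_def by metis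
  have A0: "A q \<ge> 0" for q by (rule order_trans[OF mat_norm_nonneg A])
  have "\<forall>q. \<exists>C. q < r \<longrightarrow> C \<ge> 0 \<and> (\<forall>n d. mat_norm q d (mpow x n) \<le> C * \<rho> ^ n)"
    using less by metis
  then obtain B where B: "\<And>q. q < r \<Longrightarrow> B q \<ge> 0" "\<And>q n d. q < r \<Longrightarrow> mat_norm q d (mpow x n) \<le> B q * \<rho> ^ n"
    by metis
  define D where "D = (\<Sum>q\<in>{1..r}. real (r choose q) * (A q * B (r - q)))"
  have D0: "D \<ge> 0" unfolding D_def by (intro sum_nonneg mult_nonneg_nonneg A0 B) auto
  (* The initial value of the recursion: moments of the identity matrix. *)
  obtain C0 where C0: "\<And>d. mat_norm r d E \<le> C0"
  proof
    fix d
    have "series_norm r d (E a b) \<le> 1" for a b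
    proof -
      have "series_norm r d (E a b) \<le> (\<Sum>k\<in>ball d. if k = 0 then 1 else 0)"
        unfolding series_norm_def by (rule sum_mono) (auto simp: E_def cmat_def const_def power_0_left)
      also have "\<dots> \<le> 1" by (simp add: sum.delta)
      finally show ?thesis .
    qed
    then show "mat_norm r d E \<le> (\<Sum>a<N. \<Sum>b<N. 1)"
      unfolding mat_norm_def by (intro sum_mono)
  qed
  (* With this constant both the initial value and the inhomogeneity of the recursion are absorbed. *)
  define C where "C = max C0 (D / (\<rho> - \<alpha>))"
  have "mat_norm r d (mpow x n) \<le> C * \<rho> ^ n" for n d
  proof (rule linear_recursion_bound[where y = "\<lambda>n. mat_norm r d (mpow x n)" and \<alpha> = \<alpha> and D = D])
    fix n
    have "mat_norm r d (mpow x (Suc n)) \<le> (\<Sum>q\<le>r. real (r choose q) * (mat_norm q d x * mat_norm (r - q) d (mpow x n)))"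
      unfolding mpow.simps by (rule mat_norm_mul)
    also have "\<dots> = mat_norm 0 d x * mat_norm r d (mpow x n) +
        (\<Sum>q\<in>{1..r}. real (r choose q) * (mat_norm q d x * mat_norm (r - q) d (mpow x n)))"
      by (simp add: atMost_atLeast0 sum.atLeast_Suc_atMost)
    also have "\<dots> \<le> \<alpha> * mat_norm r d (mpow x n) + (\<Sum>q\<in>{1..r}. real (r choose q) * (A q * (B (r - q) * \<rho> ^ n)))"
      by (intro add_mono mult_right_mono x(2) sum_mono mult_left_mono mult_mono A B mat_norm_nonneg A0) auto
    also have "(\<Sum>q\<in>{1..r}. real (r choose q) * (A q * (B (r - q) * \<rho> ^ n))) = D * \<rho> ^ n"
      unfolding D_def sum_distrib_right by (simp add: mult.assoc)
    finally show "mat_norm r d (mpow x (Suc n)) \<le> \<alpha> * mat_norm r d (mpow x n) + D * \<rho> ^ n" .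
  qed (use \<alpha> C0 in \<open>auto simp: C_def le_max_iff_disj pos_divide_le_eq[symmetric]\<close>)
  moreover have "C \<ge> 0" unfolding C_def using D0 \<alpha> by (simp add: le_max_iff_disj)
  ultimately show ?case by blast
qed

lemma tempered_isqrt:
  assumes x: "tempered x" "\<And>d. mat_norm 0 d x \<le> \<alpha>" and \<alpha>: "0 \<le> \<alpha>" "\<alpha> < 1"
  shows "tempered (isqrt x)"
  unfolding tempered_def
proof
  fix r
  (* Any rate strictly between the l1 bound and 1 will do. *)
  define \<rho> where "\<rho> = (\<alpha> + 1) / 2"
  have \<rho>: "\<alpha> < \<rho>" "\<rho> < 1" "0 \<le> \<rho>" using \<alpha> by (auto simp: \<rho>_def)
  obtain C where C: "C \<ge> 0" "\<And>n d. mat_norm r d (mpow x n) \<le> C * \<rho> ^ n"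
    using mat_norm_mpow_bound[OF x \<alpha>(1) \<rho>(1)] by metis
  have "mat_norm r d (isqrt x) \<le> C * (1 / (1 - \<rho>))" for d
  proof -
    have "series_norm r d (isqrt x a b) \<le> (\<Sum>n\<le>d. series_norm r d (mpow x n a b))" for a b
    proof -
      have "series_norm r d (isqrt x a b) \<le> (\<Sum>k\<in>ball d. real (deg k) ^ r * (\<Sum>n\<le>d. cmod (mpow x n a b k)))"
        unfolding series_norm_def
      proof (intro sum_mono mult_left_mono)
        fix k assume k: "k \<in> ball d"
        have "cmod (isqrt x a b k) \<le> (\<Sum>n\<le>deg k. cmod (mpow x n a b k))"
          unfolding isqrt_def
          by (rule order_trans[OF norm_sum], rule sum_mono)
            (simp add: norm_mult isqrt_coeff_nonneg isqrt_coeff_le_1 mult_left_le_one_le)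
        also have "\<dots> \<le> (\<Sum>n\<le>d. cmod (mpow x n a b k))"
          by (rule sum_mono2) (use k in \<open>auto simp: ball_def\<close>)
        finally show "cmod (isqrt x a b k) \<le> (\<Sum>n\<le>d. cmod (mpow x n a b k))" .
      qed auto
      also have "\<dots> = (\<Sum>n\<le>d. series_norm r d (mpow x n a b))"
        unfolding series_norm_def sum_distrib_left by (rule sum.swap)
      finally show ?thesis .
    qed
    then have "mat_norm r d (isqrt x) \<le> (\<Sum>a<N. \<Sum>b<N. \<Sum>n\<le>d. series_norm r d (mpow x n a b))"
      unfolding mat_norm_def by (intro sum_mono)
    also have "\<dots> = (\<Sum>n\<le>d. mat_norm r d (mpow x n))"
      unfolding mat_norm_def by (simp only: sum.swap[where B = "{..d}"])
    also have "\<dots> \<le> (\<Sum>n\<le>d. C * \<rho> ^ n)" by (intro sum_mono C)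
    also have "\<dots> \<le> C * (1 / (1 - \<rho>))"
      unfolding sum_distrib_left[symmetric]
    proof (rule mult_left_mono[OF _ C(1)])
      have "(\<Sum>n\<le>d. \<rho> ^ n) = (1 - \<rho> ^ Suc d) / (1 - \<rho>)"
        using \<rho> by (simp add: sum_gp0 atMost_atLeast0[symmetric])
      also have "\<dots> \<le> 1 / (1 - \<rho>)" using \<rho> by (intro divide_right_mono) auto
      finally show "(\<Sum>n\<le>d. \<rho> ^ n) \<le> 1 / (1 - \<rho>)" .
    qed
    finally show ?thesis .
  qed
  then show "\<exists>C. \<forall>d. mat_norm r d (isqrt x) \<le> C" by blast
qed

end

section \<open>Projections in complex matrix algebras\<close>

lemma sum_lessThan_add: "(\<Sum>i<(m::nat) + n. f i) = (\<Sum>i<m. f i) + (\<Sum>i<n. f (m + i) :: 'a::comm_monoid_add)"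
  by (induction n) (auto simp: add.assoc)

definition complex_projection :: "nat \<Rightarrow> (nat \<Rightarrow> nat \<Rightarrow> complex) \<Rightarrow> bool" where
  "complex_projection N P \<longleftrightarrow> (\<forall>a<N. \<forall>b<N. P b a = cnj (P a b) \<and> (\<Sum>c<N. P a c * P c b) = P a b)"

lemma complex_projectionD:
  assumes "complex_projection N P" "a < N" "b < N"
  shows "P b a = cnj (P a b)" "(\<Sum>c<N. P a c * P c b) = P a b"
  using assms unfolding complex_projection_def by blast+

lemma complex_projection_diag:
  assumes "complex_projection N P" "a < N"
  shows "P a a = of_real (\<Sum>c<N. (cmod (P a c))\<^sup>2)"
proof -
  have "P a a = (\<Sum>c<N. P a c * P c a)" using complex_projectionD(2)[OF assms assms(2)] by simp
  also have "\<dots> = (\<Sum>c<N. of_real ((cmod (P a c))\<^sup>2))"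
  proof (rule sum.cong[OF refl])
    fix c assume "c \<in> {..<N}"
    then have "P c a = cnj (P a c)" using complex_projectionD(1)[OF assms] by simp
    then show "P a c * P c a = of_real ((cmod (P a c))\<^sup>2)" by (simp only: complex_norm_square)
  qed
  finally show ?thesis by simp
qed

text \<open>
  If \<open>P\<close> has a nonzero entry then some diagonal entry is positive, and the corresponding column,
  normalised, is a unit vector \<open>w\<close> fixed by \<open>P\<close>. Subtracting the projection onto \<open>w\<close> gives a projection
  whose trace is smaller by 1, and traces of projections are nonnegative.
\<close>

lemma complex_projection_rank_one_sum:
  assumes "complex_projection N P"
  shows "\<exists>r v. (\<forall>a<N. \<forall>b<N. P a b = (\<Sum>c<r. v c a * cnj (v c b))) \<and> (\<Sum>a<N. P a a) = of_nat r"
proof -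
  have nn: "Re (P a a) \<ge> 0" if "complex_projection N P" "a < N" for a P
    using complex_projection_diag[OF that] by (simp add: sum_nonneg)
  have main: "\<exists>r v. (\<forall>a<N. \<forall>b<N. P a b = (\<Sum>c<r. v c a * cnj (v c b))) \<and> (\<Sum>a<N. P a a) = of_nat r"
    if "complex_projection N P" "Re (\<Sum>a<N. P a a) < real n" for n P
    using that
  proof (induction n arbitrary: P)
    case 0
    have "(\<Sum>a<N. Re (P a a)) \<ge> 0" by (intro sum_nonneg nn 0) auto
    with 0 show ?case by simp
  next
    case (Suc n)
    note P = Suc.prems(1) and herm = complex_projectionD(1)[OF Suc.prems(1)] and idem = complex_projectionD(2)[OF Suc.prems(1)]
    show ?case
    proof (cases "\<forall>a<N. \<forall>b<N. P a b = 0")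
      case True
      then show ?thesis by (intro exI[of _ 0]) auto
    next
      case False
      then obtain j b where j: "j < N" "b < N" "P j b \<noteq> 0" by blast
      define \<alpha> where "\<alpha> = (\<Sum>c<N. (cmod (P j c))\<^sup>2)"
      have Pjj: "P j j = of_real \<alpha>" unfolding \<alpha>_def by (rule complex_projection_diag[OF P j(1)])
      have "(cmod (P j b))\<^sup>2 \<le> \<alpha>" unfolding \<alpha>_def by (rule member_le_sum) (use j in auto)
      moreover have "(cmod (P j b))\<^sup>2 > 0" using j by simp
      ultimately have \<alpha>: "\<alpha> > 0" by linarith
      (* The squared length of the j-th column of P is the diagonal entry. *)
      define w where "w i = P i j / of_real (sqrt \<alpha>)" for i
      have sq: "complex_of_real (sqrt \<alpha>) * of_real (sqrt \<alpha>) = of_real \<alpha>"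
        using \<alpha> by (simp flip: of_real_mult)
      have ww: "w a * cnj (w b) = P a j * P j b / of_real \<alpha>" if "b < N" for a b
        using herm[OF that j(1)] sq by (simp add: w_def)
      have norm: "(\<Sum>c<N. w c * cnj (w c)) = 1"
      proof -
        have "(\<Sum>c<N. w c * cnj (w c)) = (\<Sum>c<N. P j c * P c j) / of_real \<alpha>"
          unfolding sum_divide_distrib by (rule sum.cong) (auto simp: ww mult.commute)
        then show ?thesis using idem[OF j(1) j(1)] Pjj \<alpha> by simp
      qed
      have Pw: "(\<Sum>c<N. P a c * w c) = w a" if "a < N" for a
        using idem[OF that j(1)] by (simp add: w_def sum_divide_distrib[symmetric])
      have wP: "(\<Sum>c<N. cnj (w c) * P c b) = cnj (w b)" if "b < N" for b
      proof -
        have "(\<Sum>c<N. cnj (w c) * P c b) = cnj (\<Sum>c<N. P b c * w c)"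
          unfolding cnj_sum
        proof (rule sum.cong[OF refl])
          fix c assume "c \<in> {..<N}"
          then have "P c b = cnj (P b c)" using herm[OF that] by simp
          then show "cnj (w c) * P c b = cnj (P b c * w c)" by simp
        qed
        then show ?thesis using Pw[OF that] by simp
      qed
      define P' where "P' a b = P a b - w a * cnj (w b)" for a b
      have "complex_projection N P'"
        unfolding complex_projection_def
      proof (intro allI impI conjI)
        fix a b assume ab: "a < N" "b < N"
        show "P' b a = cnj (P' a b)" using herm[OF ab] by (simp add: P'_def mult.commute)
        have "(\<Sum>c<N. P' a c * P' c b) = (\<Sum>c<N. P a c * P c b - w a * (cnj (w c) * P c b)
            - (P a c * w c) * cnj (w b) + w a * cnj (w b) * (w c * cnj (w c)))"
          by (rule sum.cong) (auto simp: P'_def algebra_simps)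
        also have "\<dots> = (\<Sum>c<N. P a c * P c b) - w a * (\<Sum>c<N. cnj (w c) * P c b)
            - (\<Sum>c<N. P a c * w c) * cnj (w b) + w a * cnj (w b) * (\<Sum>c<N. w c * cnj (w c))"
          by (simp only: sum.distrib sum_subtractf sum_distrib_left sum_distrib_right)
        also have "\<dots> = P' a b" using ab by (simp add: idem wP Pw norm P'_def)
        finally show "(\<Sum>c<N. P' a c * P' c b) = P' a b" .
      qed
      moreover have tr': "(\<Sum>a<N. P' a a) = (\<Sum>a<N. P a a) - 1"
        by (simp add: P'_def sum_subtractf norm)
      moreover from this have "Re (\<Sum>a<N. P' a a) < real n" using Suc.prems(2) by simp
      ultimately obtain r v where rv: "\<forall>a<N. \<forall>b<N. P' a b = (\<Sum>c<r. v c a * cnj (v c b))"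
        "(\<Sum>a<N. P' a a) = of_nat r"
        using Suc.IH by blast
      define v' where "v' c = (if c < r then v c else w)" for c
      have "P a b = (\<Sum>c<Suc r. v' c a * cnj (v' c b))" if "a < N" "b < N" for a b
      proof -
        have "P a b = P' a b + w a * cnj (w b)" by (simp add: P'_def)
        also have "P' a b = (\<Sum>c<r. v' c a * cnj (v' c b))" using rv(1) that by (simp add: v'_def)
        finally show ?thesis by (simp add: v'_def)
      qed
      moreover have "(\<Sum>a<N. P a a) = of_nat (Suc r)" using tr' rv(2) by simp
      ultimately show ?thesis by blast
    qed
  qed
  show ?thesis by (rule main[OF assms, of "Suc (nat \<lceil>Re (\<Sum>a<N. P a a)\<rceil>)"]) linarith
qed

text \<open>
  The vectors obtained for \<open>P\<close> and for \<open>1 - P\<close> are \<open>N\<close> in number, by comparing traces, and form the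
  columns of a square matrix \<open>C\<close> with $C C^* = 1$. Orthonormality, $C^* C = 1$, follows since a right
  inverse of a square matrix is a left inverse.
\<close>

lemma complex_projection_diagonalize:
  assumes P: "complex_projection N P"
  shows "\<exists>r C. (\<Sum>a<N. P a a) = of_nat r \<and> r \<le> N \<and> (\<forall>a<N. \<forall>b<N.
    P a b = (\<Sum>c<r. C a c * cnj (C b c)) \<and>
    (\<Sum>c<N. C a c * cnj (C b c)) = (if a = b then 1 else 0) \<and>
    (\<Sum>c<N. cnj (C c a) * C c b) = (if a = b then 1 else 0))"
proof -
  define Q where "Q a b = (if a = b then 1 else 0) - P a b" for a b
  note herm = complex_projectionD(1)[OF P] and idem = complex_projectionD(2)[OF P]
  have "complex_projection N Q"
    unfolding complex_projection_def
  proof (intro allI impI conjI)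
    fix a b assume ab: "a < N" "b < N"
    show "Q b a = cnj (Q a b)" using herm[OF ab] by (simp add: Q_def)
    have "(\<Sum>c<N. Q a c * Q c b) = (\<Sum>c<N. (if c = a then Q a b else 0) - P a c * Q c b)"
      by (rule sum.cong) (auto simp: Q_def algebra_simps)
    also have "\<dots> = Q a b - (\<Sum>c<N. P a c * Q c b)"
      using ab by (simp add: sum_subtractf)
    also have "(\<Sum>c<N. P a c * Q c b) = (\<Sum>c<N. (if c = b then P a b else 0) - P a c * P c b)"
      by (rule sum.cong) (auto simp: Q_def algebra_simps)
    also have "\<dots> = 0" using ab by (simp add: sum_subtractf idem)
    finally show "(\<Sum>c<N. Q a c * Q c b) = Q a b" by simp
  qed
  then obtain r' v' where Q: "\<And>a b. a < N \<Longrightarrow> b < N \<Longrightarrow> Q a b = (\<Sum>c<r'. v' c a * cnj (v' c b))"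
    "(\<Sum>a<N. Q a a) = of_nat r'"
    using complex_projection_rank_one_sum by blast
  obtain r v where P': "\<And>a b. a < N \<Longrightarrow> b < N \<Longrightarrow> P a b = (\<Sum>c<r. v c a * cnj (v c b))"
    "(\<Sum>a<N. P a a) = of_nat r"
    using complex_projection_rank_one_sum[OF P] by blast
  have "(of_nat (r + r') :: complex) = (\<Sum>a<N. P a a + Q a a)"
    by (simp add: sum.distrib P'(2) Q(2))
  also have "\<dots> = of_nat N" by (simp add: Q_def)
  finally have N: "N = r + r'" by (metis of_nat_eq_iff)
  define C where "C a c = (if c < r then v c a else v' (c - r) a)" for a c
  have CC: "(\<Sum>c<N. C a c * cnj (C b c)) = (if a = b then 1 else 0)" if "a < N" "b < N" for a b
  proof -
    have "(\<Sum>c<N. C a c * cnj (C b c)) =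
        (\<Sum>c<r. C a c * cnj (C b c)) + (\<Sum>c<r'. C a (r + c) * cnj (C b (r + c)))"
      unfolding N by (rule sum_lessThan_add)
    also have "\<dots> = P a b + Q a b" using that by (simp add: C_def P' Q)
    finally show ?thesis by (simp add: Q_def)
  qed
  define M where "M = mat N N (\<lambda>(a, c). C a c)"
  define M' where "M' = mat N N (\<lambda>(c, b). cnj (C b c))"
  have c: "M \<in> carrier_mat N N" "M' \<in> carrier_mat N N" by (auto simp: M_def M'_def)
  have "M * M' = 1\<^sub>m N"
    by (rule eq_matI) (auto simp: M_def M'_def scalar_prod_def CC atLeast0LessThan)
  then have M'M: "M' * M = 1\<^sub>m N" by (rule mat_mult_left_right_inverse[OF c])
  have "(\<Sum>c<N. cnj (C c a) * C c b) = (if a = b then 1 else 0)" if "a < N" "b < N" for a b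
  proof -
    have "(M' * M) $$ (a, b) = (\<Sum>c<N. cnj (C c a) * C c b)"
      using that by (simp add: M_def M'_def scalar_prod_def atLeast0LessThan)
    with that show ?thesis unfolding M'M by simp
  qed
  moreover have "P a b = (\<Sum>c<r. C a c * cnj (C b c))" if "a < N" "b < N" for a b
    using P'(1)[OF that] by (simp add: C_def)
  ultimately show ?thesis using P'(2) N CC by (intro exI[of _ r] exI[of _ C]) simp
qed

context series_matrices
begin

definition diag_one :: "nat \<Rightarrow> smat" where
  "diag_one r = cmat (\<lambda>a b. if a = b \<and> a < r then 1 else 0)"

lemma cmat_cong: "(\<And>a b. a < N \<Longrightarrow> b < N \<Longrightarrow> C a b = D a b) \<Longrightarrow> cmat C = cmat D"
  by (intro ext) (auto simp: cmat_def)

lemma cmat_inject: "cmat C = cmat D \<Longrightarrow> a < N \<Longrightarrow> b < N \<Longrightarrow> C a b = D a b"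
  by (drule fun_cong[of _ _ a], drule fun_cong[of _ _ b], drule fun_cong[of _ _ 0])
    (simp add: cmat_def const_def)

lemma constant_projection_diagonalize:
  assumes "projection (cmat P)"
  obtains C r where "unitary (cmat C)" "cmat P = cmat C \<star> diag_one r \<star> adj (cmat C)"
    "tr (cmat P) = of_nat r" "r \<le> N"
proof -
  have "complex_projection N P"
    unfolding complex_projection_def
  proof (intro allI impI conjI)
    fix a b assume ab: "a < N" "b < N"
    have eq: "cmat (\<lambda>a b. cnj (P b a)) = cmat P" "cmat (\<lambda>a b. \<Sum>c<N. P a c * P c b) = cmat P"
      using assms by (auto simp: projection_def adj_cmat cmat_mul)
    show "P b a = cnj (P a b)" using cmat_inject[OF eq(1) ab(2,1)] by (rule sym)
    show "(\<Sum>c<N. P a c * P c b) = P a b" by (rule cmat_inject[OF eq(2) ab])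
  qed
  from complex_projection_diagonalize[OF this] obtain r C where tr: "(\<Sum>a<N. P a a) = of_nat r" and r: "r \<le> N" and
    all: "\<forall>a<N. \<forall>b<N. P a b = (\<Sum>c<r. C a c * cnj (C b c)) \<and>
      (\<Sum>c<N. C a c * cnj (C b c)) = (if a = b then 1 else 0) \<and>
      (\<Sum>c<N. cnj (C c a) * C c b) = (if a = b then 1 else 0)"
    by (elim exE conjE) (rule that)
  have C: "P a b = (\<Sum>c<r. C a c * cnj (C b c))"
    "(\<Sum>c<N. C a c * cnj (C b c)) = (if a = b then 1 else 0)"
    "(\<Sum>c<N. cnj (C c a) * C c b) = (if a = b then 1 else 0)" if "a < N" "b < N" for a b
    using all that by simp_all
  have U: "unitary (cmat C)"
    unfolding unitary_def adj_cmat cmat_mul E_def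
    by (intro conjI supported_cmat cmat_cong) (simp_all add: C(2,3))
  have V: "cmat P = cmat C \<star> diag_one r \<star> adj (cmat C)"
    unfolding diag_one_def adj_cmat cmat_mul
  proof (rule cmat_cong)
    fix a b assume ab: "a < N" "b < N"
    have "(\<Sum>d<N. (\<Sum>c<N. C a c * (if c = d \<and> c < r then 1 else 0)) * cnj (C b d)) =
        (\<Sum>d<N. if d < r then C a d * cnj (C b d) else 0)"
    proof (rule sum.cong[OF refl])
      fix d assume "d \<in> {..<N}"
      then have "(\<Sum>c<N. C a c * (if c = d \<and> c < r then 1 else 0)) =
          (\<Sum>c<N. if c = d then (if d < r then C a d else 0) else 0)"
        by (intro sum.cong) auto
      also have "\<dots> = (if d < r then C a d else 0)" using \<open>d \<in> {..<N}\<close> by simp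
      finally show "(\<Sum>c<N. C a c * (if c = d \<and> c < r then 1 else 0)) * cnj (C b d) =
          (if d < r then C a d * cnj (C b d) else 0)" by simp
    qed
    also have "\<dots> = (\<Sum>d\<in>{..<N} \<inter> {d. d < r}. C a d * cnj (C b d))"
      by (simp add: sum.If_cases)
    also have "{..<N} \<inter> {d. d < r} = {..<r}" using r by auto
    finally show "P a b = (\<Sum>d<N. (\<Sum>c<N. C a c * (if c = d \<and> c < r then 1 else 0)) * cnj (C b d))"
      using C(1)[OF ab] by simp
  qed
  have T: "tr (cmat P) = of_nat r"
    unfolding tr_def tr[symmetric] by (rule sum.cong) (auto simp: cmat_def const_def)
  show thesis by (rule that[OF U V T r])
qed

section \<open>Projections with rapidly decreasing coefficients\<close>

lemma mat_norm_dilate_le: "0 \<le> t \<Longrightarrow> t \<le> 1 \<Longrightarrow> mat_norm r d (dilate t F) \<le> mat_norm r d F"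
  unfolding mat_norm_def series_norm_def dilate_def
  by (intro sum_mono mult_left_mono) (auto simp: norm_mult norm_power power_le_one intro!: mult_left_le_one_le)

lemma tempered_dilate: "0 \<le> t \<Longrightarrow> t \<le> 1 \<Longrightarrow> tempered F \<Longrightarrow> tempered (dilate t F)"
  unfolding tempered_def by (meson order_trans mat_norm_dilate_le)

lemma mat_norm_dilate_diff:
  assumes "0 \<le> s" "s \<le> 1" "0 \<le> t" "t \<le> 1"
  shows "mat_norm 0 d (dilate s F - dilate t F) \<le> \<bar>s - t\<bar> * mat_norm 1 d F"
  unfolding mat_norm_def series_norm_def sum_distrib_left
proof (intro sum_mono)
  fix a b k
  have "cmod ((dilate s F - dilate t F) a b k) = \<bar>s ^ deg k - t ^ deg k\<bar> * cmod (F a b k)"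
    by (simp add: dilate_def norm_mult flip: left_diff_distrib of_real_power of_real_diff)
  also have "\<bar>s ^ deg k - t ^ deg k\<bar> \<le> real (deg k) * \<bar>s - t\<bar>"
    using norm_power_diff[of s t "deg k"] assms by simp
  finally show "real (deg k) ^ 0 * cmod ((dilate s F - dilate t F) a b k) \<le>
      \<bar>s - t\<bar> * (real (deg k) ^ 1 * cmod (F a b k))"
    by (simp add: mult_right_mono mult_ac)
qed

lemma mat_norm_at_0_le: "mat_norm r d (cmat C) \<le> (\<Sum>a<N. \<Sum>b<N. cmod (C a b))"
  unfolding mat_norm_def
proof (intro sum_mono)
  fix a b
  have "series_norm r d (cmat C a b) \<le> (\<Sum>k\<in>ball d. if k = 0 then cmod (C a b) else 0)"
    unfolding series_norm_def by (rule sum_mono) (auto simp: cmat_def const_def power_0_left)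
  also have "\<dots> \<le> cmod (C a b)" by (simp add: sum.delta)
  finally show "series_norm r d (cmat C a b) \<le> cmod (C a b)" .
qed

lemma tempered_cmat: "tempered (cmat C)"
  unfolding tempered_def using mat_norm_at_0_le by blast

lemma tempered_E: "tempered E"
  unfolding E_def by (rule tempered_cmat)

lemma series_norm_series_star: "series_norm r d (series_star a) = series_norm r d a"
  unfolding series_norm_def
  by (rule sum.reindex_bij_witness[of _ "\<lambda>k. k \<circ> bar" "\<lambda>k. k \<circ> bar"])
    (auto simp: ball_def cmod_series_star)

lemma mat_norm_adj: "mat_norm r d (adj F) = mat_norm r d F"
  unfolding mat_norm_def adj_def series_norm_series_star by (rule sum.swap)

lemma tempered_adj: "tempered F \<Longrightarrow> tempered (adj F)"
  by (simp add: tempered_def mat_norm_adj)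

lemmas tempered_intros = tempered_mul tempered_add tempered_diff tempered_E tempered_adj

text \<open>
  The path of dilations from \<open>dilate 0 p\<close> to \<open>p\<close> is divided into so many steps that consecutive
  projections are at $\ell^1$ distance less than 1; the unitary is the product of the direct
  rotations.
\<close>

lemma tempered_projection_homotopy:
  assumes p: "projection p" "tempered p"
  obtains u where "unitary u" "tempered u" "p = u \<star> dilate 0 p \<star> adj u"
proof -
  obtain l where l: "\<And>d. mat_norm 1 d p \<le> l" using p(2) unfolding tempered_def by blast
  have l0: "l \<ge> 0" by (rule order_trans[OF mat_norm_nonneg l])
  (* Here l is a Lipschitz constant of the path, so 1 / M is a step of l1 length less than 1. *)
  define M where "M = Suc (nat \<lceil>l\<rceil>)"
  have M: "l < real M" "M > 0" unfolding M_def by linarith+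
  define p' where "p' i = dilate (real i / real M) p" for i
  have step: "\<exists>u. unitary u \<and> tempered u \<and> u \<star> p' i \<star> adj u = p' (Suc i)" if i: "i < M" for i
  proof -
    let ?y = "p' (Suc i) - p' i"
    let ?u = "(p' (Suc i) \<star> p' i + (E - p' (Suc i)) \<star> (E - p' i)) \<star> isqrt (?y \<star> ?y)"
    have pr: "projection (p' j)" for j unfolding p'_def by (rule projection_dilate[OF p(1)])
    have te: "tempered (p' j)" if "j \<le> M" for j
      unfolding p'_def by (rule tempered_dilate) (use p(2) that M in auto)
    have y: "mat_norm 0 d ?y \<le> l / real M" for d
    proof -
      have "mat_norm 0 d ?y \<le> \<bar>real (Suc i) / real M - real i / real M\<bar> * mat_norm 1 d p"
        unfolding p'_def by (rule mat_norm_dilate_diff) (use i M in \<open>auto simp: divide_le_eq\<close>)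
      also have "\<bar>real (Suc i) / real M - real i / real M\<bar> = 1 / real M"
        using M by (simp flip: diff_divide_distrib)
      also have "1 / real M * mat_norm 1 d p \<le> l / real M"
        using l[of d] M by (simp add: divide_right_mono)
      finally show ?thesis .
    qed
    have x: "mat_norm 0 d (?y \<star> ?y) \<le> (l / real M)\<^sup>2" for d
    proof -
      have "mat_norm 0 d (?y \<star> ?y) \<le> mat_norm 0 d ?y * mat_norm 0 d ?y"
        using mat_norm_mul[of 0 d ?y ?y] by simp
      also have "\<dots> \<le> l / real M * (l / real M)"
        using y[of d] l0 by (intro mult_mono mat_norm_nonneg) auto
      finally show ?thesis by (simp add: power2_eq_square)
    qed
    have "(l / real M)\<^sup>2 < 1" using M l0 by (simp add: power_less_one_iff)
    then have "tempered (isqrt (?y \<star> ?y))"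
      by (intro tempered_isqrt[OF _ x]) (use i in \<open>auto intro!: tempered_intros te\<close>)
    then have "tempered ?u" using i by (intro tempered_intros te) auto
    moreover have "unitary ?u" "?u \<star> p' i \<star> adj ?u = p' (Suc i)"
      by (rule direct_rotation_exists[OF pr pr], simp add: p'_def)+
    ultimately show ?thesis by blast
  qed
  have "\<exists>u. unitary u \<and> tempered u \<and> p' i = u \<star> p' 0 \<star> adj u" if "i \<le> M" for i
    using that
  proof (induction i)
    case 0
    have "supported (p' 0)" using p(1) by (simp add: p'_def projection_def supported_dilate)
    then show ?case
      by (intro exI[of _ E]) (auto simp: unitary_def supported_E E_mul mul_E tempered_E)
  next
    case (Suc i)
    then obtain u where u: "unitary u" "tempered u" "p' i = u \<star> p' 0 \<star> adj u" by auto
    obtain w where w: "unitary w" "tempered w" "w \<star> p' i \<star> adj w = p' (Suc i)"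
      using step[of i] Suc.prems by auto
    have "p' (Suc i) = (w \<star> u) \<star> p' 0 \<star> adj (w \<star> u)"
      unfolding w(3)[symmetric] u(3) adj_mul by (simp only: mul_assoc)
    then show ?case using u w unitary_mul tempered_mul by blast
  qed
  from this[of M] obtain u where "unitary u" "tempered u" "p' M = u \<star> p' 0 \<star> adj u" by auto
  then show thesis using that M by (simp add: p'_def)
qed

lemma tempered_projection_diagonalize:
  assumes p: "projection p" "tempered p"
  obtains u r where "unitary u" "tempered u" "p = u \<star> diag_one r \<star> adj u" "tr p = of_nat r"
proof -
  obtain u where u: "unitary u" "tempered u" "p = u \<star> dilate 0 p \<star> adj u"
    using tempered_projection_homotopy[OF p] .
  have sp: "supported p" using p by (simp add: projection_def)
  let ?P = "cmat (\<lambda>a b. p a b 0)"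
  have P: "dilate 0 p = ?P" by (rule dilate_0[OF sp])
  have "projection ?P" using projection_dilate[OF p(1), of 0] unfolding P .
  then obtain C r where C: "unitary (cmat C)" "?P = cmat C \<star> diag_one r \<star> adj (cmat C)"
    "tr ?P = of_nat r" by (rule constant_projection_diagonalize)
  show thesis
  proof (rule that)
    show "unitary (u \<star> cmat C)" "tempered (u \<star> cmat C)"
      using u C by (simp_all add: unitary_mul tempered_mul tempered_cmat)
    show "p = (u \<star> cmat C) \<star> diag_one r \<star> adj (u \<star> cmat C)"
      by (subst u(3), subst P, subst C(2)) (simp only: adj_mul mul_assoc)
    have "tr ?P = tr p" unfolding tr_def by (rule sum.cong) (auto simp: cmat_def const_def)
    then show "tr p = of_nat r" using C(3) by simp
  qed
qed

section \<open>Projections with finitely many coefficients\<close>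

text \<open>
  Let \<open>D k\<close> be the multidegree of \<open>k\<close>, in which \<open>Z p\<close> and \<open>Zb p\<close> both count as degree in direction
  \<open>p\<close>, and choose an exponent \<open>k0\<close> of \<open>p\<close> for which the square \<open>Q\<close> of the length of \<open>D k0\<close> is
  maximal. By the parallelogram law, two multidegrees of at most this length add up to \<open>2 D k0\<close> only
  if both equal \<open>D k0\<close>. So the coefficient of a diagonal entry of $p p^*$ at an exponent of
  multidegree \<open>2 D k0\<close> is a phase times a sum of squared moduli; but $p p^* = p$ has no coefficient
  there, unless \<open>D k0 = 0\<close>.
\<close>

lemma finite_support_projection_constant:
  assumes p: "projection p" and fin: "finite {k. \<exists>a b. p a b k \<noteq> 0}"
  shows "p = cmat (\<lambda>a b. p a b 0)"
proof -
  have sp: "supported p" and idem: "p \<star> p = p" and sa: "adj p = p"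
    using p by (auto simp: projection_def)
  define S where "S = {k. \<exists>a b. p a b k \<noteq> 0}"
  have SMI: "S \<subseteq> MI" using sp by (auto simp: S_def supported_def)
  define D where "D k g = real (k g + k (bar g))" for k :: multiindex and g
  define Q where "Q k = (\<Sum>g\<in>L. (D k g)\<^sup>2)" for k
  have Qbar: "Q (k \<circ> bar) = Q k" for k by (simp add: Q_def D_def add.commute)
  have "k = 0" if "k \<in> S" for k
  proof (rule ccontr)
    assume k: "k \<noteq> 0"
    have fS: "finite S" "S \<noteq> {}" using fin that by (auto simp: S_def)
    have "Max (Q ` S) \<in> Q ` S" using fS by (intro Max_in) auto
    then obtain k0 where k0: "k0 \<in> S" "Q k0 = Max (Q ` S)" by (metis imageE)
    have max: "Q i \<le> Q k0" if "i \<in> S" for i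
      unfolding k0(2) using fS that by (intro Max_ge) auto
    obtain g where g: "k g \<noteq> 0" using k by (auto simp: fun_eq_iff)
    have "k \<in> MI" using that SMI by blast
    then have "g \<in> L" using g by (auto simp: multiindices_def)
    then have "(D k g)\<^sup>2 \<le> Q k" unfolding Q_def by (intro member_le_sum) auto
    moreover have "(D k g)\<^sup>2 > 0" using g by (simp add: D_def)
    ultimately have Qpos: "Q k0 > 0" using max[OF that] by linarith
    define K where "K = k0 + (k0 \<circ> bar)"
    have DK: "D K g = 2 * D k0 g" for g by (simp add: D_def K_def)
    have "Q K = 4 * Q k0" unfolding Q_def DK by (simp add: power_mult_distrib sum_distrib_left)
    then have KS: "K \<notin> S" using max[of K] Qpos by auto
    have k0MI: "k0 \<in> MI" using k0(1) SMI by auto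
    define \<gamma> where "\<gamma> = star_coeff k0 * cocycle k0 (k0 \<circ> bar)"
    have \<gamma>: "\<gamma> \<noteq> 0"
    proof -
      have "cmod \<gamma> = 1" by (simp add: \<gamma>_def norm_mult)
      then show ?thesis by auto
    qed
    define I where "I = {i \<in> MI. i + (i \<circ> bar) = K}"
    have finI: "finite I"
    proof (rule finite_subset)
      have "(i, i \<circ> bar) \<in> splits K" if "i \<in> I" for i using that by (simp add: I_def splits_def)
      then show "I \<subseteq> fst ` splits K" by force
    qed simp
    obtain a b where ab: "p a b k0 \<noteq> 0" using k0(1) by (auto simp: S_def)
    have abN: "a < N" "b < N" using sp ab unfolding supported_def by blast+
    have term_bal: "j = i \<circ> bar" if ij: "(i, j) \<in> splits K" "i \<in> S" "j \<circ> bar \<in> S" for i j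
    proof -
      have "Q i \<le> Q k0" "Q j \<le> Q k0" using max[OF ij(2)] max[OF ij(3)] by (simp_all add: Qbar)
      have iMI: "i \<in> MI" "j \<in> MI" and K': "i + j = K" using ij(1) by (auto simp: splits_def)
      have sum2: "D i g + D j g = 2 * D k0 g" for g
        using DK[of g] unfolding K'[symmetric] by (simp add: D_def)
      have "(\<Sum>g\<in>L. (D i g - D j g)\<^sup>2) = (\<Sum>g\<in>L. 2 * (D i g)\<^sup>2 + 2 * (D j g)\<^sup>2 - (D i g + D j g)\<^sup>2)"
        by (rule sum.cong) (auto simp: power2_eq_square algebra_simps)
      also have "\<dots> = 2 * Q i + 2 * Q j - 4 * Q k0"
        unfolding sum2 Q_def by (simp add: sum.distrib sum_subtractf sum_distrib_left power_mult_distrib)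
      also have "\<dots> \<le> 0" using \<open>Q i \<le> Q k0\<close> \<open>Q j \<le> Q k0\<close> by simp
      finally have "(\<Sum>g\<in>L. (D i g - D j g)\<^sup>2) = 0" by (simp add: sum_nonneg order_antisym)
      then have "\<forall>g\<in>L. (D i g - D j g)\<^sup>2 = 0" by (subst (asm) sum_nonneg_eq_0_iff) auto
      then have Dij: "D i g = D j g" if "g \<in> L" for g using that by auto
      show ?thesis
      proof
        fix g
        show "j g = (i \<circ> bar) g"
        proof (cases "g \<in> L")
          case True
          have "i g + i (bar g) = k0 g + k0 (bar g)"
            using Dij[OF True] sum2[of g] by (simp add: D_def)
          moreover have "i g + j g = k0 g + k0 (bar g)"
            using fun_cong[OF K', of g] by (simp add: K_def)
          ultimately show ?thesis by simp
        next
          case False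
          then show ?thesis using iMI by (auto simp: multiindices_def)
        qed
      qed
    qed
    have "conv (p a c) (series_star (p a c)) K = \<gamma> * of_real (\<Sum>i\<in>I. (cmod (p a c i))\<^sup>2)" for c
    proof -
      let ?f = "p a c"
      have "conv ?f (series_star ?f) K = (\<Sum>(i, j)\<in>(\<lambda>i. (i, i \<circ> bar)) ` I. ?f i * series_star ?f j * cocycle i j)"
        unfolding conv_def
      proof (rule sum.mono_neutral_right)
        show "(\<lambda>i. (i, i \<circ> bar)) ` I \<subseteq> splits K" by (auto simp: I_def splits_def)
        show "\<forall>x\<in>splits K - (\<lambda>i. (i, i \<circ> bar)) ` I. (case x of (i, j) \<Rightarrow> ?f i * series_star ?f j * cocycle i j) = 0"
        proof (intro ballI, clarify)
          fix i j assume ij: "(i, j) \<in> splits K" "(i, j) \<notin> (\<lambda>i. (i, i \<circ> bar)) ` I"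
          show "?f i * series_star ?f j * cocycle i j = 0"
          proof (rule ccontr)
            assume "\<not> ?thesis"
            then have "?f i \<noteq> 0" "?f (j \<circ> bar) \<noteq> 0" by (auto simp: series_star_def)
            then have "i \<in> S" "j \<circ> bar \<in> S" unfolding S_def by blast+
            then have j: "j = i \<circ> bar" by (rule term_bal[OF ij(1)])
            have "i \<in> I" using ij(1) unfolding I_def splits_def j by blast
            with ij(2) j show False by blast
          qed
        qed
      qed simp
      also have "\<dots> = (\<Sum>i\<in>I. ?f i * series_star ?f (i \<circ> bar) * cocycle i (i \<circ> bar))"
        by (subst sum.reindex) (auto simp: inj_on_def)
      also have "\<dots> = (\<Sum>i\<in>I. \<gamma> * of_real ((cmod (?f i))\<^sup>2))"
      proof (rule sum.cong[OF refl])
        fix i assume i: "i \<in> I"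
        then have "star_coeff i * cocycle i (i \<circ> bar) = \<gamma>"
          unfolding \<gamma>_def by (intro positivity_factor_cong) (auto simp: I_def K_def k0MI)
        then have "?f i * cnj (?f i) * (star_coeff i * cocycle i (i \<circ> bar)) = \<gamma> * of_real ((cmod (?f i))\<^sup>2)"
          unfolding complex_norm_square by (simp only: mult.commute)
        then show "?f i * series_star ?f (i \<circ> bar) * cocycle i (i \<circ> bar) = \<gamma> * of_real ((cmod (?f i))\<^sup>2)"
          by (simp only: series_star_def comp_bar_bar mult.assoc)
      qed
      finally show ?thesis by (simp add: sum_distrib_left)
    qed
    note co = this
    have "0 = p a a K" using KS by (auto simp: S_def)
    also have "\<dots> = (p \<star> adj p) a a K" by (simp only: sa idem)
    also have "\<dots> = (\<Sum>c<N. conv (p a c) (series_star (p a c)) K)"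
      by (simp add: mul_def sum_fun_apply adj_def)
    also have "\<dots> = \<gamma> * of_real (\<Sum>c<N. \<Sum>i\<in>I. (cmod (p a c i))\<^sup>2)"
      by (simp only: co sum_distrib_left of_real_sum)
    finally have "(\<Sum>c<N. \<Sum>i\<in>I. (cmod (p a c i))\<^sup>2) = 0"
      using \<gamma> by (simp only: mult_eq_0_iff of_real_eq_0_iff eq_commute[of 0] simp_thms)
    then have "\<forall>c\<in>{..<N}. (\<Sum>i\<in>I. (cmod (p a c i))\<^sup>2) = 0"
      by (subst (asm) sum_nonneg_eq_0_iff) (auto intro: sum_nonneg)
    then have "(\<Sum>i\<in>I. (cmod (p a b i))\<^sup>2) = 0" using abN by auto
    then have "\<forall>i\<in>I. (cmod (p a b i))\<^sup>2 = 0"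
      by (subst (asm) sum_nonneg_eq_0_iff) (auto simp: finI)
    moreover have "k0 \<in> I" by (auto simp: I_def K_def k0MI)
    ultimately show False using ab by auto
  qed
  then have z: "p a b k = 0" if "k \<noteq> 0" for a b k using that by (auto simp: S_def)
  show ?thesis
  proof (intro ext)
    fix a b k
    show "p a b k = cmat (\<lambda>a b. p a b 0) a b k"
    proof (cases "k = 0 \<and> a < N \<and> b < N")
      case False
      have "p a b k = 0"
      proof (cases "k = 0")
        case True
        with False have "\<not> (a < N \<and> b < N \<and> k \<in> MI)" by simp
        then show ?thesis by (rule supportedD[OF sp])
      qed (rule z)
      moreover have "cmat (\<lambda>a b. p a b 0) a b k = 0" using False unfolding cmat_def const_def by auto
      ultimately show ?thesis by simp
    qed (simp add: cmat_def const_def)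
  qed
qed

end

section \<open>Rank and the Grothendieck group\<close>

text \<open>
  The class of a pair is the set of all pairs with the same difference, and this difference is the
  isomorphism.
\<close>

lemma grothendieck_group_of_nat:
  fixes S :: "('b, 'm) monoid_scheme"
  assumes bij: "bij_betw \<rho> (UNIV :: nat set) (carrier S)"
    and add: "\<And>a b. \<rho> a \<otimes>\<^bsub>S\<^esub> \<rho> b = \<rho> (a + b)"
  shows "grothendieck_group S \<cong> integer_group"
proof -
  have inj: "\<rho> a = \<rho> b \<longleftrightarrow> a = b" for a b
    using bij by (auto simp: bij_betw_def inj_on_def)
  have car: "carrier S = range \<rho>" using bij by (auto simp: bij_betw_def)
  define G where "G z = {(\<rho> a, \<rho> b) | a b. int a - int b = z}" for z :: int
  have rel: "groth_rel S `` {(\<rho> a, \<rho> b)} = G (int a - int b)" for a b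
  proof -
    have "(x \<in> groth_rel S `` {(\<rho> a, \<rho> b)}) \<longleftrightarrow> x \<in> G (int a - int b)" for x
    proof
      assume "x \<in> groth_rel S `` {(\<rho> a, \<rho> b)}"
      then obtain c d e where x: "x = (\<rho> c, \<rho> d)"
        and "\<rho> a \<otimes>\<^bsub>S\<^esub> \<rho> d \<otimes>\<^bsub>S\<^esub> \<rho> e = \<rho> c \<otimes>\<^bsub>S\<^esub> \<rho> b \<otimes>\<^bsub>S\<^esub> \<rho> e"
        by (auto simp: groth_rel_def car)
      then have "a + d = c + b" by (simp add: add inj)
      then have "int c - int d = int a - int b" by linarith
      then show "x \<in> G (int a - int b)" unfolding G_def x by blast
    next
      assume "x \<in> G (int a - int b)"
      then obtain c d where x: "x = (\<rho> c, \<rho> d)" and "int c - int d = int a - int b"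
        unfolding G_def by blast
      then have "a + d = c + b" by linarith
      then show "x \<in> groth_rel S `` {(\<rho> a, \<rho> b)}"
        by (auto simp: groth_rel_def car x add)
    qed
    then show ?thesis by blast
  qed
  have mem: "(\<rho> (nat z), \<rho> (nat (- z))) \<in> G z" for z
    unfolding G_def by (intro CollectI exI conjI refl) auto
  have injG: "inj G"
  proof (rule injI)
    fix y z assume "G y = G z"
    with mem[of y] have "(\<rho> (nat y), \<rho> (nat (- y))) \<in> G z" by simp
    then obtain a b where "\<rho> (nat y) = \<rho> a" "\<rho> (nat (- y)) = \<rho> b" "int a - int b = z"
      unfolding G_def by blast
    then show "y = z" by (auto simp: inj)
  qed
  have carG: "carrier (grothendieck_group S) = range G"
  proof -
    have "carrier (grothendieck_group S) = (\<lambda>x. groth_rel S `` {x}) ` (carrier S \<times> carrier S)"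
      by (auto simp: grothendieck_group_def quotient_def)
    also have "\<dots> = range G"
    proof
      show "(\<lambda>x. groth_rel S `` {x}) ` (carrier S \<times> carrier S) \<subseteq> range G"
        by (auto simp: car rel)
      have "G z = groth_rel S `` {(\<rho> (nat z), \<rho> (nat (- z)))}" for z
        unfolding rel by simp
      then show "range G \<subseteq> (\<lambda>x. groth_rel S `` {x}) ` (carrier S \<times> carrier S)"
        unfolding car by blast
    qed
    finally show ?thesis .
  qed
  have mult: "G y \<otimes>\<^bsub>grothendieck_group S\<^esub> G z = G (y + z)" for y z
  proof -
    have eq: "groth_rel S `` {(fst u \<otimes>\<^bsub>S\<^esub> fst v, snd u \<otimes>\<^bsub>S\<^esub> snd v)} = G (y + z)"
      if "u \<in> G y" "v \<in> G z" for u v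
    proof -
      obtain a b c d where "u = (\<rho> a, \<rho> b)" "v = (\<rho> c, \<rho> d)" "y = int a - int b" "z = int c - int d"
        using \<open>u \<in> G y\<close> \<open>v \<in> G z\<close> unfolding G_def by blast
      moreover from this have "int (a + c) - int (b + d) = y + z" by simp
      ultimately show ?thesis by (simp only: fst_conv snd_conv add rel)
    qed
    have "G y \<otimes>\<^bsub>grothendieck_group S\<^esub> G z =
        (\<Union>u\<in>G y. \<Union>v\<in>G z. groth_rel S `` {(fst u \<otimes>\<^bsub>S\<^esub> fst v, snd u \<otimes>\<^bsub>S\<^esub> snd v)})"
      by (simp add: grothendieck_group_def case_prod_beta)
    also have "\<dots> = (\<Union>u\<in>G y. \<Union>v\<in>G z. G (y + z))" using eq by simp
    also have "\<dots> = G (y + z)" using mem by blast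
    finally show ?thesis .
  qed
  have "inv_into UNIV G \<in> iso (grothendieck_group S) integer_group"
  proof (rule isoI)
    show "inv_into UNIV G \<in> hom (grothendieck_group S) integer_group"
      by (rule homI) (auto simp: carG mult injG)
    show "bij_betw (inv_into UNIV G) (carrier (grothendieck_group S)) (carrier integer_group)"
      using bij_betw_inv_into[OF inj_on_imp_bij_betw[OF injG]] by (simp add: carG)
  qed
  then show ?thesis unfolding is_iso_def by blast
qed

text \<open>
  If equivalence classes of projectors are classified by an additive rank which takes all values,
  the semigroup of classes is that of natural numbers.
\<close>

lemma K0_iso_integers_if_rank:
  fixes A :: "('a, 'm) star_algebra_scheme" and rk :: "'a mat \<Rightarrow> nat"
  assumes equiv: "\<And>p q. (p, q) \<in> proj_equiv A \<longleftrightarrow> p \<in> projectors A \<and> q \<in> projectors A \<and> rk p = rk q"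
    and dsum: "\<And>p q. p \<in> projectors A \<Longrightarrow> q \<in> projectors A \<Longrightarrow> dsum A p q \<in> projectors A"
      "\<And>p q. p \<in> projectors A \<Longrightarrow> q \<in> projectors A \<Longrightarrow> rk (dsum A p q) = rk p + rk q"
    and surj: "\<And>n. \<exists>p\<in>projectors A. rk p = n"
  shows "K0 A \<cong> integer_group"
proof -
  define cls where "cls n = {p \<in> projectors A. rk p = n}" for n
  have img: "proj_equiv A `` {p} = cls (rk p)" if "p \<in> projectors A" for p
    using that by (auto simp: cls_def equiv)
  have ne: "cls n \<noteq> {}" for n using surj[of n] by (auto simp: cls_def)
  show ?thesis
    unfolding K0_def
  proof (rule grothendieck_group_of_nat[where \<rho> = cls])
    show "bij_betw cls UNIV (carrier (proj_classes A))"
      unfolding bij_betw_def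
    proof
      show "inj cls"
      proof (rule injI)
        fix x y assume xy: "cls x = cls y"
        obtain p where "p \<in> cls x" using ne by blast
        then have "p \<in> cls x" "p \<in> cls y" using xy by auto
        then show "x = y" by (simp add: cls_def)
      qed
      have "carrier (proj_classes A) = (\<Union>p\<in>projectors A. {cls (rk p)})"
        using img by (simp add: proj_classes_def quotient_def)
      also have "\<dots> = range cls" using surj by (auto, metis imageI)
      finally show "range cls = carrier (proj_classes A)" ..
    qed
    fix a b
    have "cls a \<otimes>\<^bsub>proj_classes A\<^esub> cls b = (\<Union>p\<in>cls a. \<Union>q\<in>cls b. proj_equiv A `` {dsum A p q})"
      by (simp add: proj_classes_def)
    also have "\<dots> = (\<Union>p\<in>cls a. \<Union>q\<in>cls b. cls (a + b))"
      by (intro SUP_cong refl) (auto simp: cls_def img dsum)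
    also have "\<dots> = cls (a + b)" using ne[of a] ne[of b] by simp
    finally show "cls a \<otimes>\<^bsub>proj_classes A\<^esub> cls b = cls (a + b)" .
  qed
qed

context skew_parameter
begin

section \<open>Star-algebras represented by formal series\<close>

definition block :: "nat \<Rightarrow> (nat \<Rightarrow> nat \<Rightarrow> multiindex \<Rightarrow> complex) \<Rightarrow> (nat \<Rightarrow> nat \<Rightarrow> multiindex \<Rightarrow> complex) \<Rightarrow>
    nat \<Rightarrow> nat \<Rightarrow> multiindex \<Rightarrow> complex" where
  "block n F G a b =
    (if a < n then if b < n then F a b else 0 else if b < n then 0 else G (a - n) (b - n))"

sublocale M: series_matrices m \<Theta> N for N ..

lemma projection_block:
  assumes F: "M.projection n F" and G: "M.projection l G"
  shows "M.projection (n + l) (block n F G)"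
proof -
  have F': "M.supported n F" "M.mul n F F = F" "M.adj F = F"
    and G': "M.supported l G" "M.mul l G G = G" "M.adj G = G"
    using F G by (auto simp: M.projection_def)
  have "M.supported (n + l) (block n F G)"
    unfolding M.supported_def
  proof (intro allI impI)
    fix a b k assume nz: "block n F G a b k \<noteq> 0"
    show "a < n + l \<and> b < n + l \<and> k \<in> MI"
    proof (cases "a < n")
      case True
      then have "F a b k \<noteq> 0" using nz by (auto simp: block_def split: if_splits)
      then show ?thesis using F'(1) unfolding M.supported_def by fastforce
    next
      case False
      then have ge: "a \<ge> n" "b \<ge> n" and "G (a - n) (b - n) k \<noteq> 0"
        using nz by (auto simp: block_def split: if_splits)
      then have "a - n < l \<and> b - n < l \<and> k \<in> MI" using G'(1) unfolding M.supported_def by blast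
      then show ?thesis using ge by linarith
    qed
  qed
  moreover have "M.mul (n + l) (block n F G) (block n F G) = block n F G"
  proof (intro ext)
    fix a b k
    let ?B = "block n F G"
    have "M.mul (n + l) ?B ?B a b = (\<Sum>c<n. conv (?B a c) (?B c b)) + (\<Sum>c<l. conv (?B a (n + c)) (?B (n + c) b))"
      unfolding M.mul_def by (rule sum_lessThan_add)
    also have "(\<Sum>c<n. conv (?B a c) (?B c b)) = (if a < n \<and> b < n then M.mul n F F a b else 0)"
      unfolding M.mul_def by (auto simp: block_def intro!: sum.neutral)
    also have "(\<Sum>c<l. conv (?B a (n + c)) (?B (n + c) b)) =
        (if a < n \<or> b < n then 0 else M.mul l G G (a - n) (b - n))"
      unfolding M.mul_def by (auto simp: block_def intro!: sum.neutral)
    finally show "M.mul (n + l) ?B ?B a b k = ?B a b k"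
      unfolding F'(2) G'(2) by (cases "a < n"; cases "b < n") (simp_all add: block_def[of n F G a b])
  qed
  moreover have "M.adj (block n F G) = block n F G"
  proof (intro ext)
    fix a b k
    have "M.adj (block n F G) a b = block n (M.adj F) (M.adj G) a b"
      by (simp add: M.adj_def block_def)
    then show "M.adj (block n F G) a b k = block n F G a b k" unfolding F' G' by simp
  qed
  ultimately show ?thesis by (simp add: M.projection_def)
qed

lemma tr_block: "M.tr (n + l) (block n F G) = M.tr n F + M.tr l G"
  unfolding M.tr_def sum_lessThan_add by (simp add: block_def)

end

text \<open>
  The properties of a $*$-algebra from which its $K_0$ is computed. The map \<open>\<phi>\<close> turns matrices over
  the algebra into matrices of formal series, where all calculations take place; as it is
  injective, equations can be pulled back, including the axioms of the additive monoid.
\<close>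

locale series_representation = skew_parameter m \<Theta>
  for m :: nat and \<Theta> :: "nat \<Rightarrow> nat \<Rightarrow> real" +
  fixes A :: "('a, 'm) star_algebra_scheme" (structure)
    and \<phi> :: "'a \<Rightarrow> multiindex \<Rightarrow> complex"
  assumes zero_closed: "\<zero> \<in> carrier A" and one_closed: "\<one> \<in> carrier A"
    and add_closed: "\<And>a b. a \<in> carrier A \<Longrightarrow> b \<in> carrier A \<Longrightarrow> a \<oplus> b \<in> carrier A"
    and mult_closed: "\<And>a b. a \<in> carrier A \<Longrightarrow> b \<in> carrier A \<Longrightarrow> a \<otimes> b \<in> carrier A"
    and star_closed: "\<And>a. a \<in> carrier A \<Longrightarrow> star A a \<in> carrier A"
    and inj: "inj_on \<phi> (carrier A)"
    and support: "\<And>a k. a \<in> carrier A \<Longrightarrow> k \<notin> MI \<Longrightarrow> \<phi> a k = 0"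
    and \<phi>_zero: "\<phi> \<zero> = 0" and \<phi>_one: "\<phi> \<one> = const 1"
    and \<phi>_add: "\<And>a b. a \<in> carrier A \<Longrightarrow> b \<in> carrier A \<Longrightarrow> \<phi> (a \<oplus> b) = \<phi> a + \<phi> b"
    and \<phi>_mult: "\<And>a b. a \<in> carrier A \<Longrightarrow> b \<in> carrier A \<Longrightarrow> \<phi> (a \<otimes> b) = conv (\<phi> a) (\<phi> b)"
    and \<phi>_star: "\<And>a. a \<in> carrier A \<Longrightarrow> \<phi> (star A a) = series_star (\<phi> a)"
    and diagonalize: "\<And>N p. M.projection N p \<Longrightarrow> \<forall>a<N. \<forall>b<N. p a b \<in> \<phi> ` carrier A \<Longrightarrow>
      \<exists>u r. M.unitary N u \<and> (\<forall>a<N. \<forall>b<N. u a b \<in> \<phi> ` carrier A) \<and>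
        p = M.mul N (M.mul N u (M.diag_one N r)) (M.adj u) \<and> M.tr N p = of_nat r"
begin

lemma \<phi>_eq_iff: "a \<in> carrier A \<Longrightarrow> b \<in> carrier A \<Longrightarrow> \<phi> a = \<phi> b \<longleftrightarrow> a = b"
  using inj by (auto simp: inj_on_def)

lemma abelian_monoid_A: "abelian_monoid A"
proof (rule abelian_monoidI)
  fix x y z assume xyz: "x \<in> carrier A" "y \<in> carrier A" "z \<in> carrier A"
  have "\<phi> (x \<oplus> y \<oplus> z) = \<phi> (x \<oplus> (y \<oplus> z))"
    using xyz by (simp only: \<phi>_add add_closed add.assoc)
  then show "x \<oplus> y \<oplus> z = x \<oplus> (y \<oplus> z)" using xyz by (simp only: \<phi>_eq_iff add_closed)
next
  fix x assume x: "x \<in> carrier A"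
  have "\<phi> (\<zero> \<oplus> x) = \<phi> x" using x by (simp only: \<phi>_add zero_closed \<phi>_zero add_0)
  then show "\<zero> \<oplus> x = x" using x by (simp only: \<phi>_eq_iff add_closed zero_closed)
next
  fix x y assume xy: "x \<in> carrier A" "y \<in> carrier A"
  have "\<phi> (x \<oplus> y) = \<phi> (y \<oplus> x)" using xy by (simp only: \<phi>_add add.commute)
  then show "x \<oplus> y = y \<oplus> x" using xy by (simp only: \<phi>_eq_iff add_closed)
qed (auto simp: add_closed zero_closed)

sublocale abelian_monoid A by (rule abelian_monoid_A)

lemma \<phi>_finsum:
  assumes "finite K" "\<And>k. k \<in> K \<Longrightarrow> f k \<in> carrier A"
  shows "\<phi> (finsum A f K) = (\<Sum>k\<in>K. \<phi> (f k))"
  using assms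
proof (induction K)
  case empty
  show ?case by (simp only: finsum_empty \<phi>_zero sum.empty)
next
  case (insert x K)
  have f: "f \<in> K \<rightarrow> carrier A" "f x \<in> carrier A" using insert.prems by auto
  have "\<phi> (finsum A f (insert x K)) = \<phi> (f x \<oplus> finsum A f K)"
    by (simp only: finsum_insert[OF insert.hyps f])
  also have "\<dots> = \<phi> (f x) + (\<Sum>k\<in>K. \<phi> (f k))"
    using insert.IH insert.prems by (simp only: \<phi>_add f finsum_closed insertI2 insertI1)
  also have "\<dots> = (\<Sum>k\<in>insert x K. \<phi> (f k))" by (simp only: sum.insert[OF insert.hyps])
  finally show ?case .
qed

definition series :: "'a mat \<Rightarrow> nat \<Rightarrow> nat \<Rightarrow> multiindex \<Rightarrow> complex" where
  "series p a b = (if a < dim_row p \<and> b < dim_col p then \<phi> (p $$ (a, b)) else 0)"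

lemma mats_dim: "p \<in> mats A r c \<Longrightarrow> dim_row p = r \<and> dim_col p = c"
  by (auto simp: mats_def)

lemma mats_entry: "p \<in> mats A r c \<Longrightarrow> i < r \<Longrightarrow> j < c \<Longrightarrow> p $$ (i, j) \<in> carrier A"
  by (auto simp: mats_def)

lemma mats_mat: "(\<And>i j. i < r \<Longrightarrow> j < c \<Longrightarrow> f (i, j) \<in> carrier A) \<Longrightarrow> mat r c f \<in> mats A r c"
  by (auto simp: mats_def)

lemma series_eq: "p \<in> mats A r c \<Longrightarrow> a < r \<Longrightarrow> b < c \<Longrightarrow> series p a b = \<phi> (p $$ (a, b))"
  using mats_dim[of p r c] by (simp add: series_def)

lemma series_outside: "p \<in> mats A r c \<Longrightarrow> \<not> (a < r \<and> b < c) \<Longrightarrow> series p a b = 0"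
  using mats_dim[of p r c] by (auto simp: series_def)

lemma supported_series: "p \<in> mats A N N \<Longrightarrow> M.supported N (series p)"
  unfolding M.supported_def series_def
  using mats_dim[of p N N] mats_entry[of p N N] support by (auto split: if_splits)

lemma series_inject:
  assumes p: "p \<in> mats A N N" and q: "q \<in> mats A N N" and eq: "series p = series q"
  shows "p = q"
proof (rule eq_matI)
  fix i j assume "i < dim_row q" "j < dim_col q"
  then have ij: "i < N" "j < N" using mats_dim[OF q] by auto
  have "\<phi> (p $$ (i, j)) = \<phi> (q $$ (i, j))"
    using series_eq[OF p ij] series_eq[OF q ij] eq by simp
  then show "p $$ (i, j) = q $$ (i, j)"
    using mats_entry[OF p ij] mats_entry[OF q ij] by (simp add: \<phi>_eq_iff)
qed (use mats_dim[OF p] mats_dim[OF q] in auto)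

lemma series_eq_iff: "p \<in> mats A N N \<Longrightarrow> q \<in> mats A N N \<Longrightarrow> p = q \<longleftrightarrow> series p = series q"
  by (rule iffI, simp only:) (rule series_inject)

lemma mmult_closed:
  assumes p: "p \<in> mats A N N" and q: "q \<in> mats A N N"
  shows "mmult A p q \<in> mats A N N" and "series (mmult A p q) = M.mul N (series p) (series q)"
proof -
  have d: "dim_row p = N" "dim_col p = N" "dim_row q = N" "dim_col q = N"
    using mats_dim[OF p] mats_dim[OF q] by auto
  have e: "p $$ (i, k) \<otimes> q $$ (k, j) \<in> carrier A" if "i < N" "j < N" "k < N" for i j k
    using that by (intro mult_closed mats_entry[OF p] mats_entry[OF q])
  show cl: "mmult A p q \<in> mats A N N"
    unfolding mmult_def d by (rule mats_mat) (auto intro!: finsum_closed e)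
  show "series (mmult A p q) = M.mul N (series p) (series q)"
  proof (intro ext)
    fix a b x
    have "series (mmult A p q) a b = M.mul N (series p) (series q) a b"
    proof (cases "a < N \<and> b < N")
      case True
      then have ab: "a < N" "b < N" by auto
      have "series (mmult A p q) a b = \<phi> (\<Oplus>k\<in>{..<N}. p $$ (a, k) \<otimes> q $$ (k, b))"
        unfolding series_eq[OF cl ab] using ab by (simp add: mmult_def d)
      also have "\<dots> = (\<Sum>k\<in>{..<N}. \<phi> (p $$ (a, k) \<otimes> q $$ (k, b)))"
        by (rule \<phi>_finsum) (auto intro!: e ab)
      also have "\<dots> = (\<Sum>k\<in>{..<N}. conv (series p a k) (series q k b))"
      proof (rule sum.cong[OF refl])
        fix k assume "k \<in> {..<N}"
        then have k: "k < N" by simp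
        show "\<phi> (p $$ (a, k) \<otimes> q $$ (k, b)) = conv (series p a k) (series q k b)"
          unfolding series_eq[OF p ab(1) k] series_eq[OF q k ab(2)]
          by (rule \<phi>_mult[OF mats_entry[OF p ab(1) k] mats_entry[OF q k ab(2)]])
      qed
      finally show ?thesis by (simp only: M.mul_def)
    next
      case False
      have "M.mul N (series p) (series q) a b = 0"
        by (rule M.supported_zero[OF M.supported_mul[OF supported_series[OF p] supported_series[OF q]] False])
      then show ?thesis using series_outside[OF cl False] by simp
    qed
    then show "series (mmult A p q) a b x = M.mul N (series p) (series q) a b x" by simp
  qed
qed

lemma madjoint_closed:
  assumes p: "p \<in> mats A N N"
  shows "madjoint A p \<in> mats A N N" and "series (madjoint A p) = M.adj (series p)"
proof -
  have d: "dim_row p = N" "dim_col p = N" using mats_dim[OF p] by auto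
  show cl: "madjoint A p \<in> mats A N N"
    unfolding madjoint_def d by (rule mats_mat) (auto intro!: star_closed mats_entry[OF p])
  show "series (madjoint A p) = M.adj (series p)"
  proof (intro ext)
    fix a b x
    show "series (madjoint A p) a b x = M.adj (series p) a b x"
    proof (cases "a < N \<and> b < N")
      case True
      then have ab: "a < N" "b < N" by auto
      have "series (madjoint A p) a b = \<phi> (star A (p $$ (b, a)))"
        unfolding series_eq[OF cl ab] using ab by (simp add: madjoint_def d)
      then show ?thesis
        unfolding M.adj_def series_eq[OF p ab(2,1)] \<phi>_star[OF mats_entry[OF p ab(2,1)]] by simp
    next
      case False
      then have "\<not> (b < N \<and> a < N)" by blast
      then show ?thesis
        unfolding M.adj_def series_outside[OF cl False] by (simp add: series_outside[OF p])
    qed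
  qed
qed

lemma mone_closed: "mone A N \<in> mats A N N" and series_mone: "series (mone A N) = M.E N"
proof -
  show cl: "mone A N \<in> mats A N N"
    unfolding mone_def by (rule mats_mat) (auto simp: one_closed zero_closed)
  show "series (mone A N) = M.E N"
  proof (intro ext)
    fix a b x
    show "series (mone A N) a b x = M.E N a b x"
    proof (cases "a < N \<and> b < N")
      case True
      then have ab: "a < N" "b < N" by auto
      show ?thesis unfolding series_eq[OF cl ab]
        using ab by (simp add: mone_def M.E_def M.cmat_def \<phi>_one \<phi>_zero const_def)
    next
      case False
      have "M.E N a b = 0" by (rule M.supported_zero[OF M.supported_E False])
      then show ?thesis unfolding series_outside[OF cl False] by simp
    qed
  qed
qed

lemma mzero_closed: "mzero A r c \<in> mats A r c" and series_mzero: "series (mzero A r c) = 0"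
proof -
  show "mzero A r c \<in> mats A r c"
    unfolding mzero_def by (rule mats_mat) (auto simp: zero_closed)
  show "series (mzero A r c) = 0"
    by (intro ext) (auto simp: series_def mzero_def \<phi>_zero)
qed

lemma projectors_iff:
  assumes "p \<in> mats A N N"
  shows "p \<in> projectors A \<longleftrightarrow> M.projection N (series p)"
proof -
  have "p \<in> projectors A \<longleftrightarrow> mmult A p p = p \<and> madjoint A p = p"
    using assms by (auto simp: projectors_def)
  also have "mmult A p p = p \<longleftrightarrow> M.mul N (series p) (series p) = series p"
    by (simp only: series_eq_iff[OF mmult_closed(1)[OF assms assms] assms] mmult_closed(2)[OF assms assms])
  also have "madjoint A p = p \<longleftrightarrow> M.adj (series p) = series p"
    by (simp only: series_eq_iff[OF madjoint_closed(1)[OF assms] assms] madjoint_closed(2)[OF assms])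
  finally show ?thesis by (simp add: M.projection_def supported_series[OF assms])
qed

lemma projectorsE:
  assumes "p \<in> projectors A"
  obtains N where "p \<in> mats A N N" "M.projection N (series p)" "dim_row p = N" "dim_col p = N"
proof -
  obtain N where N: "p \<in> mats A N N" using assms by (auto simp: projectors_def)
  show thesis using that[OF N] projectors_iff[OF N] assms mats_dim[OF N] by simp
qed

lemma dsum_closed:
  assumes p: "p \<in> mats A n n" and q: "q \<in> mats A l l"
  shows "dsum A p q \<in> mats A (n + l) (n + l)" and "series (dsum A p q) = block n (series p) (series q)"
proof -
  have d: "dim_row p = n" "dim_col p = n" "dim_row q = l" "dim_col q = l"
    using mats_dim[OF p] mats_dim[OF q] by auto
  have ent: "dsum A p q $$ (i, j) = (if i < n then if j < n then p $$ (i, j) else \<zero>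
      else if j < n then \<zero> else q $$ (i - n, j - n))" if "i < n + l" "j < n + l" for i j
    using that by (simp add: dsum_def four_block_mat_def Let_def mzero_def d)
  have dim: "dim_row (dsum A p q) = n + l" "dim_col (dsum A p q) = n + l"
    by (simp_all add: dsum_def d)
  have "dsum A p q $$ (i, j) \<in> carrier A" if "i < n + l" "j < n + l" for i j
    unfolding ent[OF that] using that
    by (auto intro!: mats_entry[OF p] mats_entry[OF q] zero_closed)
  then show cl: "dsum A p q \<in> mats A (n + l) (n + l)"
    unfolding mats_def by (intro CollectI conjI carrier_matI[OF dim] allI impI)
  show "series (dsum A p q) = block n (series p) (series q)"
  proof (intro ext)
    fix a b x
    show "series (dsum A p q) a b x = block n (series p) (series q) a b x"
    proof (cases "a < n + l \<and> b < n + l")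
      case True
      then have ab: "a < n + l" "b < n + l" by auto
      show ?thesis
        unfolding series_eq[OF cl ab] ent[OF ab] block_def
        using ab by (simp add: series_eq[OF p] series_eq[OF q] \<phi>_zero)
    next
      case False
      have "block n (series p) (series q) a b = 0"
      proof (cases "n \<le> a \<and> n \<le> b")
        case True
        with False have "\<not> (a - n < l \<and> b - n < l)" by linarith
        from series_outside[OF q this] True show ?thesis by (simp add: block_def)
      next
        case ge: False
        with False have "\<not> (a < n \<and> b < n)" by linarith
        with ge show ?thesis by (auto simp: block_def)
      qed
      then show ?thesis unfolding series_outside[OF cl False] by simp
    qed
  qed
qed

definition trace :: "'a mat \<Rightarrow> complex" where
  "trace p = M.tr (dim_row p) (series p)"

lemma dsum_projector:
  assumes "p \<in> projectors A" "q \<in> projectors A"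
  shows "dsum A p q \<in> projectors A" "trace (dsum A p q) = trace p + trace q"
proof -
  obtain n where n: "p \<in> mats A n n" "M.projection n (series p)" "dim_row p = n"
    using assms(1) by (rule projectorsE)
  obtain l where l: "q \<in> mats A l l" "M.projection l (series q)" "dim_row q = l"
    using assms(2) by (rule projectorsE)
  note cl = dsum_closed[OF n(1) l(1)]
  show "dsum A p q \<in> projectors A"
    unfolding projectors_iff[OF cl(1)] cl(2) by (rule projection_block[OF n(2) l(2)])
  show "trace (dsum A p q) = trace p + trace q"
    using mats_dim[OF cl(1)] by (simp add: trace_def cl(2) tr_block n(3) l(3))
qed

lemma mzero_projector: "mzero A n n \<in> projectors A" "trace (mzero A n n) = 0"
proof -
  show "mzero A n n \<in> projectors A"
    unfolding projectors_iff[OF mzero_closed] series_mzero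
    by (simp add: M.projection_def M.supported_0)
  show "trace (mzero A n n) = 0" by (simp add: trace_def series_mzero M.tr_def)
qed

lemma pad_projector:
  assumes "p \<in> projectors A" "dim_row p \<le> K"
  shows "pad A K p \<in> projectors A" "pad A K p \<in> mats A K K" "trace (pad A K p) = trace p"
proof -
  obtain n where n: "p \<in> mats A n n" "dim_row p = n" "dim_col p = n"
    using assms(1) by (rule projectorsE)
  have pad: "pad A K p = dsum A p (mzero A (K - n) (K - n))" by (simp add: pad_def n)
  show "pad A K p \<in> projectors A" "trace (pad A K p) = trace p"
    unfolding pad using dsum_projector[OF assms(1) mzero_projector(1)] mzero_projector(2) by simp_all
  show "pad A K p \<in> mats A K K"
    using dsum_closed(1)[OF n(1) mzero_closed, of "K - n"] assms(2) n(2) by (simp add: pad)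
qed

lemma unitaries_iff:
  assumes "u \<in> mats A N N"
  shows "u \<in> unitaries A N \<longleftrightarrow> M.unitary N (series u)"
proof -
  note a = madjoint_closed[OF assms]
  have "mmult A u (madjoint A u) = mone A N \<longleftrightarrow> M.mul N (series u) (M.adj (series u)) = M.E N"
    by (simp only: series_eq_iff[OF mmult_closed(1)[OF assms a(1)] mone_closed]
        mmult_closed(2)[OF assms a(1)] a(2) series_mone)
  moreover have "mmult A (madjoint A u) u = mone A N \<longleftrightarrow> M.mul N (M.adj (series u)) (series u) = M.E N"
    by (simp only: series_eq_iff[OF mmult_closed(1)[OF a(1) assms] mone_closed]
        mmult_closed(2)[OF a(1) assms] a(2) series_mone)
  ultimately show ?thesis
    using assms by (simp add: unitaries_def M.unitary_def supported_series)
qed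

lemma series_preimage:
  assumes F: "M.supported N F" "\<forall>a<N. \<forall>b<N. F a b \<in> \<phi> ` carrier A"
  obtains p where "p \<in> mats A N N" "series p = F"
proof -
  define p where "p = mat N N (\<lambda>(a, b). inv_into (carrier A) \<phi> (F a b))"
  have p: "p \<in> mats A N N"
    unfolding p_def by (rule mats_mat) (use F(2) in \<open>auto intro!: inv_into_into\<close>)
  moreover have "series p = F"
  proof (intro ext)
    fix a b x
    show "series p a b x = F a b x"
    proof (cases "a < N \<and> b < N")
      case True
      then have ab: "a < N" "b < N" by auto
      have "series p a b = F a b"
        unfolding series_eq[OF p ab] using ab F(2) by (simp add: p_def f_inv_into_f)
      then show ?thesis by simp
    next
      case False
      show ?thesis unfolding series_outside[OF p False] M.supported_zero[OF F(1) False] ..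
    qed
  qed
  ultimately show thesis by (rule that)
qed

lemma series_entries: "p \<in> mats A N N \<Longrightarrow> \<forall>a<N. \<forall>b<N. series p a b \<in> \<phi> ` carrier A"
  by (auto simp: series_eq mats_entry)

lemma projector_diagonalize:
  assumes "p \<in> projectors A" "p \<in> mats A K K"
  obtains u r where "u \<in> mats A K K" "M.unitary K (series u)"
    "series p = M.mul K (M.mul K (series u) (M.diag_one K r)) (M.adj (series u))" "trace p = of_nat r"
proof -
  have "M.projection K (series p)" using assms projectors_iff by blast
  from diagonalize[OF this series_entries[OF assms(2)]]
  obtain v r where v: "M.unitary K v" "\<forall>a<K. \<forall>b<K. v a b \<in> \<phi> ` carrier A"
    "series p = M.mul K (M.mul K v (M.diag_one K r)) (M.adj v)" "M.tr K (series p) = of_nat r"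
    by (elim exE conjE) (rule that)
  have "M.supported K v" using v(1) by (simp only: M.unitary_def)
  from this v(2) obtain u where u: "u \<in> mats A K K" "series u = v" by (rule series_preimage)
  have tr: "trace p = of_nat r" using v(4) mats_dim[OF assms(2)] by (simp add: trace_def)
  show thesis by (rule that[OF u(1) _ _ tr]) (simp_all only: u(2) v(1) v(3)[symmetric])
qed

lemma trace_nat: "p \<in> projectors A \<Longrightarrow> \<exists>r. trace p = of_nat r"
proof -
  assume p: "p \<in> projectors A"
  then obtain N where N: "p \<in> mats A N N" by (rule projectorsE)
  from p N obtain r where "trace p = of_nat r" by (rule projector_diagonalize)
  then show "\<exists>r. trace p = of_nat r" ..
qed

text \<open>
  The trace of the constant term is a complete invariant. Given equal traces, both projectors are
  padded to the same size \<open>K\<close> and conjugated into the same diagonal matrix.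
\<close>

lemma proj_equiv_iff:
  "(p, q) \<in> proj_equiv A \<longleftrightarrow> p \<in> projectors A \<and> q \<in> projectors A \<and> trace p = trace q"
proof
  assume "(p, q) \<in> proj_equiv A"
  then obtain K u where pq: "p \<in> projectors A" "q \<in> projectors A"
    and K: "dim_row p \<le> K" "dim_row q \<le> K" and u: "u \<in> unitaries A K"
    and eq: "pad A K p = mmult A (mmult A u (pad A K q)) (madjoint A u)"
    unfolding proj_equiv_def by blast
  note p' = pad_projector[OF pq(1) K(1)] and q' = pad_projector[OF pq(2) K(2)]
  have um: "u \<in> mats A K K" using u by (simp add: unitaries_def)
  then have un: "M.unitary K (series u)" using u unitaries_iff by blast
  have "series (pad A K p) = M.mul K (M.mul K (series u) (series (pad A K q))) (M.adj (series u))"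
    unfolding eq
    by (simp only: mmult_closed(2)[OF mmult_closed(1)[OF um q'(2)] madjoint_closed(1)[OF um]]
        mmult_closed(2)[OF um q'(2)] madjoint_closed(2)[OF um])
  then have "M.tr K (series (pad A K p)) = M.tr K (series (pad A K q))"
    using M.tr_unitary_conjugate[OF un supported_series[OF q'(2)]] by simp
  then have "trace (pad A K p) = trace (pad A K q)"
    using mats_dim[OF p'(2)] mats_dim[OF q'(2)] by (simp add: trace_def)
  then show "p \<in> projectors A \<and> q \<in> projectors A \<and> trace p = trace q"
    using pq p'(3) q'(3) by simp
next
  assume "p \<in> projectors A \<and> q \<in> projectors A \<and> trace p = trace q"
  then have p: "p \<in> projectors A" and q: "q \<in> projectors A" and t: "trace p = trace q" by auto
  define K where "K = max (dim_row p) (dim_row q)"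
  have K: "dim_row p \<le> K" "dim_row q \<le> K" by (auto simp: K_def)
  note p' = pad_projector[OF p K(1)] and q' = pad_projector[OF q K(2)]
  obtain u r where u: "u \<in> mats A K K" "M.unitary K (series u)"
    "series (pad A K p) = M.mul K (M.mul K (series u) (M.diag_one K r)) (M.adj (series u))"
    "trace (pad A K p) = of_nat r" using p'(1,2) by (rule projector_diagonalize)
  obtain w r' where w: "w \<in> mats A K K" "M.unitary K (series w)"
    "series (pad A K q) = M.mul K (M.mul K (series w) (M.diag_one K r')) (M.adj (series w))"
    "trace (pad A K q) = of_nat r'" using q'(1,2) by (rule projector_diagonalize)
  have "(of_nat r :: complex) = of_nat r'" using u(4) w(4) p'(3) q'(3) t by simp
  then have r: "r' = r" by simp
  note wa = madjoint_closed[OF w(1)]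
  (* Conjugate the second projector into the diagonal by w*, and back by u. *)
  define x where "x = mmult A u (madjoint A w)"
  have x: "x \<in> mats A K K" "series x = M.mul K (series u) (M.adj (series w))"
    unfolding x_def by (simp_all only: mmult_closed[OF u(1) wa(1)] wa(2))
  have ux: "M.unitary K (series x)"
    unfolding x(2) by (rule M.unitary_mul[OF u(2) M.unitary_adj[OF w(2)]])
  have sw: "M.supported K (series w)" by (rule supported_series[OF w(1)])
  have sd: "M.supported K (M.diag_one K r)" unfolding M.diag_one_def by (rule M.supported_cmat)
  have ww: "M.mul K (M.adj (series w)) (M.mul K (series w) F) = F" if "M.supported K F" for F
    using w(2) that by (simp add: M.mul_assoc[symmetric] M.unitary_def M.E_mul)
  have sup: "M.supported K (M.mul K (M.diag_one K r) (M.adj (series w)))"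
      "M.supported K (M.adj (series u))"
      "M.supported K (M.mul K (M.diag_one K r) (M.adj (series u)))"
    by (intro M.supported_intros sd sw supported_series[OF u(1)])+
  have "series (mmult A (mmult A x (pad A K q)) (madjoint A x)) =
      M.mul K (M.mul K (series x) (series (pad A K q))) (M.adj (series x))"
    by (simp only: mmult_closed(2)[OF mmult_closed(1)[OF x(1) q'(2)] madjoint_closed(1)[OF x(1)]]
        mmult_closed(2)[OF x(1) q'(2)] madjoint_closed(2)[OF x(1)])
  also have "\<dots> = series (pad A K p)"
    unfolding w(3) x(2) u(3) r M.adj_mul M.adj_adj[OF sw]
    by (simp only: M.mul_assoc ww sup)
  finally have "pad A K p = mmult A (mmult A x (pad A K q)) (madjoint A x)"
    by (rule series_inject[OF mmult_closed(1)[OF mmult_closed(1)[OF x(1) q'(2)] madjoint_closed(1)[OF x(1)]] p'(2),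
        symmetric])
  moreover have "x \<in> unitaries A K" using ux unitaries_iff[OF x(1)] by simp
  ultimately show "(p, q) \<in> proj_equiv A"
    unfolding proj_equiv_def using p q K by blast
qed

theorem K0_iso_integers: "K0 A \<cong> integer_group"
proof -
  define rk where "rk p = (THE r. trace p = of_nat r)" for p
  have rk: "trace p = of_nat (rk p)" if p: "p \<in> projectors A" for p
  proof -
    obtain r where r: "trace p = of_nat r" using trace_nat[OF p] by blast
    then have "rk p = r" unfolding rk_def by (intro the_equality) auto
    with r show ?thesis by simp
  qed
  show ?thesis
  proof (rule K0_iso_integers_if_rank[where rk = rk])
    fix p q
    show "(p, q) \<in> proj_equiv A \<longleftrightarrow> p \<in> projectors A \<and> q \<in> projectors A \<and> rk p = rk q"
      unfolding proj_equiv_iff using rk by auto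
    assume pq: "p \<in> projectors A" "q \<in> projectors A"
    show "dsum A p q \<in> projectors A" by (rule dsum_projector(1)[OF pq])
    have "(of_nat (rk (dsum A p q)) :: complex) = of_nat (rk p + rk q)"
      using dsum_projector[OF pq] rk pq by simp
    then show "rk (dsum A p q) = rk p + rk q" by (simp only: of_nat_eq_iff)
  next
    fix n
    have pr: "mone A n \<in> projectors A"
      unfolding projectors_iff[OF mone_closed] series_mone
      by (simp add: M.projection_def M.supported_E M.E_mul)
    have "trace (mone A n) = (\<Sum>a<n. 1)"
      using mats_dim[OF mone_closed[of n]]
      by (simp add: trace_def series_mone M.tr_def M.E_def M.cmat_def const_def)
    then have "(of_nat (rk (mone A n)) :: complex) = of_nat n" using rk[OF pr] by simp
    then show "\<exists>p\<in>projectors A. rk p = n" using pr by auto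
  qed
qed

end

section \<open>The smooth algebra\<close>

lemma inverse_square_telescope:
  assumes "t > (0 :: real)"
  shows "1 / (1 + t\<^sup>2) \<le> 2 / t - 2 / (t + 1)"
proof -
  have "t * (t + 1) \<le> 2 * (1 + t\<^sup>2)"
    using zero_le_power2[of "t - 1"] assms by (simp add: power2_eq_square algebra_simps)
  moreover have "1 + t\<^sup>2 > 0" "t * (t + 1) > 0"
    using assms zero_le_power2[of t] by (auto intro: add_pos_nonneg)
  ultimately have "1 / (1 + t\<^sup>2) \<le> 2 / (t * (t + 1))"
    by (simp only: pos_le_divide_eq pos_divide_le_eq mult_1 times_divide_eq_left)
  also have "\<dots> = 2 / t - 2 / (t + 1)"
    using assms by (simp add: field_simps)
  finally show ?thesis .
qed

lemma sum_inverse_squares_le: "(\<Sum>t\<le>d. 1 / (1 + (real t)\<^sup>2)) \<le> 3"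
proof -
  have "(\<Sum>t\<le>d. 1 / (1 + (real t)\<^sup>2)) \<le> 3 - 2 / (real d + 1)"
  proof (induction d)
    case (Suc d)
    then show ?case using inverse_square_telescope[of "real d + 1"] by (simp add: add.commute)
  qed simp
  also have "\<dots> \<le> 3" by simp
  finally show ?thesis .
qed

context skew_parameter
begin

abbreviation weight :: "multiindex \<Rightarrow> real" where
  "weight k \<equiv> 1 + (\<Sum>g\<in>L. (real (k g))\<^sup>2)"

lemma weight_ge_1: "weight k \<ge> 1"
  by (simp add: sum_nonneg)

text \<open>
  The sum over a box factorises into one-dimensional sums.
\<close>

lemma sum_inverse_products_le: "(\<Sum>k\<in>ball d. \<Prod>g\<in>L. 1 / (1 + (real (k g))\<^sup>2)) \<le> 3 ^ card L"
proof -
  let ?w = "\<lambda>t. 1 / (1 + (real t)\<^sup>2)" and ?r = "\<lambda>k :: multiindex. restrict k L"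
  have inj: "inj_on ?r (ball d)"
  proof (rule inj_onI, rule ext)
    fix i j g assume ij: "i \<in> ball d" "j \<in> ball d" "?r i = ?r j"
    show "i g = j g"
    proof (cases "g \<in> L")
      case True
      then show ?thesis using fun_cong[OF ij(3), of g] by simp
    next
      case False
      then show ?thesis using ij(1,2) by (auto simp: ball_def multiindices_def)
    qed
  qed
  have sub: "?r ` ball d \<subseteq> PiE L (\<lambda>_. {..d})"
  proof (intro image_subsetI PiE_I)
    fix k g assume k: "k \<in> ball d" and g: "g \<in> L"
    have "k g \<le> deg k" unfolding deg_def using g by (intro member_le_sum) auto
    then show "?r k g \<in> {..d}" using k g by (simp add: ball_def)
  qed auto
  have "(\<Sum>k\<in>ball d. \<Prod>g\<in>L. ?w (k g)) = (\<Sum>f\<in>?r ` ball d. \<Prod>g\<in>L. ?w (f g))"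
    unfolding sum.reindex[OF inj] by (auto intro!: sum.cong prod.cong)
  also have "\<dots> \<le> (\<Sum>f\<in>PiE L (\<lambda>_. {..d}). \<Prod>g\<in>L. ?w (f g))"
    by (rule sum_mono2[OF _ sub]) (auto intro!: finite_PiE prod_nonneg)
  also have "\<dots> = (\<Prod>g\<in>L. \<Sum>t\<le>d. ?w t)"
    by (rule prod_sum_PiE[symmetric]) auto
  also have "\<dots> \<le> (\<Prod>g\<in>L. 3)"
    by (rule prod_mono) (auto intro!: sum_inverse_squares_le sum_nonneg)
  finally show ?thesis by simp
qed

text \<open>
  Rapid decrease gives room for the summable weight: a product of the factors $1 / (1 + k_g^2)$ over
  the generators is split off, at the cost of raising the exponent of the weight by the number of
  generators.
\<close>

lemma schwartz_series_norm_bounded: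
  assumes a: "a \<in> schwartz m"
  shows "\<exists>C. \<forall>d. M.series_norm r d a \<le> C"
proof -
  have "r + card L + 1 \<ge> 1" by simp
  then obtain C where C: "\<And>k. k \<in> MI \<Longrightarrow> weight k ^ (r + card L + 1) * cmod (a k) < C"
    using a unfolding schwartz_def by blast
  have pt: "real (deg k) ^ r * cmod (a k) \<le> C * (\<Prod>g\<in>L. 1 / (1 + (real (k g))\<^sup>2))" if k: "k \<in> MI" for k
  proof -
    let ?P = "\<Prod>g\<in>L. 1 + (real (k g))\<^sup>2"
    have P: "?P > 0" by (rule prod_pos) (auto intro: add_pos_nonneg)
    have "real (deg k) = (\<Sum>g\<in>L. real (k g))" by (simp add: deg_def)
    also have "\<dots> \<le> (\<Sum>g\<in>L. (real (k g))\<^sup>2)"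
    proof (rule sum_mono)
      fix g
      have "k g \<le> k g ^ 2" by (simp add: power2_eq_square)
      then show "real (k g) \<le> (real (k g))\<^sup>2" by (simp flip: of_nat_power)
    qed
    finally have "real (deg k) ^ r \<le> weight k ^ r" by (intro power_mono) auto
    moreover have "?P \<le> (\<Prod>g\<in>L. weight k)"
      by (rule prod_mono) (auto intro!: member_le_sum)
    then have "?P \<le> weight k ^ card L" by simp
    ultimately have "real (deg k) ^ r * ?P \<le> weight k ^ r * weight k ^ card L"
      using P weight_ge_1[of k] by (intro mult_mono) auto
    also have "\<dots> \<le> weight k ^ (r + card L + 1)"
      unfolding power_add[symmetric] by (rule power_increasing[OF _ weight_ge_1]) simp
    finally have "real (deg k) ^ r * ?P * cmod (a k) \<le> weight k ^ (r + card L + 1) * cmod (a k)"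
      by (rule mult_right_mono) simp
    also have "\<dots> \<le> C" using C[OF k] by simp
    finally have "real (deg k) ^ r * cmod (a k) \<le> C / ?P"
      using P by (simp add: pos_le_divide_eq mult_ac)
    then show ?thesis by (simp add: prod_dividef)
  qed
  have C0: "C \<ge> 0"
  proof -
    have "0 \<le> weight 0 ^ (r + card L + 1) * cmod (a 0)" by (simp add: sum_nonneg)
    then show ?thesis using C[OF MI_zero] by linarith
  qed
  have "M.series_norm r d a \<le> C * 3 ^ card L" for d
  proof -
    have "M.series_norm r d a \<le> (\<Sum>k\<in>ball d. C * (\<Prod>g\<in>L. 1 / (1 + (real (k g))\<^sup>2)))"
      unfolding M.series_norm_def by (intro sum_mono pt) (simp add: ball_def)
    also have "\<dots> \<le> C * 3 ^ card L"
      unfolding sum_distrib_left[symmetric]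
      by (rule mult_left_mono[OF sum_inverse_products_le C0])
    finally show ?thesis .
  qed
  then show ?thesis by blast
qed

text \<open>
  A single coefficient is bounded by the moment, and the quadratic weight by the square of
  $1 + \deg k$.
\<close>

lemma schwartzI:
  assumes supp: "\<And>k. k \<notin> MI \<Longrightarrow> a k = 0" and bd: "\<And>r. \<exists>C. \<forall>d. M.series_norm r d a \<le> C"
  shows "a \<in> schwartz m"
  unfolding schwartz_def
proof (intro CollectI conjI allI impI)
  fix r :: nat
  obtain C where C: "\<And>q d. M.series_norm q d a \<le> C q" using bd by metis
  let ?B = "\<Sum>q\<le>2 * r. real (2 * r choose q) * C q"
  have "weight k ^ r * cmod (a k) < ?B + 1" if k: "k \<in> MI" for k
  proof -
    have pt: "real (deg k) ^ q * cmod (a k) \<le> C q" for q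
    proof -
      have "real (deg k) ^ q * cmod (a k) \<le> M.series_norm q (deg k) a"
        unfolding M.series_norm_def by (rule member_le_sum[OF _ _ finite_ball]) (use k in \<open>auto simp: ball_def\<close>)
      then show ?thesis using C[of q "deg k"] by linarith
    qed
    have "(\<Sum>g\<in>L. (real (k g))\<^sup>2) \<le> (\<Sum>g\<in>L. real (k g) * real (deg k))"
      unfolding power2_eq_square deg_def of_nat_sum
      by (intro sum_mono mult_left_mono member_le_sum) auto
    also have "\<dots> = (real (deg k))\<^sup>2"
      by (simp add: sum_distrib_right[symmetric] deg_def power2_eq_square)
    finally have "weight k \<le> (1 + real (deg k))\<^sup>2" by (simp add: power2_sum)
    then have "weight k ^ r \<le> ((1 + real (deg k))\<^sup>2) ^ r"
      by (rule power_mono) (use weight_ge_1[of k] in linarith)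
    also have "\<dots> = (real (deg k) + 1) ^ (2 * r)" by (simp add: power_mult add.commute)
    also have "\<dots> = (\<Sum>q\<le>2 * r. real (2 * r choose q) * real (deg k) ^ q)"
      by (subst binomial_ring) simp
    finally have "weight k ^ r * cmod (a k) \<le> (\<Sum>q\<le>2 * r. real (2 * r choose q) * real (deg k) ^ q) * cmod (a k)"
      by (rule mult_right_mono) simp
    also have "\<dots> = (\<Sum>q\<le>2 * r. real (2 * r choose q) * (real (deg k) ^ q * cmod (a k)))"
      by (simp add: sum_distrib_right mult.assoc)
    also have "\<dots> \<le> ?B" by (intro sum_mono mult_left_mono pt) auto
    finally show ?thesis by linarith
  qed
  then show "\<exists>C. \<forall>k\<in>MI. weight k ^ r * cmod (a k) < C" by blast
qed (rule supp)

lemma schwartz_support: "a \<in> schwartz m \<Longrightarrow> k \<notin> MI \<Longrightarrow> a k = 0"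
  by (simp add: schwartz_def)

lemma const_schwartz: "const c \<in> schwartz m"
proof (rule schwartzI)
  fix r
  have "M.series_norm r d (const c) \<le> cmod c" for d
  proof -
    have "M.series_norm r d (const c) \<le> (\<Sum>k\<in>ball d. if k = 0 then cmod c else 0)"
      unfolding M.series_norm_def by (rule sum_mono) (auto simp: const_def power_0_left)
    also have "\<dots> \<le> cmod c" by (simp add: sum.delta)
    finally show ?thesis .
  qed
  then show "\<exists>C. \<forall>d. M.series_norm r d (const c) \<le> C" by blast
qed (auto simp: const_def)

lemma zero_schwartz: "0 \<in> schwartz m"
proof -
  have "const 0 = 0" by (intro ext) (simp add: const_def)
  then show ?thesis using const_schwartz[of 0] by simp
qed

lemma conv_schwartz:
  assumes "a \<in> schwartz m" "b \<in> schwartz m"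
  shows "conv a b \<in> schwartz m"
proof (rule schwartzI)
  fix r
  obtain A B where A: "\<And>q d. M.series_norm q d a \<le> A q" and B: "\<And>q d. M.series_norm q d b \<le> B q"
    using schwartz_series_norm_bounded[OF assms(1)] schwartz_series_norm_bounded[OF assms(2)] by metis
  have A0: "A q \<ge> 0" for q by (rule order_trans[OF M.series_norm_nonneg A])
  have "M.series_norm r d (conv a b) \<le> (\<Sum>q\<le>r. real (r choose q) * (A q * B (r - q)))" for d
    by (rule order_trans[OF M.series_norm_conv]; intro sum_mono mult_left_mono mult_mono A B M.series_norm_nonneg A0) simp
  then show "\<exists>C. \<forall>d. M.series_norm r d (conv a b) \<le> C" by blast
qed (rule M.conv_not_MI)

lemma add_schwartz:
  assumes "a \<in> schwartz m" "b \<in> schwartz m"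
  shows "a + b \<in> schwartz m"
proof (rule schwartzI)
  fix r
  obtain A B where A: "\<And>d. M.series_norm r d a \<le> A" and B: "\<And>d. M.series_norm r d b \<le> B"
    using schwartz_series_norm_bounded[OF assms(1), of r] schwartz_series_norm_bounded[OF assms(2), of r] by blast
  have "M.series_norm r d (a + b) \<le> A + B" for d
    by (rule order_trans[OF M.series_norm_add add_mono[OF A B]])
  then show "\<exists>C. \<forall>d. M.series_norm r d (a + b) \<le> C" by blast
next
  fix k assume "k \<notin> MI"
  then show "(a + b) k = 0" using assms by (simp add: schwartz_support)
qed

lemma series_star_schwartz:
  assumes "a \<in> schwartz m"
  shows "series_star a \<in> schwartz m"
proof (rule schwartzI)
  fix r show "\<exists>C. \<forall>d. M.series_norm r d (series_star a) \<le> C"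
    unfolding M.series_norm_series_star by (rule schwartz_series_norm_bounded[OF assms])
next
  fix k assume "k \<notin> MI"
  then have "a (k \<circ> bar) = 0" by (intro schwartz_support[OF assms]) simp
  then show "series_star a k = 0" by (simp add: series_star_def)
qed

lemma tempered_if_schwartz_entries:
  assumes "\<forall>a<N. \<forall>b<N. F a b \<in> schwartz m"
  shows "M.tempered N F"
  unfolding M.tempered_def
proof
  fix r
  have "\<forall>a b. \<exists>C. a < N \<longrightarrow> b < N \<longrightarrow> (\<forall>d. M.series_norm r d (F a b) \<le> C)"
    using assms schwartz_series_norm_bounded[of _ r] by blast
  then obtain C where C: "\<And>a b d. a < N \<Longrightarrow> b < N \<Longrightarrow> M.series_norm r d (F a b) \<le> C a b" by metis
  have "M.mat_norm N r d F \<le> (\<Sum>a<N. \<Sum>b<N. C a b)" for d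
    unfolding M.mat_norm_def by (intro sum_mono C) auto
  then show "\<exists>C. \<forall>d. M.mat_norm N r d F \<le> C" by blast
qed

lemma schwartz_entries_if_tempered:
  assumes F: "M.supported N F" "M.tempered N F" and ab: "a < N" "b < N"
  shows "F a b \<in> schwartz m"
proof (rule schwartzI)
  fix k assume "k \<notin> MI"
  then show "F a b k = 0" by (intro M.supportedD[OF F(1)]) simp
next
  fix r
  obtain C where C: "\<And>d. M.mat_norm N r d F \<le> C" using F(2) unfolding M.tempered_def by blast
  have "M.series_norm r d (F a b) \<le> C" for d
  proof -
    have "M.series_norm r d (F a b) \<le> (\<Sum>b<N. M.series_norm r d (F a b))"
      by (rule member_le_sum) (use ab M.series_norm_nonneg in auto)
    also have "\<dots> \<le> M.mat_norm N r d F"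
      unfolding M.mat_norm_def
      by (rule member_le_sum[where f = "\<lambda>a. \<Sum>b<N. M.series_norm r d (F a b)"])
        (use ab in \<open>auto intro!: sum_nonneg M.series_norm_nonneg\<close>)
    finally show ?thesis using C[of d] by linarith
  qed
  then show "\<exists>C. \<forall>d. M.series_norm r d (F a b) \<le> C" by blast
qed

lemma C_smooth_mult: "monoid.mult (C_smooth m \<Theta>) a b = conv a b"
proof
  fix k
  have "{(i, j). i \<in> MI \<and> j \<in> MI \<and> (\<forall>g. i g + j g = k g)} = splits k"
    unfolding splits_def by (simp add: fun_eq_iff)
  then show "monoid.mult (C_smooth m \<Theta>) a b k = conv a b k"
    by (simp add: C_smooth_def conv_def cocycle_def)
qed

lemma C_smooth_representation: "series_representation m \<Theta> (C_smooth m \<Theta>) (\<lambda>a. a)"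
proof (intro series_representation.intro skew_parameter_axioms series_representation_axioms.intro)
  have z: "\<zero>\<^bsub>C_smooth m \<Theta>\<^esub> = 0" by (simp add: C_smooth_def zero_fun_def)
  have o: "\<one>\<^bsub>C_smooth m \<Theta>\<^esub> = const 1"
    by (rule ext) (simp add: C_smooth_def const_def zero_fun_def)
  have p: "a \<oplus>\<^bsub>C_smooth m \<Theta>\<^esub> b = a + b" for a b by (simp add: C_smooth_def plus_fun_def)
  have s: "star (C_smooth m \<Theta>) a = series_star a" for a
    by (rule ext) (simp add: C_smooth_def series_star_def star_coeff_def)
  have c: "carrier (C_smooth m \<Theta>) = schwartz m" by (simp add: C_smooth_def)
  show "\<zero>\<^bsub>C_smooth m \<Theta>\<^esub> \<in> carrier (C_smooth m \<Theta>)" "\<one>\<^bsub>C_smooth m \<Theta>\<^esub> \<in> carrier (C_smooth m \<Theta>)"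
    unfolding z o c by (rule zero_schwartz const_schwartz)+
  fix a b
  assume a: "a \<in> carrier (C_smooth m \<Theta>)"
  show "star (C_smooth m \<Theta>) a \<in> carrier (C_smooth m \<Theta>)"
    using a unfolding c s by (rule series_star_schwartz)
  show "a k = 0" if "k \<notin> MI" for k using a that unfolding c by (rule schwartz_support)
  show "star (C_smooth m \<Theta>) a = series_star a" by (rule s)
  assume b: "b \<in> carrier (C_smooth m \<Theta>)"
  show "a \<oplus>\<^bsub>C_smooth m \<Theta>\<^esub> b \<in> carrier (C_smooth m \<Theta>)" using a b unfolding c p by (rule add_schwartz)
  show "a \<otimes>\<^bsub>C_smooth m \<Theta>\<^esub> b \<in> carrier (C_smooth m \<Theta>)"
    using a b unfolding c C_smooth_mult by (rule conv_schwartz)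
  show "a \<oplus>\<^bsub>C_smooth m \<Theta>\<^esub> b = a + b" by (rule p)
  show "a \<otimes>\<^bsub>C_smooth m \<Theta>\<^esub> b = conv a b" by (rule C_smooth_mult)
next
  show "inj_on (\<lambda>a. a) (carrier (C_smooth m \<Theta>))" by (rule inj_on_id2)
  show "\<zero>\<^bsub>C_smooth m \<Theta>\<^esub> = 0" by (simp add: C_smooth_def zero_fun_def)
  show "\<one>\<^bsub>C_smooth m \<Theta>\<^esub> = const 1"
    by (rule ext) (simp add: C_smooth_def const_def zero_fun_def)
next
  fix N p
  assume p: "M.projection N p" and "\<forall>a<N. \<forall>b<N. p a b \<in> (\<lambda>a. a) ` carrier (C_smooth m \<Theta>)"
  then have "\<forall>a<N. \<forall>b<N. p a b \<in> schwartz m" by (simp add: C_smooth_def)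
  then have "M.tempered N p" by (rule tempered_if_schwartz_entries)
  from p this obtain u r where u: "M.unitary N u" "M.tempered N u"
    "p = M.mul N (M.mul N u (M.diag_one N r)) (M.adj u)" "M.tr N p = of_nat r"
    by (rule M.tempered_projection_diagonalize)
  have "M.supported N u" using u(1) by (simp only: M.unitary_def)
  then have "\<forall>a<N. \<forall>b<N. u a b \<in> (\<lambda>a. a) ` carrier (C_smooth m \<Theta>)"
    using schwartz_entries_if_tempered[OF _ u(2)] by (simp add: C_smooth_def)
  with u show "\<exists>u r. M.unitary N u \<and> (\<forall>a<N. \<forall>b<N. u a b \<in> (\<lambda>a. a) ` carrier (C_smooth m \<Theta>)) \<and>
      p = M.mul N (M.mul N u (M.diag_one N r)) (M.adj u) \<and> M.tr N p = of_nat r"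
    by (intro exI conjI)
qed

end

section \<open>The formal series of a noncommutative polynomial\<close>

lemma star_word_eq_iff: "star_word w = v \<longleftrightarrow> w = star_word v"
  by (metis star_word_star_word)

lemma inj_star_word: "inj star_word"
  by (metis injI star_word_star_word)

lemma lookup_free_star: "Poly_Mapping.lookup (free_star f) w = cnj (Poly_Mapping.lookup f (star_word w))"
  unfolding free_star_def
  by (simp add: Poly_Mapping.map.rep_eq map_key.rep_eq[OF inj_star_word] when_def)

lemma keys_free_star: "Poly_Mapping.keys (free_star f) = star_word ` Poly_Mapping.keys f"
proof (intro equalityI subsetI)
  fix w assume "w \<in> Poly_Mapping.keys (free_star f)"
  then have "star_word w \<in> Poly_Mapping.keys f" by (simp add: in_keys_iff lookup_free_star)
  then show "w \<in> star_word ` Poly_Mapping.keys f"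
    by (rule image_eqI[of _ _ "star_word w", rotated]) simp
next
  fix w assume "w \<in> star_word ` Poly_Mapping.keys f"
  then show "w \<in> Poly_Mapping.keys (free_star f)"
    by (auto simp: in_keys_iff lookup_free_star)
qed

lemma free_scale_eq_mult: "free_scale c f = Poly_Mapping.single [] c * f"
  unfolding free_scale_def using mult_map_scale_conv_mult[of c f] by (simp add: zero_list_def)

lemma free_star_free_star: "free_star (free_star f) = f"
  by (rule poly_mapping_eqI) (simp add: lookup_free_star)

lemma free_star_diff: "free_star (f - g) = free_star f - free_star g"
  by (rule poly_mapping_eqI) (simp add: lookup_free_star lookup_minus)

lemma free_star_single: "free_star (Poly_Mapping.single w c) = Poly_Mapping.single (star_word w) (cnj c)"
proof (rule poly_mapping_eqI)
  fix v
  have "w = star_word v \<longleftrightarrow> star_word w = v" using star_word_eq_iff[of w v] by blast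
  then show "Poly_Mapping.lookup (free_star (Poly_Mapping.single w c)) v =
      Poly_Mapping.lookup (Poly_Mapping.single (star_word w) (cnj c)) v"
    by (simp add: lookup_free_star lookup_single when_def)
qed

lemma single_sum: "Poly_Mapping.single w (\<Sum>x\<in>A. f x) = (\<Sum>x\<in>A. Poly_Mapping.single w (f x))"
  by (induction A rule: infinite_finite_induct) (auto simp: single_add)

context skew_parameter
begin

abbreviation "FA \<equiv> free_alg m"

text \<open>
  The word as an element of the algebra of formal series.
\<close>

definition monomial_series :: "letter list \<Rightarrow> multiindex \<Rightarrow> complex" where
  "monomial_series w k = (if k = count (mset w) then R w else 0)"

definition free_series :: "free \<Rightarrow> multiindex \<Rightarrow> complex" where
  "free_series f k = (\<Sum>w\<in>Poly_Mapping.keys f. Poly_Mapping.lookup f w * monomial_series w k)"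

lemma free_series_superset:
  assumes "finite W" "Poly_Mapping.keys f \<subseteq> W"
  shows "free_series f k = (\<Sum>w\<in>W. Poly_Mapping.lookup f w * monomial_series w k)"
  unfolding free_series_def by (rule sum.mono_neutral_left) (use assms in \<open>auto simp: in_keys_iff\<close>)

lemma free_series_add: "free_series (f + g) = free_series f + free_series g"
proof
  fix k
  let ?W = "Poly_Mapping.keys f \<union> Poly_Mapping.keys g"
  have "free_series (f + g) k = (\<Sum>w\<in>?W. Poly_Mapping.lookup (f + g) w * monomial_series w k)"
    by (rule free_series_superset) (use keys_add[of f g] in auto)
  also have "\<dots> = free_series f k + free_series g k"
    by (simp add: lookup_add distrib_right sum.distrib free_series_superset[of ?W])
  finally show "free_series (f + g) k = (free_series f + free_series g) k" by simp
qed

lemma free_series_0 [simp]: "free_series 0 = 0"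
  by (rule ext) (simp add: free_series_def)

lemma free_series_uminus: "free_series (- f) = - free_series f"
  by (rule ext) (simp add: free_series_def sum_negf)

lemma free_series_diff: "free_series (f - g) = free_series f - free_series g"
  unfolding diff_conv_add_uminus[of f g] free_series_add free_series_uminus diff_conv_add_uminus[of "free_series f"] ..

lemma free_series_sum: "free_series (\<Sum>x\<in>A. f x) = (\<Sum>x\<in>A. free_series (f x))"
  by (induction A rule: infinite_finite_induct)
    (simp_all only: sum.infinite sum.empty sum.insert free_series_0 free_series_add not_False_eq_True)

lemma free_series_single: "free_series (Poly_Mapping.single w c) = (\<lambda>k. c * monomial_series w k)"
proof
  fix k
  have "free_series (Poly_Mapping.single w c) k =
      (\<Sum>v\<in>{w}. Poly_Mapping.lookup (Poly_Mapping.single w c) v * monomial_series v k)"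
    by (rule free_series_superset) auto
  then show "free_series (Poly_Mapping.single w c) k = c * monomial_series w k" by simp
qed

lemma carrier_FA: "f \<in> carrier FA \<longleftrightarrow> (\<forall>w\<in>Poly_Mapping.keys f. set w \<subseteq> L)"
  by (simp add: free_alg_def)

lemma single_in_FA: "set w \<subseteq> L \<Longrightarrow> Poly_Mapping.single w c \<in> carrier FA"
  by (simp add: carrier_FA)

lemma add_in_FA: "f \<in> carrier FA \<Longrightarrow> g \<in> carrier FA \<Longrightarrow> f + g \<in> carrier FA"
  unfolding carrier_FA using keys_add[of f g] by blast

lemma uminus_in_FA: "f \<in> carrier FA \<Longrightarrow> - f \<in> carrier FA"
  by (simp add: carrier_FA)

lemma diff_in_FA: "f \<in> carrier FA \<Longrightarrow> g \<in> carrier FA \<Longrightarrow> f - g \<in> carrier FA"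
  using add_in_FA[of f "- g"] uminus_in_FA[of g] by simp

lemma mult_in_FA:
  assumes "f \<in> carrier FA" "g \<in> carrier FA"
  shows "f * g \<in> carrier FA"
  unfolding carrier_FA
proof
  fix w assume "w \<in> Poly_Mapping.keys (f * g)"
  then obtain u v where "w = u + v" "u \<in> Poly_Mapping.keys f" "v \<in> Poly_Mapping.keys g"
    using keys_mult[of f g] by blast
  then show "set w \<subseteq> L" using assms by (simp add: carrier_FA plus_list_def)
qed

lemma zero_in_FA: "0 \<in> carrier FA"
  by (simp add: carrier_FA)

lemma one_eq_single: "(1 :: free) = Poly_Mapping.single [] 1"
  by (simp add: zero_list_def[symmetric])

lemma one_in_FA: "1 \<in> carrier FA"
  unfolding one_eq_single by (rule single_in_FA) simp

lemma star_in_FA: "f \<in> carrier FA \<Longrightarrow> free_star f \<in> carrier FA"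
  by (simp add: carrier_FA keys_free_star set_star_word)

lemma FA_simps:
  "\<zero>\<^bsub>FA\<^esub> = 0" "\<one>\<^bsub>FA\<^esub> = 1" "f \<oplus>\<^bsub>FA\<^esub> g = f + g" "f \<otimes>\<^bsub>FA\<^esub> g = f * g"
  by (simp_all add: free_alg_def)

lemma ring_FA: "ring FA"
proof (rule ringI)
  show "abelian_group FA"
  proof (rule abelian_groupI)
    fix f assume "f \<in> carrier FA"
    then show "\<exists>g\<in>carrier FA. g \<oplus>\<^bsub>FA\<^esub> f = \<zero>\<^bsub>FA\<^esub>"
      by (intro bexI[of _ "- f"]) (simp_all add: FA_simps uminus_in_FA)
  qed (simp_all add: FA_simps add_in_FA zero_in_FA ac_simps)
  show "Group.monoid FA"
    by (rule monoidI) (simp_all add: FA_simps mult_in_FA one_in_FA mult.assoc)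
qed (simp_all add: FA_simps ring_distribs)

lemma monomial_series_support: "set w \<subseteq> L \<Longrightarrow> k \<notin> MI \<Longrightarrow> monomial_series w k = 0"
  using count_word_in_multiindices[of w m] by (auto simp: monomial_series_def)

lemma free_series_support: "f \<in> carrier FA \<Longrightarrow> k \<notin> MI \<Longrightarrow> free_series f k = 0"
  unfolding free_series_def by (rule sum.neutral) (auto simp: carrier_FA monomial_series_support)

lemma free_series_finite_support: "finite {k. free_series f k \<noteq> 0}"
proof (rule finite_subset)
  show "{k. free_series f k \<noteq> 0} \<subseteq> (\<lambda>w. count (mset w)) ` Poly_Mapping.keys f"
  proof (rule subsetI, rule ccontr)
    fix k assume k: "k \<in> {k. free_series f k \<noteq> 0}" "k \<notin> (\<lambda>w. count (mset w)) ` Poly_Mapping.keys f"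
    then have "free_series f k = 0" unfolding free_series_def
      by (intro sum.neutral) (auto simp: monomial_series_def)
    with k show False by simp
  qed
qed simp

lemma conv_monomial_series:
  assumes "set w \<subseteq> L" "set v \<subseteq> L"
  shows "conv (monomial_series w) (monomial_series v) = monomial_series (w @ v)"
proof
  fix k
  let ?i = "count (mset w)" and ?j = "count (mset v)"
  have ij: "?i \<in> MI" "?j \<in> MI" using assms by (auto intro: count_word_in_multiindices)
  have "count (mset (w @ v)) = ?i + ?j" by (rule ext) simp
  then have ms: "monomial_series (w @ v) k = (if k = ?i + ?j then R (w @ v) else 0)"
    by (simp only: monomial_series_def)
  show "conv (monomial_series w) (monomial_series v) k = monomial_series (w @ v) k"
  proof (cases "k = ?i + ?j")
    case True
    have "conv (monomial_series w) (monomial_series v) k =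
        (\<Sum>(i, j)\<in>{(?i, ?j)}. monomial_series w i * monomial_series v j * cocycle i j)"
      unfolding conv_def
      by (rule sum.mono_neutral_right[OF finite_splits])
        (use True ij in \<open>auto simp: splits_def monomial_series_def split: if_splits\<close>)
    also have "\<dots> = R w * R v * cross \<beta> w v"
      by (simp add: monomial_series_def cocycle_count assms)
    also have "\<dots> = R (w @ v)" by (simp add: reorder_eq_pairprod pairprod_append)
    finally show ?thesis unfolding ms using True by simp
  next
    case False
    have "conv (monomial_series w) (monomial_series v) k = 0"
      unfolding conv_def
      by (rule sum.neutral) (use False in \<open>auto simp: splits_def monomial_series_def\<close>)
    then show ?thesis unfolding ms using False by simp
  qed
qed

lemma sum_singles: "(\<Sum>w\<in>Poly_Mapping.keys f. Poly_Mapping.single w (Poly_Mapping.lookup f w)) = f"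
  by (rule poly_mapping_eqI) (simp add: lookup_sum lookup_single when_def in_keys_iff)

lemma free_series_mult:
  assumes "f \<in> carrier FA" "g \<in> carrier FA"
  shows "free_series (f * g) = conv (free_series f) (free_series g)"
proof -
  let ?f = "\<lambda>w. Poly_Mapping.single w (Poly_Mapping.lookup f w)"
  let ?g = "\<lambda>w. Poly_Mapping.single w (Poly_Mapping.lookup g w)"
  have single: "free_series (?f w * ?g v) = conv (free_series (?f w)) (free_series (?g v))"
    if "w \<in> Poly_Mapping.keys f" "v \<in> Poly_Mapping.keys g" for w v
  proof -
    have wv: "set w \<subseteq> L" "set v \<subseteq> L" using that assms by (auto simp: carrier_FA)
    show ?thesis
      by (rule ext)
        (simp only: mult_single free_series_single M.conv_scale conv_monomial_series[OF wv, symmetric] plus_list_def mult.assoc)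
  qed
  have "free_series (f * g) = free_series ((\<Sum>w\<in>Poly_Mapping.keys f. ?f w) * (\<Sum>v\<in>Poly_Mapping.keys g. ?g v))"
    by (simp only: sum_singles)
  also have "\<dots> = (\<Sum>w\<in>Poly_Mapping.keys f. \<Sum>v\<in>Poly_Mapping.keys g. free_series (?f w * ?g v))"
    by (simp only: sum_product free_series_sum)
  also have "\<dots> = (\<Sum>w\<in>Poly_Mapping.keys f. \<Sum>v\<in>Poly_Mapping.keys g. conv (free_series (?f w)) (free_series (?g v)))"
    by (intro sum.cong refl single)
  also have "\<dots> = conv (\<Sum>w\<in>Poly_Mapping.keys f. free_series (?f w)) (\<Sum>v\<in>Poly_Mapping.keys g. free_series (?g v))"
    by (simp only: conv_sum_left, simp only: conv_sum_right)
  also have "\<dots> = conv (free_series f) (free_series g)" by (simp only: free_series_sum[symmetric] sum_singles)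
  finally show ?thesis .
qed

lemma free_series_star:
  assumes "f \<in> carrier FA"
  shows "free_series (free_star f) = series_star (free_series f)"
proof
  fix k
  have "free_series (free_star f) k =
      (\<Sum>w\<in>Poly_Mapping.keys f. cnj (Poly_Mapping.lookup f w) * monomial_series (star_word w) k)"
    unfolding free_series_def keys_free_star
    by (subst sum.reindex) (auto simp: lookup_free_star intro: inj_on_subset[OF inj_star_word])
  also have "\<dots> = (\<Sum>w\<in>Poly_Mapping.keys f. cnj (Poly_Mapping.lookup f w * monomial_series w (k \<circ> bar)) *
      star_coeff (k \<circ> bar))"
  proof (rule sum.cong[OF refl])
    fix w assume "w \<in> Poly_Mapping.keys f"
    then have w: "set w \<subseteq> L" using assms by (auto simp: carrier_FA)
    have "k = count (mset w) \<circ> bar \<longleftrightarrow> k \<circ> bar = count (mset w)"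
      by (metis comp_bar_bar)
    then have "monomial_series (star_word w) k = cnj (monomial_series w (k \<circ> bar)) * star_coeff (k \<circ> bar)"
      using reorder_star_word[OF w]
      by (simp add: monomial_series_def count_star_word star_coeff_def)
    then show "cnj (Poly_Mapping.lookup f w) * monomial_series (star_word w) k =
        cnj (Poly_Mapping.lookup f w * monomial_series w (k \<circ> bar)) * star_coeff (k \<circ> bar)"
      by (simp add: mult.assoc)
  qed
  also have "\<dots> = series_star (free_series f) k"
    by (simp add: series_star_def free_series_def sum_distrib_right)
  finally show "free_series (free_star f) k = series_star (free_series f) k" .
qed

section \<open>Normal form modulo the relations\<close>

abbreviation "star_relators \<equiv> relators m \<Theta> \<union> free_star ` relators m \<Theta>"
abbreviation "I \<equiv> rel_ideal m \<Theta>"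

lemma free_scale_word: "free_scale c (word w) = Poly_Mapping.single w c"
  by (simp add: free_scale_eq_mult mult_single plus_list_def)

text \<open>
  All relators have the same form in terms of \<open>swap\<close>.
\<close>

lemma relator_cases:
  assumes "f \<in> relators m \<Theta>"
  obtains g h where "g \<in> L" "h \<in> L" "f = word [g, h] - Poly_Mapping.single [h, g] (swap \<Theta> g h)"
proof -
  consider (ZZ) p q where "p \<in> {1..m div 2}" "q \<in> {1..m div 2}"
      "f = word [Z p, Z q] - free_scale (lam \<Theta> p q) (word [Z q, Z p])"
    | (BB) p q where "p \<in> {1..m div 2}" "q \<in> {1..m div 2}"
      "f = word [Zb p, Zb q] - free_scale (lam \<Theta> p q) (word [Zb q, Zb p])"
    | (BZ) p q where "p \<in> {1..m div 2}" "q \<in> {1..m div 2}"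
      "f = word [Zb p, Z q] - free_scale (lam \<Theta> q p) (word [Z q, Zb p])"
    | (XZ) p where "odd m" "p \<in> {1..m div 2}" "f = word [X, Z p] - word [Z p, X]"
    using assms unfolding relators_def by (auto split: if_splits)
  then show thesis
  proof cases
    case ZZ then show thesis using that[of "Z p" "Z q"] by (simp add: set_gens free_scale_word)
  next
    case BB then show thesis using that[of "Zb p" "Zb q"] by (simp add: set_gens free_scale_word)
  next
    case BZ then show thesis using that[of "Zb p" "Z q"] by (simp add: set_gens free_scale_word)
  next
    case XZ then show thesis using that[of X "Z p"] by (simp add: set_gens)
  qed
qed

lemma commutator_in_FA:
  "g \<in> L \<Longrightarrow> h \<in> L \<Longrightarrow> word [g, h] - Poly_Mapping.single [h, g] c \<in> carrier FA"
  by (intro diff_in_FA single_in_FA) auto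

text \<open>
  The only case not covered by the definition of \<open>reorder\<close> is that of equal letters, where the scalar
  is 1 by skew-symmetry.
\<close>

lemma monomial_series_swap:
  assumes "g \<in> L" "h \<in> L"
  shows "monomial_series [g, h] k = swap \<Theta> g h * monomial_series [h, g] k"
proof -
  have "R [g, h] = swap \<Theta> g h * R [h, g]"
  proof -
    have "precedes h g \<or> precedes g h \<or> g = h" by (cases g; cases h) auto
    moreover have "swap \<Theta> g g = 1" by (cases g; use assms in \<open>auto simp: set_gens lam_diag\<close>)
    ultimately show ?thesis
      using swap_inverse[OF assms] precedes_asym[of g h] precedes_asym[of h g] by auto
  qed
  then show ?thesis by (simp add: monomial_series_def add_mset_commute)
qed

lemma free_series_relator: "f \<in> relators m \<Theta> \<Longrightarrow> free_series f = 0"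
proof (erule relator_cases)
  fix g h assume gh: "g \<in> L" "h \<in> L" and f: "f = word [g, h] - Poly_Mapping.single [h, g] (swap \<Theta> g h)"
  show "free_series f = 0"
    unfolding f free_series_diff free_series_single by (rule ext) (simp add: monomial_series_swap[OF gh])
qed

lemma relators_in_FA: "relators m \<Theta> \<subseteq> carrier FA"
  by (auto elim!: relator_cases intro: commutator_in_FA)

lemma star_relators_in_FA: "star_relators \<subseteq> carrier FA"
  using relators_in_FA star_in_FA by auto

lemma ideal_I: "ideal I FA"
  unfolding rel_ideal_def by (rule ring.genideal_ideal[OF ring_FA star_relators_in_FA])

lemma star_relators_in_I: "star_relators \<subseteq> I"
  unfolding rel_ideal_def by (rule ring.genideal_self[OF ring_FA star_relators_in_FA])

lemma I_in_FA: "I \<subseteq> carrier FA"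
  by (rule additive_subgroup.a_subset[OF ideal.axioms(1)[OF ideal_I]])

lemma I_add: "f \<in> I \<Longrightarrow> g \<in> I \<Longrightarrow> f + g \<in> I"
  using additive_subgroup.a_closed[OF ideal.axioms(1)[OF ideal_I]] by (simp add: FA_simps)

lemma I_zero: "0 \<in> I"
  using additive_subgroup.zero_closed[OF ideal.axioms(1)[OF ideal_I]] by (simp add: FA_simps)

lemma I_mult_left: "f \<in> carrier FA \<Longrightarrow> g \<in> I \<Longrightarrow> f * g \<in> I"
  using ideal.I_l_closed[OF ideal_I] by (simp add: FA_simps)

lemma I_mult_right: "f \<in> carrier FA \<Longrightarrow> g \<in> I \<Longrightarrow> g * f \<in> I"
  using ideal.I_r_closed[OF ideal_I] by (simp add: FA_simps)

lemma I_scale: "g \<in> I \<Longrightarrow> Poly_Mapping.single [] c * g \<in> I"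
  by (rule I_mult_left[OF single_in_FA]) auto

lemma I_trans: "f - g \<in> I \<Longrightarrow> g - h \<in> I \<Longrightarrow> f - h \<in> I"
  using I_add[of "f - g" "g - h"] by simp

lemma I_sum: "(\<And>x. x \<in> A \<Longrightarrow> f x \<in> I) \<Longrightarrow> (\<Sum>x\<in>A. f x) \<in> I"
  by (induction A rule: infinite_finite_induct) (auto simp: I_zero I_add)

text \<open>
  The kernel of the map to formal series is an ideal, and contains the relators and their stars.
\<close>

lemma I_subset_kernel: "f \<in> I \<Longrightarrow> free_series f = 0"
proof -
  let ?K = "{f \<in> carrier FA. free_series f = 0}"
  have "ideal ?K FA"
  proof (rule idealI[OF ring_FA])
    show "subgroup ?K (add_monoid FA)"
    proof (rule group.subgroupI)
      show "Group.group (add_monoid FA)"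
        by (rule abelian_group.a_group[OF ring.is_abelian_group[OF ring_FA]])
      show "?K \<noteq> {}" using zero_in_FA free_series_0 by blast
      fix f assume f: "f \<in> ?K"
      have "inv\<^bsub>add_monoid FA\<^esub> f = - f"
        by (rule group.inv_equality[OF abelian_group.a_group[OF ring.is_abelian_group[OF ring_FA]]])
          (use f uminus_in_FA in \<open>auto simp: FA_simps\<close>)
      then show "inv\<^bsub>add_monoid FA\<^esub> f \<in> ?K" using f by (simp add: uminus_in_FA free_series_uminus)
      fix g assume "g \<in> ?K"
      with f show "f \<otimes>\<^bsub>add_monoid FA\<^esub> g \<in> ?K" by (simp add: FA_simps add_in_FA free_series_add)
    qed auto
  qed (auto simp: FA_simps mult_in_FA free_series_mult)
  moreover have "star_relators \<subseteq> ?K"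
    using star_relators_in_FA free_series_relator relators_in_FA by (auto simp: free_series_star)
  ultimately have "I \<subseteq> ?K"
    unfolding rel_ideal_def by (rule ring.genideal_minimal[OF ring_FA])
  then show "f \<in> I \<Longrightarrow> free_series f = 0" by blast
qed

lemma relators_intros:
  assumes "p \<in> {1..m div 2}" "q \<in> {1..m div 2}"
  shows "word [Z p, Z q] - Poly_Mapping.single [Z q, Z p] (lam \<Theta> p q) \<in> relators m \<Theta>"
    "word [Zb p, Zb q] - Poly_Mapping.single [Zb q, Zb p] (lam \<Theta> p q) \<in> relators m \<Theta>"
    "word [Zb p, Z q] - Poly_Mapping.single [Z q, Zb p] (lam \<Theta> q p) \<in> relators m \<Theta>"
    "odd m \<Longrightarrow> word [X, Z p] - word [Z p, X] \<in> relators m \<Theta>"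
  unfolding relators_def free_scale_word
     apply (rule UnI1, rule UN_I[OF assms(1)], rule UN_I[OF assms(2)], simp only: insert_iff simp_thms)
    apply (rule UnI1, rule UN_I[OF assms(1)], rule UN_I[OF assms(2)], simp only: insert_iff simp_thms)
   apply (rule UnI1, rule UN_I[OF assms(1)], rule UN_I[OF assms(2)], simp only: insert_iff simp_thms)
  by (rule UnI2, simp only: if_True simp_thms, rule CollectI, rule exI[of _ p])
    (simp only: assms(1) simp_thms)

text \<open>
  Not all pairs of letters occur in the relators in both orders, and $x$ commutes with $\bar z_p$ only
  by the star of a relator. The other order follows by scaling, since the two
  scalars are inverse to each other.
\<close>

lemma commutation_in_I:
  assumes "g \<in> L" "h \<in> L"
  shows "word [g, h] - Poly_Mapping.single [h, g] (swap \<Theta> g h) \<in> I"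
proof -
  have flip: "word [g, h] - Poly_Mapping.single [h, g] (swap \<Theta> g h) \<in> I"
    if "word [h, g] - Poly_Mapping.single [g, h] (swap \<Theta> h g) \<in> I" "g \<in> L" "h \<in> L" for g h
  proof -
    have "Poly_Mapping.single [] (- swap \<Theta> g h) * (word [h, g] - Poly_Mapping.single [g, h] (swap \<Theta> h g)) =
        word [g, h] - Poly_Mapping.single [h, g] (swap \<Theta> g h)"
      by (simp add: right_diff_distrib mult_single plus_list_def swap_inverse that single_uminus)
    then show ?thesis using I_scale[OF that(1), of "- swap \<Theta> g h"] by simp
  qed
  have XZ: "word [X, Z p] - word [Z p, X] \<in> I" and XB: "word [Zb p, X] - word [X, Zb p] \<in> I"
    if "odd m" "p \<in> {1..m div 2}" for p
  proof -
    have r: "word [X, Z p] - word [Z p, X] \<in> relators m \<Theta>"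
      using relators_intros(4)[of p p] that by blast
    then show "word [X, Z p] - word [Z p, X] \<in> I" using star_relators_in_I by blast
    have "free_star (word [X, Z p] - word [Z p, X]) = word [Zb p, X] - word [X, Zb p]"
      by (simp add: free_star_diff free_star_single star_word_def)
    then show "word [Zb p, X] - word [X, Zb p] \<in> I"
      using subsetD[OF star_relators_in_I, OF UnI2, OF imageI[OF r]] by simp
  qed
  have rel: "f \<in> relators m \<Theta> \<Longrightarrow> f \<in> I" for f using star_relators_in_I by blast
  show ?thesis
  proof (cases g)
    case g: X
    show ?thesis
    proof (cases h)
      case h: X
      show ?thesis unfolding g h by (simp add: I_zero)
    next
      case h: (Z q)
      show ?thesis unfolding g h using XZ[of q] assms g h by (simp add: set_gens)
    next
      case h: (Zb q)
      show ?thesis unfolding g h using flip[where g = X and h = "Zb q"] XB[of q] assms g h by (simp add: set_gens)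
    qed
  next
    case g: (Z p)
    show ?thesis
    proof (cases h)
      case h: X
      show ?thesis unfolding g h using flip[where g = "Z p" and h = X] XZ[of p] assms g h by (simp add: set_gens)
    next
      case h: (Z q)
      show ?thesis unfolding g h
        using rel[OF relators_intros(1)[of p q]] assms unfolding g h by (simp add: set_gens)
    next
      case h: (Zb q)
      have "word [Zb q, Z p] - Poly_Mapping.single [Z p, Zb q] (swap \<Theta> (Zb q) (Z p)) \<in> I"
        using rel[OF relators_intros(3)[of q p]] assms unfolding g h by (simp add: set_gens)
      then show ?thesis using flip[where g = "Z p" and h = "Zb q"] assms unfolding g h by simp
    qed
  next
    case g: (Zb p)
    show ?thesis
    proof (cases h)
      case h: X
      show ?thesis unfolding g h using XB[of p] assms g h by (simp add: set_gens)
    next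
      case h: (Z q)
      show ?thesis unfolding g h
        using rel[OF relators_intros(3)[of p q]] assms unfolding g h by (simp add: set_gens)
    next
      case h: (Zb q)
      show ?thesis unfolding g h
        using rel[OF relators_intros(2)[of p q]] assms unfolding g h by (simp add: set_gens)
    qed
  qed
qed

lemma move_right_in_I:
  assumes "g \<in> L" "set v \<subseteq> L" "set w \<subseteq> L"
  shows "word (g # v @ w) - Poly_Mapping.single (v @ g # w) (prod_list (map (swap \<Theta> g) v)) \<in> I"
  using assms(2)
proof (induction v)
  case Nil
  show ?case by (simp add: I_zero)
next
  case (Cons h v)
  let ?p = "prod_list (map (swap \<Theta> g) v)"
  have "(word [g, h] - Poly_Mapping.single [h, g] (swap \<Theta> g h)) * word (v @ w) \<in> I"
    by (rule I_mult_right[OF single_in_FA commutation_in_I]) (use Cons.prems assms in auto)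
  then have 1: "word (g # h # v @ w) - Poly_Mapping.single (h # g # v @ w) (swap \<Theta> g h) \<in> I"
    by (simp add: left_diff_distrib mult_single plus_list_def)
  have "Poly_Mapping.single [h] (swap \<Theta> g h) * (word (g # v @ w) - Poly_Mapping.single (v @ g # w) ?p) \<in> I"
    by (rule I_mult_left[OF single_in_FA Cons.IH]) (use Cons.prems in auto)
  then have 2: "Poly_Mapping.single (h # g # v @ w) (swap \<Theta> g h) -
      Poly_Mapping.single (h # v @ g # w) (swap \<Theta> g h * ?p) \<in> I"
    by (simp add: right_diff_distrib mult_single plus_list_def)
  show ?case using I_add[OF 1 2] by simp
qed

text \<open>
  The letters of the monomial that precede \<open>g\<close> form an initial segment, past which \<open>g\<close> has to be
  moved.
\<close>

lemma insert_in_monomial: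
  assumes g: "g \<in> L"
  shows "word (g # stdm k) - Poly_Mapping.single (stdm (k(g := Suc (k g))))
      (prod_list (map (swap \<Theta> g) (filter (\<lambda>h. precedes h g) (stdm k)))) \<in> I"
proof -
  obtain L1 L2 where gens: "gens m = L1 @ g # L2" using g by (meson split_list)
  have d: "g \<notin> set L1" "g \<notin> set L2" using distinct_gens[of m] by (auto simp: gens)
  have L1: "precedes h g" if "h \<in> set L1" for h
    using sorted_gens[of m] that by (auto simp: gens sorted_wrt_append)
  have L2: "\<not> precedes h g" if "h \<in> set L2" for h
    using sorted_gens[of m] that by (auto simp: gens sorted_wrt_append precedes_asym)
  define A where "A = concat (map (\<lambda>h. replicate (k h) h) L1)"
  define B where "B = concat (map (\<lambda>h. replicate (k h) h) L2)"
  have std: "stdm k = A @ replicate (k g) g @ B"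
    by (simp add: monomial_def gens A_def B_def)
  have upd: "map (\<lambda>h. replicate ((k(g := Suc (k g))) h) h) L' = map (\<lambda>h. replicate (k h) h) L'"
    if "g \<notin> set L'" for L'
    by (rule map_cong) (use that in auto)
  have std': "stdm (k(g := Suc (k g))) = A @ g # replicate (k g) g @ B"
    unfolding monomial_def gens map_append concat_append list.map concat.simps
      upd[OF d(1)] upd[OF d(2)] A_def B_def by simp
  have "filter (\<lambda>h. precedes h g) A = A"
    by (rule filter_True) (auto simp: A_def L1)
  moreover have "filter (\<lambda>h. precedes h g) (replicate (k g) g @ B) = []"
    by (rule filter_False) (auto simp: B_def L2)
  ultimately have fil: "filter (\<lambda>h. precedes h g) (stdm k) = A"
    unfolding std filter_append by simp
  show ?thesis
    unfolding fil std' unfolding std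
  proof (rule move_right_in_I[OF g])
    show "set A \<subseteq> L" "set (replicate (k g) g @ B) \<subseteq> L"
      using set_monomial[of m k] unfolding std by auto
  qed
qed

text \<open>
  Insertion sort, from the right end of the word.
\<close>

lemma word_normal_form:
  assumes "set w \<subseteq> L"
  shows "word w - Poly_Mapping.single (stdm (count (mset w))) (R w) \<in> I"
  using assms
proof (induction w)
  case Nil
  have e: "stdm (count (mset [])) = []" by (simp add: monomial_def)
  show ?case unfolding e by (simp add: I_zero)
next
  case (Cons g w)
  let ?k = "count (mset w)" and ?k' = "count (mset (g # w))"
  have w: "set w \<subseteq> L" and g: "g \<in> L" using Cons.prems by auto
  have k': "?k' = ?k(g := Suc (?k g))" by (rule ext) simp
  let ?f = "\<lambda>w. prod_list (map (swap \<Theta> g) (filter (\<lambda>h. precedes h g) w))"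
  have f: "?f (stdm ?k) = ?f w"
    unfolding prod_list_map_mset mset_filter
    by (simp add: mset_eq_monomialI[OF count_word_in_multiindices[OF w] refl])
  have "word [g] * (word w - Poly_Mapping.single (stdm ?k) (R w)) \<in> I"
    by (rule I_mult_left[OF single_in_FA Cons.IH[OF w]]) (use g in auto)
  then have 1: "word (g # w) - Poly_Mapping.single (g # stdm ?k) (R w) \<in> I"
    by (simp add: right_diff_distrib mult_single plus_list_def)
  have "Poly_Mapping.single [] (R w) * (word (g # stdm ?k) -
      Poly_Mapping.single (stdm ?k') (?f w)) \<in> I"
    using I_scale[OF insert_in_monomial[OF g, of ?k], of "R w"] unfolding f k' .
  then have 2: "Poly_Mapping.single (g # stdm ?k) (R w) -
      Poly_Mapping.single (stdm ?k') (R (g # w)) \<in> I"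
    by (simp add: right_diff_distrib mult_single plus_list_def mult.commute)
  show ?case by (rule I_trans[OF 1 2])
qed

text \<open>
  Modulo the ideal an element is the linear combination of standard monomials whose coefficients
  are those of its formal series.
\<close>

lemma kernel_subset_I:
  assumes f: "f \<in> carrier FA" and free_series: "free_series f = 0"
  shows "f \<in> I"
proof -
  let ?W = "Poly_Mapping.keys f" and ?c = "\<lambda>w. count (mset w)" and ?l = "Poly_Mapping.lookup f"
  let ?n = "\<lambda>w. Poly_Mapping.single (stdm (?c w)) (?l w * R w)"
  have "(\<Sum>w\<in>?W. Poly_Mapping.single w (?l w) - ?n w) \<in> I"
  proof (rule I_sum)
    fix w assume "w \<in> ?W"
    then have w: "set w \<subseteq> L" using f by (auto simp: carrier_FA)
    have "Poly_Mapping.single [] (?l w) * (word w - Poly_Mapping.single (stdm (?c w)) (R w)) \<in> I"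
      by (rule I_scale[OF word_normal_form[OF w]])
    then show "Poly_Mapping.single w (?l w) - ?n w \<in> I"
      by (simp add: right_diff_distrib mult_single plus_list_def)
  qed
  then have 1: "f - (\<Sum>w\<in>?W. ?n w) \<in> I"
    by (simp add: sum_subtractf sum_singles)
  have "(\<Sum>w\<in>?W. ?n w) = (\<Sum>k\<in>?c ` ?W. \<Sum>w\<in>{w \<in> ?W. ?c w = k}. ?n w)"
    by (rule sum.image_gen) simp
  also have "\<dots> = (\<Sum>k\<in>?c ` ?W. Poly_Mapping.single (stdm k) (free_series f k))"
  proof (rule sum.cong[OF refl])
    fix k
    have "(\<Sum>w\<in>{w \<in> ?W. ?c w = k}. ?n w) =
        Poly_Mapping.single (stdm k) (\<Sum>w\<in>{w \<in> ?W. ?c w = k}. ?l w * R w)"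
      by (simp add: single_sum)
    also have "(\<Sum>w\<in>{w \<in> ?W. ?c w = k}. ?l w * R w) = free_series f k"
      unfolding free_series_def monomial_series_def
      by (rule sum.mono_neutral_cong_left) auto
    finally show "(\<Sum>w\<in>{w \<in> ?W. ?c w = k}. ?n w) = Poly_Mapping.single (stdm k) (free_series f k)" .
  qed
  also have "\<dots> = 0" unfolding free_series by simp
  finally show ?thesis using 1 by simp
qed

lemma I_eq_kernel: "f \<in> I \<longleftrightarrow> f \<in> carrier FA \<and> free_series f = 0"
  using I_subset_kernel kernel_subset_I I_in_FA by blast

end

context skew_parameter
begin

section \<open>The polynomial algebra and the main result\<close>

abbreviation "CA \<equiv> C_alg m \<Theta>"

definition cls :: "free \<Rightarrow> free set" where
  "cls f = {f' \<in> carrier FA. free_series f' = free_series f}"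

text \<open>
  The series takes the same value on all elements of a coset of the ideal, so it does not matter
  which one is chosen.
\<close>

definition coset_series :: "free set \<Rightarrow> multiindex \<Rightarrow> complex" where
  "coset_series C = free_series (SOME f. f \<in> C)"

text \<open>
  Since the relation ideal is the kernel of \<open>free_series\<close>, its cosets are the fibres.
\<close>

lemma coset_eq_cls:
  assumes f: "f \<in> carrier FA"
  shows "I +>\<^bsub>FA\<^esub> f = cls f"
proof -
  have "I +>\<^bsub>FA\<^esub> f = (\<lambda>h. h + f) ` I"
    by (auto simp: a_r_coset_def' FA_simps)
  also have "\<dots> = cls f"
  proof (intro equalityI subsetI)
    fix x assume "x \<in> (\<lambda>h. h + f) ` I"
    then obtain h where h: "h \<in> carrier FA" "free_series h = 0" "x = h + f" by (auto simp: I_eq_kernel)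
    then show "x \<in> cls f" by (simp add: cls_def add_in_FA f free_series_add)
  next
    fix x assume "x \<in> cls f"
    then have x: "x \<in> carrier FA" "free_series x = free_series f" by (auto simp: cls_def)
    then have "x - f \<in> I" by (simp add: I_eq_kernel diff_in_FA f free_series_diff)
    then show "x \<in> (\<lambda>h. h + f) ` I" by (rule image_eqI[rotated]) simp
  qed
  finally show ?thesis .
qed

lemma cls_self: "f \<in> carrier FA \<Longrightarrow> f \<in> cls f"
  by (simp add: cls_def)

lemma cls_eq_iff: "f \<in> carrier FA \<Longrightarrow> cls f = cls g \<longleftrightarrow> free_series f = free_series g"
  by (auto simp: cls_def)

lemma coset_series_cls:
  assumes "f \<in> carrier FA"
  shows "coset_series (cls f) = free_series f"
proof -
  have "(SOME g. g \<in> cls f) \<in> cls f" by (rule someI[of "\<lambda>g. g \<in> cls f", OF cls_self[OF assms]])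
  then show ?thesis by (simp add: coset_series_def cls_def)
qed

lemma carrier_CA: "carrier CA = cls ` carrier FA"
  by (auto simp: C_alg_def FactRing_def A_RCOSETS_def' coset_eq_cls)

lemma CA_zero: "\<zero>\<^bsub>CA\<^esub> = cls 0"
proof -
  have "I = cls 0" by (auto simp: cls_def I_eq_kernel)
  then show ?thesis by (simp add: C_alg_def FactRing_def)
qed

lemma CA_one: "\<one>\<^bsub>CA\<^esub> = cls 1"
  using coset_eq_cls[OF one_in_FA] by (simp add: C_alg_def FactRing_def FA_simps)

lemma CA_mult:
  assumes "f \<in> carrier FA" "g \<in> carrier FA"
  shows "cls f \<otimes>\<^bsub>CA\<^esub> cls g = cls (f * g)"
proof -
  have "rcoset_mult FA I (I +>\<^bsub>FA\<^esub> f) (I +>\<^bsub>FA\<^esub> g) = I +>\<^bsub>FA\<^esub> (f \<otimes>\<^bsub>FA\<^esub> g)"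
    by (rule ideal.rcoset_mult_add[OF ideal_I assms])
  then show ?thesis
    by (simp add: C_alg_def FactRing_def FA_simps coset_eq_cls assms mult_in_FA)
qed

lemma CA_add:
  assumes "f \<in> carrier FA" "g \<in> carrier FA"
  shows "cls f \<oplus>\<^bsub>CA\<^esub> cls g = cls (f + g)"
proof -
  have "(I +>\<^bsub>FA\<^esub> f) <+>\<^bsub>FA\<^esub> (I +>\<^bsub>FA\<^esub> g) = I +>\<^bsub>FA\<^esub> (f \<oplus>\<^bsub>FA\<^esub> g)"
    by (rule abelian_subgroup.a_rcos_sum[OF abelian_subgroupI3[OF ideal.axioms(1)[OF ideal_I]
            ring.is_abelian_group[OF ring_FA]] assms])
  then show ?thesis
    by (simp add: C_alg_def FactRing_def FA_simps coset_eq_cls assms add_in_FA)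
qed

lemma CA_star:
  assumes f: "f \<in> carrier FA"
  shows "star CA (cls f) = cls (free_star f)"
proof -
  have "free_star ` cls f = cls (free_star f)"
  proof (intro equalityI subsetI)
    fix x assume "x \<in> free_star ` cls f"
    then obtain g where g: "g \<in> carrier FA" "free_series g = free_series f" "x = free_star g" by (auto simp: cls_def)
    then show "x \<in> cls (free_star f)" by (simp add: cls_def star_in_FA free_series_star f)
  next
    fix x assume "x \<in> cls (free_star f)"
    then have x: "x \<in> carrier FA" "free_series x = free_series (free_star f)" by (auto simp: cls_def)
    have "free_series (free_star x) = free_series (free_star (free_star f))"
      using x by (simp only: free_series_star star_in_FA f)
    then have "free_star x \<in> cls f" using x(1) by (simp add: cls_def star_in_FA free_star_free_star)
    then show "x \<in> free_star ` cls f"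
      by (rule image_eqI[rotated]) (simp add: free_star_free_star)
  qed
  then show ?thesis by (simp add: C_alg_def)
qed

lemma const_eq_free_series: "const c = free_series (Poly_Mapping.single [] c)"
proof
  fix k :: multiindex
  have "count (mset []) = (0 :: multiindex)" by (rule ext) simp
  then show "const c k = free_series (Poly_Mapping.single [] c) k"
    unfolding free_series_single monomial_series_def const_def by simp
qed

lemma C_alg_representation: "series_representation m \<Theta> CA coset_series"
proof (intro series_representation.intro skew_parameter_axioms series_representation_axioms.intro)
  show "\<zero>\<^bsub>CA\<^esub> \<in> carrier CA" "\<one>\<^bsub>CA\<^esub> \<in> carrier CA"
    unfolding CA_zero CA_one carrier_CA using zero_in_FA one_in_FA by blast+
  show "inj_on coset_series (carrier CA)"
  proof (rule inj_onI)
    fix C D assume "C \<in> carrier CA" "D \<in> carrier CA" and eq: "coset_series C = coset_series D"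
    then obtain f g where "f \<in> carrier FA" "g \<in> carrier FA" "C = cls f" "D = cls g"
      by (auto simp: carrier_CA)
    with eq show "C = D" by (simp only: coset_series_cls cls_eq_iff)
  qed
  show "coset_series \<zero>\<^bsub>CA\<^esub> = 0" unfolding CA_zero coset_series_cls[OF zero_in_FA] by (rule free_series_0)
  show "coset_series \<one>\<^bsub>CA\<^esub> = const 1"
    unfolding CA_one coset_series_cls[OF one_in_FA] by (simp only: const_eq_free_series one_eq_single)
next
  fix a assume "a \<in> carrier CA"
  then obtain f where f: "f \<in> carrier FA" "a = cls f" by (auto simp: carrier_CA)
  show "star CA a \<in> carrier CA"
    unfolding f(2) CA_star[OF f(1)] carrier_CA using star_in_FA[OF f(1)] by blast
  show "coset_series a k = 0" if "k \<notin> MI" for k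
    unfolding f(2) coset_series_cls[OF f(1)] by (rule free_series_support[OF f(1) that])
  show "coset_series (star CA a) = series_star (coset_series a)"
    unfolding f(2) CA_star[OF f(1)] coset_series_cls[OF f(1)] coset_series_cls[OF star_in_FA[OF f(1)]]
    by (rule free_series_star[OF f(1)])
  fix b assume "b \<in> carrier CA"
  then obtain g where g: "g \<in> carrier FA" "b = cls g" by (auto simp: carrier_CA)
  show "a \<oplus>\<^bsub>CA\<^esub> b \<in> carrier CA"
    unfolding f(2) g(2) CA_add[OF f(1) g(1)] carrier_CA using add_in_FA[OF f(1) g(1)] by blast
  show "a \<otimes>\<^bsub>CA\<^esub> b \<in> carrier CA"
    unfolding f(2) g(2) CA_mult[OF f(1) g(1)] carrier_CA using mult_in_FA[OF f(1) g(1)] by blast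
  show "coset_series (a \<oplus>\<^bsub>CA\<^esub> b) = coset_series a + coset_series b"
    unfolding f(2) g(2) CA_add[OF f(1) g(1)] coset_series_cls[OF f(1)] coset_series_cls[OF g(1)]
      coset_series_cls[OF add_in_FA[OF f(1) g(1)]] by (rule free_series_add)
  show "coset_series (a \<otimes>\<^bsub>CA\<^esub> b) = conv (coset_series a) (coset_series b)"
    unfolding f(2) g(2) CA_mult[OF f(1) g(1)] coset_series_cls[OF f(1)] coset_series_cls[OF g(1)]
      coset_series_cls[OF mult_in_FA[OF f(1) g(1)]] by (rule free_series_mult[OF f(1) g(1)])
next
  fix N p
  assume p: "M.projection N p" and ent: "\<forall>a<N. \<forall>b<N. p a b \<in> coset_series ` carrier CA"
  have sp: "M.supported N p" using p by (simp only: M.projection_def)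
  have fin: "finite {k. p a b k \<noteq> 0}" if "a < N" "b < N" for a b
  proof -
    have "p a b \<in> coset_series ` cls ` carrier FA" using ent that unfolding carrier_CA by blast
    then obtain f where f: "f \<in> carrier FA" "p a b = coset_series (cls f)" by blast
    show ?thesis unfolding f(2) coset_series_cls[OF f(1)] by (rule free_series_finite_support)
  qed
  have "{k. \<exists>a b. p a b k \<noteq> 0} \<subseteq> (\<Union>a<N. \<Union>b<N. {k. p a b k \<noteq> 0})"
    using sp unfolding M.supported_def by blast
  then have "finite {k. \<exists>a b. p a b k \<noteq> 0}"
    by (rule finite_subset) (auto intro!: finite_UN_I fin)
  from M.finite_support_projection_constant[OF p this]
  have pc: "p = M.cmat N (\<lambda>a b. p a b 0)" .
  have "M.projection N (M.cmat N (\<lambda>a b. p a b 0))" using p pc by simp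
  then obtain C r where C: "M.unitary N (M.cmat N C)"
    "M.cmat N (\<lambda>a b. p a b 0) = M.mul N (M.mul N (M.cmat N C) (M.diag_one N r)) (M.adj (M.cmat N C))"
    "M.tr N (M.cmat N (\<lambda>a b. p a b 0)) = of_nat r"
    by (rule M.constant_projection_diagonalize)
  have "const c \<in> coset_series ` carrier CA" for c
  proof -
    have s: "Poly_Mapping.single [] c \<in> carrier FA" by (rule single_in_FA) simp
    then have "const c = coset_series (cls (Poly_Mapping.single [] c))"
      by (simp only: coset_series_cls const_eq_free_series)
    then show ?thesis using s by (auto simp: carrier_CA)
  qed
  then have "\<forall>a<N. \<forall>b<N. M.cmat N C a b \<in> coset_series ` carrier CA"
    by (simp add: M.cmat_def)
  then show "\<exists>u r. M.unitary N u \<and> (\<forall>a<N. \<forall>b<N. u a b \<in> coset_series ` carrier CA) \<and>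
      p = M.mul N (M.mul N u (M.diag_one N r)) (M.adj u) \<and> M.tr N p = of_nat r"
    using C unfolding pc[symmetric] by (intro exI conjI)
qed

end

theorem theorem1p1:
  fixes m :: nat and \<Theta> :: "nat \<Rightarrow> nat \<Rightarrow> real"
  assumes "m \<ge> 1"
    and "\<And>p q. p \<in> {1..m div 2} \<Longrightarrow> q \<in> {1..m div 2} \<Longrightarrow> \<Theta> p q = - \<Theta> q p"
  shows "K0 (C_alg m \<Theta>) \<cong> integer_group \<and> K0 (C_smooth m \<Theta>) \<cong> integer_group"
proof -
  interpret skew_parameter m \<Theta> using assms(2) by (rule skew_parameter.intro)
  show ?thesis
    using series_representation.K0_iso_integers[OF C_alg_representation]
      series_representation.K0_iso_integers[OF C_smooth_representation] by blast
qed

end
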